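(* Let $\nu\ge2$ and suppose that the kernel of the second differential at the origin of a smooth even function $f:\mathbb R^\nu\to\mathbb R$ (variables $k_1,\dots,k_\nu$) coincides with the coordinate plane $Ok_1k_2$. Put $$A=\frac1{4!}\frac{\partial^4f(0)}{\partial k_1^4},\ B=\frac1{3!}\frac{\partial^4f(0)}{\partial k_1^3\partial k_2},\ C=\frac14\frac{\partial^4f(0)}{\partial k_1^2\partial k_2^2},\ D=\frac1{3!}\frac{\partial^4f(0)}{\partial k_1\partial k_2^3},\ E=\frac1{4!}\frac{\partial^4f(0)}{\partial k_2^4},$$ $$\Delta_4=-4(AC^3D^2+B^3D^3+B^2C^3E)-27(A^2D^4+B^4E^2)+B^2C^2D^2+18(ABCD^3+B^3CDE)$$ $$+144(A^2CD^2E+AB^2CE^2)-6AB^2D^2E-80ABC^2DE-192A^2BDE^2+16AE(C^2-4AE)^2 .$$ Then the even germ of $f$ at the origin has an even singularity of class $X_{e,5}^{\pm\pm}$ (for some choice of signs) if and only if $\Delta_4\neq0$. Moreover, $f\in X_{e,5}^{++}\cup X_{e,5}^{--}$ if $\Delta_4>0$, and $f\in X_{e,5}^{+-}$ if $\Delta_4<0$.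
   Context: An even germ $f$ at $0\in\mathbb R^\nu$ has an even singularity of class $X_{e,5}^{\sigma\tau}$, $\sigma,\tau\in\{+,-\}$, if there is a germ of odd diffeomorphism ($h(-x)=-h(x)$) of $(\mathbb R^\nu,0)$ after which $f=\mathrm{const}+\sigma x_1^4+a x_1^2x_2^2+\tau x_2^4+Q(x_3,\dots,x_\nu)$, where $Q$ is a nondegenerate quadratic form and $a\in\mathbb R$, with $a^2\neq4$ if $\sigma=\tau$. (The classes $X_{e,5}^{+-}$ and $X_{e,5}^{-+}$ coincide.) *)

theory Defs
  imports "HOL-Analysis.Analysis"
begin

section \<open>Smooth maps and partial derivatives\<close>

text \<open>Only meant for open \<open>S\<close>: the Frechet derivative at a point of an open set depends
  only on the values of the map on that set.\<close>

primrec C_times_on :: "nat \<Rightarrow> 'a::real_normed_vector set \<Rightarrow> ('a \<Rightarrow> 'b::real_normed_vector) \<Rightarrow> bool" where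
  "C_times_on 0 S f \<longleftrightarrow> continuous_on S f"
| "C_times_on (Suc n) S f \<longleftrightarrow>
     (\<forall>x\<in>S. f differentiable (at x)) \<and>
     (\<forall>v. C_times_on n S (\<lambda>x. frechet_derivative f (at x) v))"

definition smooth_map_on :: "'a::real_normed_vector set \<Rightarrow> ('a \<Rightarrow> 'b::real_normed_vector) \<Rightarrow> bool" where
  "smooth_map_on S f \<longleftrightarrow> (\<forall>n. C_times_on n S f)"

definition partial_deriv :: "'n::finite \<Rightarrow> (real ^ 'n \<Rightarrow> real) \<Rightarrow> real ^ 'n \<Rightarrow> real" where
  "partial_deriv i f x = deriv (\<lambda>t. f (x + t *\<^sub>R axis i 1)) 0"

definition second_differential ::
    "('a::real_normed_vector \<Rightarrow> real) \<Rightarrow> 'a \<Rightarrow> 'a \<Rightarrow> 'a \<Rightarrow> real" where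
  "second_differential f x u v =
     frechet_derivative (\<lambda>y. frechet_derivative f (at y) u) (at x) v"

section \<open>Bilinear and quadratic forms\<close>

definition bilinear_kernel :: "('a \<Rightarrow> 'a \<Rightarrow> real) \<Rightarrow> 'a set" where
  "bilinear_kernel b = {u. \<forall>v. b u v = 0}"

definition nondegenerate_quadratic_form_on :: "'a::real_vector set \<Rightarrow> ('a \<Rightarrow> real) \<Rightarrow> bool" where
  "nondegenerate_quadratic_form_on W Q \<longleftrightarrow>
     (\<exists>b. bilinear b \<and> (\<forall>u v. b u v = b v u) \<and> (\<forall>u\<in>W. Q u = b u u) \<and>
          (\<forall>u\<in>W. (\<forall>v\<in>W. b u v = 0) \<longrightarrow> u = 0))"

section \<open>The even singularity classes\<close>

text \<open>The first two coordinates are the ones with (distinct) indices \<open>i\<close> and \<open>j\<close>. A function of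
  the remaining coordinates is represented as a function on \<open>other_coords i j\<close>, composed with
  the coordinate projection \<open>proj_other i j\<close>.\<close>

definition coord_plane :: "'n::finite \<Rightarrow> 'n \<Rightarrow> (real ^ 'n) set" where
  "coord_plane i j = span {axis i 1, axis j 1}"

definition other_coords :: "'n::finite \<Rightarrow> 'n \<Rightarrow> (real ^ 'n) set" where
  "other_coords i j = {x. x $ i = 0 \<and> x $ j = 0}"

definition proj_other :: "'n::finite \<Rightarrow> 'n \<Rightarrow> real ^ 'n \<Rightarrow> real ^ 'n" where
  "proj_other i j x = (\<chi> p. if p = i \<or> p = j then 0 else x $ p)"

text \<open>\<open>h\<close> represents a germ at \<open>0\<close> of odd diffeomorphism; \<open>h 0 = 0\<close> follows from oddness.\<close>

definition odd_diffeo :: "'a::real_normed_vector set \<Rightarrow> 'a set \<Rightarrow> ('a \<Rightarrow> 'a) \<Rightarrow> bool" where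
  "odd_diffeo U V h \<longleftrightarrow>
     open U \<and> open V \<and> 0 \<in> U \<and> bij_betw h U V \<and>
     smooth_map_on U h \<and> smooth_map_on V (inv_into U h) \<and>
     (\<forall>x\<in>U. - x \<in> U \<and> h (- x) = - h x)"

text \<open>The signs \<open>\<sigma>\<close> and \<open>\<tau>\<close> are represented by the reals \<open>1\<close> and \<open>-1\<close>.\<close>

definition X_e5 :: "'n::finite \<Rightarrow> 'n \<Rightarrow> real \<Rightarrow> real \<Rightarrow> (real ^ 'n \<Rightarrow> real) set" where
  "X_e5 i j \<sigma> \<tau> =
     {f. (\<forall>\<^sub>F x in nhds 0. f (- x) = f x) \<and>
         (\<exists>U V h a c Q. odd_diffeo U V h \<and>
            nondegenerate_quadratic_form_on (other_coords i j) Q \<and>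
            (\<sigma> = \<tau> \<longrightarrow> a\<^sup>2 \<noteq> 4) \<and>
            (\<forall>x\<in>U. f (h x) = c + \<sigma> * (x $ i) ^ 4 + a * (x $ i)\<^sup>2 * (x $ j)\<^sup>2 + \<tau> * (x $ j) ^ 4
                     + Q (proj_other i j x)))}"

definition Delta4 :: "real \<Rightarrow> real \<Rightarrow> real \<Rightarrow> real \<Rightarrow> real \<Rightarrow> real" where
  "Delta4 A B C D E =
     - 4 * (A * C^3 * D^2 + B^3 * D^3 + B^2 * C^3 * E) - 27 * (A^2 * D^4 + B^4 * E^2)
     + B^2 * C^2 * D^2 + 18 * (A * B * C * D^3 + B^3 * C * D * E)
     + 144 * (A^2 * C * D^2 * E + A * B^2 * C * E^2) - 6 * A * B^2 * D^2 * E
     - 80 * A * B * C^2 * D * E - 192 * A^2 * B * D * E^2 + 16 * A * E * (C^2 - 4 * A * E)^2"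

end

theory Submission
  imports Defs
begin

text \<open>Write \<open>z\<close> for the coordinates other than \<open>x, y\<close>. Taylor expansion with integral remainder gives
  \<open>f = f(0) + q(x, y) + (quintic monomials times odd functions) + (cubic monomials times even functions) z + z S z\<close>
  with \<open>q\<close> the quartic form of the statement: evenness and the kernel condition remove all lower terms.
  If the discriminant of \<open>q\<close> does not vanish, \<open>f = N \<circ> \<psi>\<close> with \<open>N = f(0) + q(x, y) + z S(0) z\<close> is
  solved by \<open>\<psi> = id + (u, v, M z + cubic)\<close>, where \<open>u, v\<close> are quadratic forms in \<open>x, y\<close> and all
  coefficients are unknown functions. Comparing the coefficients of the quintic monomials, of the cubic
  monomials times \<open>z\<close> and of the products \<open>z\<^sub>b z\<^sub>c\<close> gives as many equations as unknowns, with an invertible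
  linearisation: in \<open>u, v\<close> it is the Sylvester matrix of the two derivatives of \<open>q\<close>. So the implicit
  function theorem applies, without any flow or finite determinacy argument, and its uniqueness part
  makes \<open>\<psi>\<close> odd. A linear change of \<open>x, y\<close> then brings \<open>q\<close> to normal form.

  Conversely, if \<open>f \<circ> h\<close> is a normal form, comparing the terms of order 2 and 4 of \<open>f(h(t x))\<close> as
  \<open>t\<close> tends to 0 shows that the derivative of \<open>h\<close> at 0 preserves the plane and carries \<open>q\<close> to the quartic
  part of the normal form. The discriminant is a relative invariant, so that of \<open>q\<close> is nonzero.\<close>

section \<open>Calculus of smooth maps\<close>

lemma C_times_on_cong:
  assumes "open S" "\<And>x. x \<in> S \<Longrightarrow> f x = g x" "C_times_on n S f"
  shows "C_times_on n S g"
  using assms(2,3)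
proof (induction n arbitrary: f g)
  case 0
  then show ?case using continuous_on_cong[of S S f g] by simp
next
  case (Suc n)
  have df: "f differentiable (at x)" if "x \<in> S" for x using Suc.prems that by simp
  have dg: "(g has_derivative frechet_derivative f (at x)) (at x)" if "x \<in> S" for x
    using frechet_derivative_works[THEN iffD1, OF df[OF that]] assms(1) that Suc.prems(1)
    by (rule has_derivative_transform_within_open)
  have eq: "frechet_derivative f (at x) = frechet_derivative g (at x)" if "x \<in> S" for x
    using dg[OF that] by (rule frechet_derivative_at)
  have "C_times_on n S (\<lambda>x. frechet_derivative g (at x) v)" for v
    by (rule Suc.IH[of "\<lambda>x. frechet_derivative f (at x) v"]) (use Suc.prems eq in auto)
  then show ?case using dg by (auto simp: differentiable_def)
qed

lemma C_times_on_SucI: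
  assumes "open S" "\<And>x. x \<in> S \<Longrightarrow> (f has_derivative f' x) (at x)"
    and "\<And>v. C_times_on n S (\<lambda>x. f' x v)"
  shows "C_times_on (Suc n) S f"
proof -
  have eq: "f' x = frechet_derivative f (at x)" if "x \<in> S" for x
    using assms(2)[OF that] by (rule frechet_derivative_at)
  have "C_times_on n S (\<lambda>x. frechet_derivative f (at x) v)" for v
    by (rule C_times_on_cong[OF assms(1) _ assms(3)[of v]]) (simp add: eq)
  then show ?thesis using assms(2) by (auto simp: differentiable_def)
qed

lemma C_times_on_subset: "C_times_on n S f \<Longrightarrow> T \<subseteq> S \<Longrightarrow> C_times_on n T f"
  by (induction n arbitrary: f) (auto intro: continuous_on_subset)

lemma C_times_on_SucD: "C_times_on (Suc n) S f \<Longrightarrow> C_times_on n S f"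
proof (induction n arbitrary: f)
  case 0
  then show ?case
    using continuous_at_imp_continuous_on differentiable_imp_continuous_within
    by (metis C_times_on.simps)
qed simp

lemma C_times_on_const: "C_times_on n S (\<lambda>x. c)"
proof (induction n arbitrary: c)
  case (Suc n)
  have "frechet_derivative (\<lambda>x::'a. c) (at x) = (\<lambda>v. 0)" for x
    by (simp add: frechet_derivative_const)
  then show ?case using Suc by simp
qed simp

lemma C_times_on_linear:
  assumes "bounded_linear f"
  shows "C_times_on n S f"
proof (cases n)
  case 0
  then show ?thesis using assms by (simp add: linear_continuous_on)
next
  case (Suc m)
  have "(f has_derivative f) (at x)" for x
    using assms by (rule bounded_linear_imp_has_derivative)
  then have "frechet_derivative f (at x) = f" for x
    using frechet_derivative_at by metis
  then show ?thesis using assms Suc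
    by (simp add: bounded_linear_imp_differentiable C_times_on_const)
qed

lemma C_times_on_add:
  assumes "open S" "C_times_on n S f" "C_times_on n S g"
  shows "C_times_on n S (\<lambda>x. f x + g x)"
  using assms(2,3)
proof (induction n arbitrary: f g)
  case 0
  then show ?case by (simp add: continuous_on_add)
next
  case (Suc n)
  show ?case
  proof (rule C_times_on_SucI[OF assms(1)])
    show "((\<lambda>x. f x + g x) has_derivative
        (\<lambda>v. frechet_derivative f (at x) v + frechet_derivative g (at x) v)) (at x)" if "x \<in> S" for x
      using Suc.prems that by (auto intro!: has_derivative_add simp: frechet_derivative_works[symmetric])
  qed (use Suc in auto)
qed

lemma C_times_on_bilinear:
  assumes "bounded_bilinear p" "open S" "C_times_on n S f" "C_times_on n S g"
  shows "C_times_on n S (\<lambda>x. p (f x) (g x))"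
  using assms(3,4)
proof (induction n arbitrary: f g)
  case 0
  then show ?case using bounded_bilinear.continuous_on[OF assms(1)] by simp
next
  case (Suc n)
  have f: "C_times_on n S f" and g: "C_times_on n S g"
    by (rule C_times_on_SucD[OF Suc.prems(1)], rule C_times_on_SucD[OF Suc.prems(2)])
  show ?case
  proof (rule C_times_on_SucI[OF assms(2)])
    show "((\<lambda>x. p (f x) (g x)) has_derivative
        (\<lambda>v. p (f x) (frechet_derivative g (at x) v) + p (frechet_derivative f (at x) v) (g x))) (at x)"
      if "x \<in> S" for x
      using Suc.prems that
      by (auto intro!: bounded_bilinear.FDERIV[OF assms(1)] simp: frechet_derivative_works[symmetric])
    show "C_times_on n S (\<lambda>x. p (f x) (frechet_derivative g (at x) v) + p (frechet_derivative f (at x) v) (g x))"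
      for v
      using Suc.prems by (intro C_times_on_add[OF assms(2)] Suc.IH f g) auto
  qed
qed

lemma C_times_on_sum:
  assumes "open S" "\<And>i. i \<in> I \<Longrightarrow> C_times_on n S (f i)"
  shows "C_times_on n S (\<lambda>x. \<Sum>i\<in>I. f i x)"
  using assms(2)
proof (induction I rule: infinite_finite_induct)
  case (insert i I)
  then show ?case by (auto intro!: C_times_on_add[OF assms(1)])
qed (auto intro: C_times_on_const)

lemma C_times_on_compose:
  fixes f :: "'a::real_normed_vector \<Rightarrow> 'b::euclidean_space" and g :: "'b \<Rightarrow> 'c::real_normed_vector"
  assumes "open S" "open T" "f ` S \<subseteq> T" "C_times_on n S f" "C_times_on n T g"
  shows "C_times_on n S (\<lambda>x. g (f x))"
  using assms(4,5)
proof (induction n arbitrary: g)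
  case 0
  then show ?case using continuous_on_compose2[of T g S f] assms(3) by simp
next
  case (Suc n)
  have f: "C_times_on n S f" by (rule C_times_on_SucD[OF Suc.prems(1)])
  have dg: "(g has_derivative frechet_derivative g (at y)) (at y)" if "y \<in> T" for y
    using Suc.prems that by (simp add: frechet_derivative_works[symmetric])
  have df: "(f has_derivative frechet_derivative f (at x)) (at x)" if "x \<in> S" for x
    using Suc.prems that by (simp add: frechet_derivative_works[symmetric])
  show ?case
  proof (rule C_times_on_SucI[OF assms(1)])
    fix x assume x: "x \<in> S"
    then have fx: "f x \<in> T" using assms(3) by auto
    have lin: "linear (frechet_derivative g (at (f x)))"
      using dg[OF fx] has_derivative_linear by blast
    have eq: "frechet_derivative g (at (f x)) u
        = (\<Sum>b\<in>Basis. (u \<bullet> b) *\<^sub>R frechet_derivative g (at (f x)) b)" for u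
    proof -
      have "frechet_derivative g (at (f x)) (\<Sum>b\<in>Basis. (u \<bullet> b) *\<^sub>R b)
        = (\<Sum>b\<in>Basis. (u \<bullet> b) *\<^sub>R frechet_derivative g (at (f x)) b)"
        by (simp only: linear_sum[OF lin] linear_scale[OF lin])
      then show ?thesis by (simp only: euclidean_representation)
    qed
    show "((\<lambda>x. g (f x)) has_derivative
       (\<lambda>v. \<Sum>b\<in>Basis. (frechet_derivative f (at x) v \<bullet> b) *\<^sub>R frechet_derivative g (at (f x)) b)) (at x)"
      using has_derivative_compose[OF df[OF x] dg[OF fx]] by (simp only: eq[symmetric])
  next
    fix v
    have "C_times_on n S (\<lambda>x. frechet_derivative f (at x) v \<bullet> b)" for b
      using Suc.prems(1) by (intro C_times_on_bilinear[OF bounded_bilinear_inner assms(1)] C_times_on_const) auto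
    then show "C_times_on n S (\<lambda>x. \<Sum>b\<in>Basis. (frechet_derivative f (at x) v \<bullet> b) *\<^sub>R frechet_derivative g (at (f x)) b)"
      using Suc.prems(2) by (intro C_times_on_sum C_times_on_bilinear[OF bounded_bilinear_scaleR] Suc.IH f assms(1)) auto
  qed
qed

named_theorems smooth_intros

lemma smooth_map_on_cong:
  "open S \<Longrightarrow> (\<And>x. x \<in> S \<Longrightarrow> f x = g x) \<Longrightarrow> smooth_map_on S f \<Longrightarrow> smooth_map_on S g"
  unfolding smooth_map_on_def using C_times_on_cong by blast

lemma smooth_map_on_subset: "smooth_map_on S f \<Longrightarrow> T \<subseteq> S \<Longrightarrow> smooth_map_on T f"
  unfolding smooth_map_on_def using C_times_on_subset by blast

lemma smooth_map_on_linear: "bounded_linear f \<Longrightarrow> smooth_map_on S f"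
  unfolding smooth_map_on_def using C_times_on_linear by blast

lemma smooth_map_on_const [smooth_intros]: "smooth_map_on S (\<lambda>x. c)"
  unfolding smooth_map_on_def using C_times_on_const by blast

lemma smooth_map_on_bilinear:
  "bounded_bilinear p \<Longrightarrow> open S \<Longrightarrow> smooth_map_on S f \<Longrightarrow> smooth_map_on S g
   \<Longrightarrow> smooth_map_on S (\<lambda>x. p (f x) (g x))"
  unfolding smooth_map_on_def using C_times_on_bilinear by blast

lemma smooth_map_on_compose:
  fixes f :: "'a::real_normed_vector \<Rightarrow> 'b::euclidean_space"
  shows "open S \<Longrightarrow> open T \<Longrightarrow> f ` S \<subseteq> T \<Longrightarrow> smooth_map_on S f \<Longrightarrow> smooth_map_on T g
   \<Longrightarrow> smooth_map_on S (\<lambda>x. g (f x))"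
  unfolding smooth_map_on_def using C_times_on_compose by blast

lemma smooth_map_on_compose_linear:
  fixes f :: "'a::real_normed_vector \<Rightarrow> 'b::euclidean_space" and g :: "'b \<Rightarrow> 'c::real_normed_vector"
  assumes "bounded_linear g" "open S" "smooth_map_on S f"
  shows "smooth_map_on S (\<lambda>x. g (f x))"
  by (rule smooth_map_on_compose[OF assms(2) open_UNIV _ assms(3) smooth_map_on_linear[OF assms(1)]]) simp

lemma smooth_map_on_add [smooth_intros]:
  "open S \<Longrightarrow> smooth_map_on S f \<Longrightarrow> smooth_map_on S g \<Longrightarrow> smooth_map_on S (\<lambda>x. f x + g x)"
  unfolding smooth_map_on_def using C_times_on_add by blast

lemma smooth_map_on_sum [smooth_intros]:
  "open S \<Longrightarrow> (\<And>i. i \<in> I \<Longrightarrow> smooth_map_on S (f i)) \<Longrightarrow> smooth_map_on S (\<lambda>x. \<Sum>i\<in>I. f i x)"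
  unfolding smooth_map_on_def using C_times_on_sum[of S I _ f] by blast

lemmas smooth_map_on_scaleR [smooth_intros] = smooth_map_on_bilinear[OF bounded_bilinear_scaleR]
lemmas smooth_map_on_inner [smooth_intros] = smooth_map_on_bilinear[OF bounded_bilinear_inner]
lemmas smooth_map_on_mult [smooth_intros] = smooth_map_on_bilinear[OF bounded_bilinear_mult]

lemma smooth_map_on_minus [smooth_intros]:
  "open S \<Longrightarrow> smooth_map_on S f \<Longrightarrow> smooth_map_on S (\<lambda>x. - f x)"
  using smooth_map_on_scaleR[OF _ smooth_map_on_const[where c="-1"]] by simp

lemma smooth_map_on_diff [smooth_intros]:
  "open S \<Longrightarrow> smooth_map_on S f \<Longrightarrow> smooth_map_on S g \<Longrightarrow> smooth_map_on S (\<lambda>x. f x - g x)"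
  using smooth_map_on_add[of S f "\<lambda>x. - g x"] by (simp add: smooth_map_on_minus)

lemma smooth_map_on_power [smooth_intros]:
  fixes f :: "'a::real_normed_vector \<Rightarrow> real"
  shows "open S \<Longrightarrow> smooth_map_on S f \<Longrightarrow> smooth_map_on S (\<lambda>x. f x ^ n)"
proof (induction n)
  case (Suc n)
  then show ?case using smooth_map_on_mult[of S f "\<lambda>x. f x ^ n"] by simp
qed (simp add: smooth_map_on_const)

lemma smooth_map_on_ident [smooth_intros]: "smooth_map_on S (\<lambda>x. x)"
  by (rule smooth_map_on_linear) (rule bounded_linear_ident)

lemma smooth_map_on_Pair [smooth_intros]:
  fixes f :: "'a::real_normed_vector \<Rightarrow> 'b::euclidean_space" and g :: "'a \<Rightarrow> 'c::euclidean_space"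
  assumes "open S" "smooth_map_on S f" "smooth_map_on S g"
  shows "smooth_map_on S (\<lambda>x. (f x, g x))"
proof -
  have "bounded_linear (\<lambda>x::'b. (x, 0::'c))" "bounded_linear (\<lambda>x::'c. (0::'b, x))"
    by (auto intro!: bounded_linear_Pair bounded_linear_ident bounded_linear_zero)
  then have "smooth_map_on S (\<lambda>x. (f x, 0) + (0, g x))"
    using assms by (intro smooth_intros) (auto intro: smooth_map_on_compose_linear)
  then show ?thesis by simp
qed

lemma smooth_map_on_fst [smooth_intros]:
  fixes f :: "'a::real_normed_vector \<Rightarrow> 'b::euclidean_space \<times> 'c::euclidean_space"
  shows "open S \<Longrightarrow> smooth_map_on S f \<Longrightarrow> smooth_map_on S (\<lambda>x. fst (f x))"
  using smooth_map_on_compose_linear[OF bounded_linear_fst] .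

lemma smooth_map_on_snd [smooth_intros]:
  fixes f :: "'a::real_normed_vector \<Rightarrow> 'b::euclidean_space \<times> 'c::euclidean_space"
  shows "open S \<Longrightarrow> smooth_map_on S f \<Longrightarrow> smooth_map_on S (\<lambda>x. snd (f x))"
  using smooth_map_on_compose_linear[OF bounded_linear_snd] .

lemma smooth_map_on_vec_nth [smooth_intros]:
  fixes f :: "'a::real_normed_vector \<Rightarrow> 'b::euclidean_space ^ 'n"
  shows "open S \<Longrightarrow> smooth_map_on S f \<Longrightarrow> smooth_map_on S (\<lambda>x. f x $ i)"
  using smooth_map_on_compose_linear[OF bounded_linear_vec_nth] .

lemma smooth_map_on_frechet_derivative:
  "smooth_map_on S f \<Longrightarrow> smooth_map_on S (\<lambda>x. frechet_derivative f (at x) v)"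
  unfolding smooth_map_on_def using C_times_on.simps(2) by blast

lemma smooth_map_on_has_derivative:
  "smooth_map_on S f \<Longrightarrow> x \<in> S \<Longrightarrow> (f has_derivative frechet_derivative f (at x)) (at x)"
  unfolding smooth_map_on_def
  by (metis C_times_on.simps(2) frechet_derivative_works)

lemma smooth_map_on_continuous: "smooth_map_on S f \<Longrightarrow> continuous_on S f"
  unfolding smooth_map_on_def by (metis C_times_on.simps(1))

lemma smooth_map_on_componentwise:
  fixes f :: "'a::real_normed_vector \<Rightarrow> 'b::euclidean_space"
  assumes "open S" "\<And>b. b \<in> Basis \<Longrightarrow> smooth_map_on S (\<lambda>x. f x \<bullet> b)"
  shows "smooth_map_on S f"
proof -
  have "smooth_map_on S (\<lambda>x. \<Sum>b\<in>Basis. (f x \<bullet> b) *\<^sub>R b)"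
    using assms by (intro smooth_map_on_sum smooth_map_on_scaleR smooth_map_on_const) auto
  then show ?thesis by (simp add: euclidean_representation)
qed

lemma smooth_map_on_vec_lambda:
  fixes f :: "'a::real_normed_vector \<Rightarrow> 'n::finite \<Rightarrow> 'b::euclidean_space"
  assumes "open S" "\<And>i. smooth_map_on S (\<lambda>x. f x i)"
  shows "smooth_map_on S (\<lambda>x. \<chi> i. f x i)"
proof (rule smooth_map_on_componentwise[OF assms(1)])
  fix b :: "'b ^ 'n" assume "b \<in> Basis"
  then obtain i u where "b = axis i u" by (auto simp: Basis_vec_def)
  moreover have "smooth_map_on S (\<lambda>x. f x i \<bullet> u)"
    by (intro smooth_map_on_inner smooth_map_on_const assms)
  ultimately show "smooth_map_on S (\<lambda>x. (\<chi> i. f x i) \<bullet> b)"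
    by (simp add: inner_axis)
qed

lemma smooth_map_on_matrix_vector_mult [smooth_intros]:
  fixes A :: "'a::real_normed_vector \<Rightarrow> real ^ 'n ^ 'm"
  assumes "open S" "smooth_map_on S A" "smooth_map_on S f"
  shows "smooth_map_on S (\<lambda>x. A x *v f x)"
  unfolding matrix_vector_mult_def
  by (intro smooth_map_on_vec_lambda smooth_intros assms)


section \<open>Directional derivatives and Taylor expansion\<close>

definition dirD :: "'a::real_normed_vector \<Rightarrow> ('a \<Rightarrow> 'b::real_normed_vector) \<Rightarrow> 'a \<Rightarrow> 'b" where
  "dirD v f = (\<lambda>x. frechet_derivative f (at x) v)"

lemma smooth_dirD: "smooth_map_on S f \<Longrightarrow> smooth_map_on S (dirD v f)"
  unfolding dirD_def by (rule smooth_map_on_frechet_derivative)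

lemma smooth_dirD_pow: "smooth_map_on S f \<Longrightarrow> smooth_map_on S ((dirD v ^^ k) f)"
  by (induction k) (auto intro: smooth_dirD)

lemma dirD_eqI: "(f has_derivative f') (at x) \<Longrightarrow> dirD v f x = f' v"
  unfolding dirD_def by (simp add: frechet_derivative_at[symmetric])

lemma smooth_has_dirD:
  "smooth_map_on S f \<Longrightarrow> x \<in> S \<Longrightarrow> (f has_derivative (\<lambda>v. dirD v f x)) (at x)"
  unfolding dirD_def by (rule smooth_map_on_has_derivative)

lemma dirD_line:
  assumes "smooth_map_on UNIV f"
  shows "((\<lambda>t. f (a + t *\<^sub>R v)) has_vector_derivative dirD v f (a + t *\<^sub>R v)) (at t within T)"
proof -
  have lin: "linear (\<lambda>u. dirD u f (a + t *\<^sub>R v))"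
    using smooth_has_dirD[OF assms] has_derivative_linear by blast
  have l: "((\<lambda>t. a + t *\<^sub>R v) has_derivative (\<lambda>h. h *\<^sub>R v)) (at t)"
    by (auto intro!: derivative_eq_intros)
  have "((\<lambda>t. f (a + t *\<^sub>R v)) has_derivative (\<lambda>h. dirD (h *\<^sub>R v) f (a + t *\<^sub>R v))) (at t)"
    using has_derivative_compose[OF l smooth_has_dirD[OF assms UNIV_I]] by simp
  then show ?thesis
    unfolding has_vector_derivative_def linear_scale[OF lin] by (rule has_derivative_at_withinI)
qed

lemma dirD_scale_dir:
  assumes "smooth_map_on UNIV f"
  shows "dirD (c *\<^sub>R v) f x = c *\<^sub>R dirD v f x"
  by (rule linear_scale[OF has_derivative_linear[OF smooth_has_dirD[OF assms UNIV_I]]])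

lemma dirD_sum_dir:
  assumes "smooth_map_on UNIV f"
  shows "dirD (\<Sum>i\<in>I. v i) f x = (\<Sum>i\<in>I. dirD (v i) f x)"
  using linear_sum[OF has_derivative_linear[OF smooth_has_dirD[OF assms UNIV_I]]] .

lemma dirD_scale:
  assumes "smooth_map_on UNIV f"
  shows "dirD v (\<lambda>x. c *\<^sub>R f x) x = c *\<^sub>R dirD v f x"
  by (rule dirD_eqI) (intro has_derivative_scaleR_right smooth_has_dirD[OF _ UNIV_I] assms)

lemma dirD_pow_scale_dir:
  assumes "smooth_map_on UNIV f"
  shows "(dirD (c *\<^sub>R v) ^^ k) f x = c ^ k *\<^sub>R (dirD v ^^ k) f x"
proof (induction k arbitrary: x)
  case (Suc k)
  have "(dirD (c *\<^sub>R v) ^^ k) f = (\<lambda>x. c ^ k *\<^sub>R (dirD v ^^ k) f x)"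
    using Suc by blast
  then have "(dirD (c *\<^sub>R v) ^^ Suc k) f x = dirD (c *\<^sub>R v) (\<lambda>x. c ^ k *\<^sub>R (dirD v ^^ k) f x) x"
    by simp
  also have "\<dots> = c ^ Suc k *\<^sub>R (dirD v ^^ Suc k) f x"
    by (simp add: dirD_scale[OF smooth_dirD_pow[OF assms]] dirD_scale_dir[OF smooth_dirD_pow[OF assms]])
  finally show ?case .
qed simp

lemma dirD_parity:
  fixes f :: "'a::real_normed_vector \<Rightarrow> real"
  assumes "smooth_map_on UNIV f" "\<And>x. f (- x) = s * f x"
  shows "dirD v f (- x) = - s * dirD v f x"
proof -
  have "((\<lambda>x. f (- x)) has_derivative (\<lambda>v. dirD (- v) f (- x))) (at x)"
    by (rule has_derivative_compose[OF _ smooth_has_dirD[OF assms(1) UNIV_I], of uminus uminus])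
      (auto intro!: derivative_eq_intros)
  moreover have "((\<lambda>x. f (- x)) has_derivative (\<lambda>v. s * dirD v f x)) (at x)"
    unfolding assms(2) by (intro has_derivative_mult_right smooth_has_dirD[OF _ UNIV_I] assms)
  ultimately have "(\<lambda>v. dirD (- v) f (- x)) = (\<lambda>v. s * dirD v f x)"
    by (rule has_derivative_unique)
  then have "dirD (- v) f (- x) = s * dirD v f x" by (rule fun_cong)
  then show ?thesis
    using dirD_scale_dir[OF assms(1), of "-1" v "-x"] by simp
qed

lemma dirD_pow_parity:
  fixes f :: "'a::real_normed_vector \<Rightarrow> real"
  assumes "smooth_map_on UNIV f" "\<And>x. f (- x) = s * f x"
  shows "(dirD v ^^ k) f (- x) = (- 1) ^ k * s * (dirD v ^^ k) f x"
proof (induction k arbitrary: x)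
  case (Suc k)
  then show ?case using dirD_parity[OF smooth_dirD_pow[OF assms(1)] Suc] by simp
qed (simp add: assms)

lemma leibniz_dirD:
  fixes H :: "real \<times> 'a::euclidean_space \<Rightarrow> 'b::euclidean_space"
  assumes "C_times_on (Suc 0) UNIV H"
  shows "((\<lambda>y. integral {0..1} (\<lambda>t. H (t, y))) has_derivative
      (\<lambda>v. integral {0..1} (\<lambda>t. frechet_derivative H (at (t, y)) (0, v)))) (at y)"
proof -
  have dH: "(H has_derivative frechet_derivative H (at p)) (at p)" for p
    using assms by (simp only: C_times_on.simps frechet_derivative_works[symmetric]) blast
  have d: "((\<lambda>y. H (t, y)) has_derivative (\<lambda>v. frechet_derivative H (at (t, y)) (0, v))) (at y)" for t y
    by (rule has_derivative_compose[OF _ dH, of "\<lambda>y. (t, y)" "\<lambda>v. (0, v)"])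
      (auto intro!: derivative_eq_intros)
  define F where "F y t = Blinfun (\<lambda>v. frechet_derivative H (at (t, y)) (0, v))" for y t
  have F: "blinfun_apply (F y t) = (\<lambda>v. frechet_derivative H (at (t, y)) (0, v))" for y t
    unfolding F_def by (intro bounded_linear_Blinfun_apply has_derivative_bounded_linear[OF d])
  have cH: "continuous_on UNIV (\<lambda>p. frechet_derivative H (at p) v)" for v
    using assms by (simp only: C_times_on.simps)
  have cH0: "continuous_on UNIV H" using C_times_on_SucD[OF assms] by simp
  have "continuous_on UNIV (\<lambda>q. F (fst q) (snd q))"
  proof (rule continuous_on_blinfun_componentwise)
    fix b :: 'a
    have "continuous_on UNIV (\<lambda>q. frechet_derivative H (at (snd q, fst q)) (0, b))"
      by (intro continuous_on_compose2[OF cH] continuous_intros) auto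
    then show "continuous_on UNIV (\<lambda>q. blinfun_apply (F (fst q) (snd q)) b)"
      by (simp add: F)
  qed
  then have cF: "continuous_on (UNIV \<times> cbox 0 1) (\<lambda>(y, t). F y t)"
    by (auto simp: case_prod_beta intro: continuous_on_subset)
  have ct: "continuous_on T (\<lambda>t. F y t)" for T :: "real set"
    using continuous_on_compose2[OF \<open>continuous_on UNIV (\<lambda>q. F (fst q) (snd q))\<close>, of T "\<lambda>t. (y, t)"]
    by (simp add: continuous_intros)
  have "((\<lambda>y. integral (cbox 0 1) (\<lambda>t. H (t, y))) has_derivative integral (cbox 0 1) (F y)) (at y within UNIV)"
  proof (rule leibniz_rule[OF _ _ cF])
    show "(\<lambda>t. H (t, y)) integrable_on cbox 0 1" for y
      by (intro integrable_continuous continuous_on_compose2[OF cH0] continuous_intros) auto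
  qed (auto simp: F d)
  moreover have "blinfun_apply (integral (cbox 0 1) (F y))
      = (\<lambda>v. integral (cbox 0 1) (\<lambda>t. frechet_derivative H (at (t, y)) (0, v)))"
    by (rule ext, subst blinfun_apply_integral) (auto simp: F intro!: integrable_continuous_real ct)
  ultimately show ?thesis by simp
qed

lemma C_times_on_integral:
  fixes H :: "real \<times> 'a::euclidean_space \<Rightarrow> 'b::euclidean_space"
  assumes "C_times_on n UNIV H"
  shows "C_times_on n UNIV (\<lambda>y. integral {0..1} (\<lambda>t. H (t, y)))"
  using assms
proof (induction n arbitrary: H)
  case 0
  have "continuous_on UNIV (\<lambda>y. integral (cbox 0 1) (\<lambda>t. H (t, y)))"
    using 0 by (intro integral_continuous_on_param)
      (auto simp: case_prod_beta intro!: continuous_on_compose2[of UNIV H] continuous_intros)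
  then show ?case by simp
next
  case (Suc n)
  have 1: "C_times_on (Suc 0) UNIV H"
    using Suc.prems by (induction n) (simp, metis C_times_on_SucD)
  show ?case
  proof (rule C_times_on_SucI[OF open_UNIV leibniz_dirD[OF 1]])
    show "C_times_on n UNIV (\<lambda>y. integral {0..1} (\<lambda>t. frechet_derivative H (at (t, y)) (0, v)))" for v
      by (rule Suc.IH) (use Suc.prems in \<open>simp only: C_times_on.simps\<close>)
  qed
qed

lemma smooth_integral:
  fixes H :: "real \<times> 'a::euclidean_space \<Rightarrow> 'b::euclidean_space"
  shows "smooth_map_on UNIV H \<Longrightarrow> smooth_map_on UNIV (\<lambda>y. integral {0..1} (\<lambda>t. H (t, y)))"
  unfolding smooth_map_on_def using C_times_on_integral by blast

lemma taylor_dirD: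
  fixes f :: "'a::real_normed_vector \<Rightarrow> real"
  assumes "smooth_map_on UNIV f" "0 < n"
  shows "f (a + v) = (\<Sum>i<n. (dirD v ^^ i) f a / fact i)
     + integral {0..1} (\<lambda>t. (1 - t) ^ (n - 1) / fact (n - 1) * (dirD v ^^ n) f (a + t *\<^sub>R v))"
proof -
  have "(\<lambda>t. f (a + t *\<^sub>R v)) 1 = (\<Sum>i<n. ((1 - 0) ^ i / fact i) *\<^sub>R (dirD v ^^ i) f (a + 0 *\<^sub>R v))
     + integral {0..1} (\<lambda>t. ((1 - t) ^ (n - 1) / fact (n - 1)) *\<^sub>R (dirD v ^^ n) f (a + t *\<^sub>R v))"
  proof (rule Taylor_integral[where Df = "\<lambda>m t. (dirD v ^^ m) f (a + t *\<^sub>R v)"])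
    show "((\<lambda>t. (dirD v ^^ m) f (a + t *\<^sub>R v)) has_vector_derivative (dirD v ^^ Suc m) f (a + t *\<^sub>R v))
      (at t within {0..1})" for m t
      using dirD_line[OF smooth_dirD_pow[OF assms(1)]] by simp
  qed (use assms in auto)
  then show ?thesis by simp
qed

lemma dirD_commute:
  fixes f :: "'a::euclidean_space \<Rightarrow> real"
  assumes f: "smooth_map_on UNIV f"
  shows "dirD v (dirD w f) x = dirD w (dirD v f) x"
proof -
  define G where "G y = dirD w (dirD v f) y - dirD v (dirD w f) y" for y
  have G: "smooth_map_on UNIV G"
    unfolding G_def by (intro smooth_intros smooth_dirD f open_UNIV)
  define K where "K s = integral {0..1} (\<lambda>t. G (x + (t * s) *\<^sub>R v))" for s
  have shift: "f (y + s *\<^sub>R v) - f y = s * integral {0..1} (\<lambda>t. dirD v f (y + (t * s) *\<^sub>R v))"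
    if "smooth_map_on UNIV f" for f :: "'a \<Rightarrow> real" and y s
    using taylor_dirD[OF that, of 1 y "s *\<^sub>R v"] by (simp add: dirD_scale_dir[OF that])
  have line: "smooth_map_on UNIV (\<lambda>p::real \<times> 'a. g (snd p + (fst p * s) *\<^sub>R v))"
    if "smooth_map_on UNIV g" for g :: "'a \<Rightarrow> real" and s
    using that by (intro smooth_map_on_compose[OF open_UNIV open_UNIV _ _ that] smooth_intros) auto
  have int: "(\<lambda>t. g (x + (t * s) *\<^sub>R v)) integrable_on {0..1}" if "smooth_map_on UNIV g" for g :: "'a \<Rightarrow> real" and s
    by (intro integrable_continuous_real continuous_on_compose2[OF smooth_map_on_continuous[OF that]] continuous_intros) auto
  have K0: "K s = 0" if "s \<noteq> 0" for s
  proof -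
    have d: "dirD w (\<lambda>y. f (y + s *\<^sub>R v) - f y) x = dirD w f (x + s *\<^sub>R v) - dirD w f x"
      by (rule dirD_eqI, intro has_derivative_diff smooth_has_dirD[OF f UNIV_I],
        rule has_derivative_compose[OF _ smooth_has_dirD[OF f UNIV_I], of _ "\<lambda>h. h"])
       (auto intro!: derivative_eq_intros)
    let ?H = "\<lambda>p::real \<times> 'a. dirD v f (snd p + (fst p * s) *\<^sub>R v)"
    have H: "smooth_map_on UNIV ?H" by (rule line[OF smooth_dirD[OF f]])
    have H1: "C_times_on (Suc 0) UNIV ?H" using H unfolding smooth_map_on_def by blast
    have dH: "frechet_derivative ?H (at (t, x)) (0, w) = dirD w (dirD v f) (x + (t * s) *\<^sub>R v)" for t
    proof -
      have "(?H has_derivative (\<lambda>h. dirD (snd h + (fst h * s) *\<^sub>R v) (dirD v f) (x + (t * s) *\<^sub>R v))) (at (t, x))"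
      proof -
        have "((\<lambda>p. snd p + (fst p * s) *\<^sub>R v) has_derivative (\<lambda>h. snd h + (fst h * s) *\<^sub>R v)) (at (t, x))"
          by (auto intro!: derivative_eq_intros)
        from has_derivative_compose[OF this smooth_has_dirD[OF smooth_dirD[OF f] UNIV_I]]
        show ?thesis by simp
      qed
      from frechet_derivative_at[OF this, symmetric] show ?thesis by simp
    qed
    have "dirD w (\<lambda>y. s * integral {0..1} (\<lambda>t. ?H (t, y))) x
      = s * integral {0..1} (\<lambda>t. frechet_derivative ?H (at (t, x)) (0, w))"
      by (rule dirD_eqI) (intro has_derivative_mult_right leibniz_dirD[OF H1])
    then have "dirD w f (x + s *\<^sub>R v) - dirD w f x
       = s * integral {0..1} (\<lambda>t. dirD w (dirD v f) (x + (t * s) *\<^sub>R v))"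
      using d shift[OF f] by (simp add: dH)
    moreover have "dirD w f (x + s *\<^sub>R v) - dirD w f x
       = s * integral {0..1} (\<lambda>t. dirD v (dirD w f) (x + (t * s) *\<^sub>R v))"
      by (rule shift[OF smooth_dirD[OF f]])
    moreover have "K s = integral {0..1} (\<lambda>t. dirD w (dirD v f) (x + (t * s) *\<^sub>R v))
       - integral {0..1} (\<lambda>t. dirD v (dirD w f) (x + (t * s) *\<^sub>R v))"
      unfolding K_def G_def by (intro integral_diff int smooth_dirD f)
    ultimately show ?thesis using that by simp
  qed
  have "continuous_on UNIV (\<lambda>s. integral (cbox 0 1) (\<lambda>t. G (x + (t * s) *\<^sub>R v)))"
    by (intro integral_continuous_on_param)
      (auto simp: case_prod_beta intro!: continuous_on_compose2[OF smooth_map_on_continuous[OF G]] continuous_intros)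
  then have "isCont K 0"
    unfolding K_def by (simp add: continuous_on_eq_continuous_at)
  then have "K \<midarrow>0\<rightarrow> K 0" by (simp add: isCont_def)
  moreover have "K \<midarrow>0\<rightarrow> 0"
    by (rule tendsto_eventually) (auto simp: eventually_at K0 intro!: exI[of _ 1])
  ultimately have "K 0 = 0" using LIM_unique by blast
  then show ?thesis by (simp add: K_def G_def)
qed


section \<open>The smooth inverse function theorem\<close>

lemma has_derivative_scaleR_vanishing:
  assumes "(f has_derivative f') (at x)" "f x = 0" "isCont c x"
  shows "((\<lambda>y. f y *\<^sub>R c y) has_derivative (\<lambda>h. f' h *\<^sub>R c x)) (at x)"
proof -
  have f': "bounded_linear f'" and lim: "((\<lambda>y. (f y - f' (y - x)) /\<^sub>R norm (y - x)) \<longlongrightarrow> 0) (at x)"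
    using assms(1,2) by (auto simp: has_derivative_at_within)
  obtain K where K: "\<And>h. norm (f' h) \<le> norm h * K" and "K > 0"
    using bounded_linear.pos_bounded[OF f'] by blast
  have c: "((\<lambda>y. c y - c x) \<longlongrightarrow> 0) (at x)"
    using assms(3) by (simp add: isCont_def LIM_zero)
  have "((\<lambda>y. K * norm (c y - c x)) \<longlongrightarrow> K * norm (0::'b)) (at x)"
    by (intro tendsto_intros c)
  then have Kc: "((\<lambda>y. K * norm (c y - c x)) \<longlongrightarrow> 0) (at x)" by simp
  have "norm ((f' (y - x) / norm (y - x)) *\<^sub>R (c y - c x)) \<le> K * norm (c y - c x)" for y
    using mult_right_mono[of "\<bar>f' (y - x)\<bar> / norm (y - x)" K "norm (c y - c x)"] K[of "y - x"] \<open>K > 0\<close>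
    by (cases "y = x") (auto simp: divide_simps mult.commute)
  then have b: "((\<lambda>y. (f' (y - x) / norm (y - x)) *\<^sub>R (c y - c x)) \<longlongrightarrow> 0) (at x)"
    by (intro Lim_null_comparison[OF _ Kc] always_eventually allI)
  have a: "((\<lambda>y. ((f y - f' (y - x)) /\<^sub>R norm (y - x)) *\<^sub>R c y) \<longlongrightarrow> 0 *\<^sub>R c x) (at x)"
    by (intro tendsto_scaleR lim) (use assms(3) in \<open>simp add: isCont_def\<close>)
  have "((\<lambda>y. (f y *\<^sub>R c y - f x *\<^sub>R c x - f' (y - x) *\<^sub>R c x) /\<^sub>R norm (y - x)) \<longlongrightarrow> 0) (at x)"
  proof (rule Lim_transform_eventually)
    show "((\<lambda>y. ((f y - f' (y - x)) /\<^sub>R norm (y - x)) *\<^sub>R c y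
        + (f' (y - x) / norm (y - x)) *\<^sub>R (c y - c x)) \<longlongrightarrow> 0) (at x)"
      using tendsto_add[OF a b] by simp
    show "\<forall>\<^sub>F y in at x. ((f y - f' (y - x)) /\<^sub>R norm (y - x)) *\<^sub>R c y
        + (f' (y - x) / norm (y - x)) *\<^sub>R (c y - c x)
      = (f y *\<^sub>R c y - f x *\<^sub>R c x - f' (y - x) *\<^sub>R c x) /\<^sub>R norm (y - x)"
      by (intro always_eventually allI) (simp add: assms(2) algebra_simps divide_inverse)
  qed
  then show ?thesis
    unfolding has_derivative_at_within using bounded_linear_scaleR_const[OF f'] by simp
qed

lemma linear_bound_below_continuous:
  fixes A :: "'a::real_normed_vector \<Rightarrow> 'b::euclidean_space \<Rightarrow> 'c::euclidean_space"
  assumes S: "open S" "x \<in> S" and lin: "\<And>y. y \<in> S \<Longrightarrow> linear (A y)"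
    and cont: "\<And>v. continuous_on S (\<lambda>y. A y v)" and inj: "inj (A x)"
  obtains c where "c > 0" "\<forall>\<^sub>F y in at x. \<forall>v. norm v \<le> c * norm (A y v)"
proof -
  obtain B where B: "B > 0" "\<And>v. B * norm v \<le> norm (A x v)"
    using linear_inj_bounded_below_pos[OF lin[OF S(2)] inj] by blast
  have "((\<lambda>y. \<Sum>b\<in>Basis. norm (A y b - A x b)) \<longlongrightarrow> (\<Sum>b\<in>(Basis::'b set). norm (A x b - A x b))) (at x)"
    using cont S by (intro tendsto_intros) (auto simp: continuous_on_eq_continuous_at isCont_def)
  then have "\<forall>\<^sub>F y in at x. (\<Sum>b\<in>(Basis::'b set). norm (A y b - A x b)) < B / 2"
    using B(1) by (intro order_tendstoD(2)[where y = 0]) auto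
  moreover have "\<forall>\<^sub>F y in at x. y \<in> S" using S by (rule eventually_at_in_open')
  ultimately have "\<forall>\<^sub>F y in at x. \<forall>v. norm v \<le> (2 / B) * norm (A y v)"
  proof eventually_elim
    case (elim y)
    show ?case
    proof
      fix v
      have "A y v - A x v = (\<Sum>b\<in>Basis. (v \<bullet> b) *\<^sub>R (A y b - A x b))"
      proof -
        have *: "A z v = (\<Sum>b\<in>Basis. (v \<bullet> b) *\<^sub>R A z b)" if "z \<in> S" for z
        proof -
          have "A z (\<Sum>b\<in>Basis. (v \<bullet> b) *\<^sub>R b) = (\<Sum>b\<in>Basis. (v \<bullet> b) *\<^sub>R A z b)"
            by (simp only: linear_sum[OF lin[OF that]] linear_scale[OF lin[OF that]])
          then show ?thesis by (simp only: euclidean_representation)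
        qed
        show ?thesis
          unfolding *[OF elim(2)] *[OF S(2)] by (simp add: scaleR_diff_right sum_subtractf)
      qed
      also have "norm \<dots> \<le> (\<Sum>b\<in>Basis. norm v * norm (A y b - A x b))"
        by (rule sum_norm_le) (auto intro!: mult_right_mono Basis_le_norm)
      also have "\<dots> = norm v * (\<Sum>b\<in>Basis. norm (A y b - A x b))" by (simp add: sum_distrib_left)
      also have "\<dots> \<le> norm v * (B / 2)" using elim(1) by (intro mult_left_mono) auto
      finally have "norm (A y v - A x v) \<le> norm v * (B / 2)" .
      then have "B * norm v \<le> norm (A y v) + norm v * (B / 2)"
        using B(2)[of v] norm_triangle_ineq2[of "A x v" "A y v"] by (simp add: norm_minus_commute)
      then show "norm v \<le> (2 / B) * norm (A y v)" using B(1) by (simp add: field_simps)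
    qed
  qed
  then show ?thesis using that[of "2 / B"] B(1) by simp
qed

lemma C_times_on_linear_inverse:
  fixes A :: "'a::real_normed_vector \<Rightarrow> 'b::euclidean_space \<Rightarrow> 'c::euclidean_space"
  assumes S: "open S"
    and lin: "\<And>y. y \<in> S \<Longrightarrow> linear (A y)" and linB: "\<And>y. y \<in> S \<Longrightarrow> linear (B y)"
    and inv: "\<And>y v. y \<in> S \<Longrightarrow> A y (B y v) = v" "\<And>y v. y \<in> S \<Longrightarrow> B y (A y v) = v"
    and smooth: "\<And>v. C_times_on n S (\<lambda>y. A y v)"
  shows "C_times_on n S (\<lambda>y. B y v)"
  using smooth
proof (induction n arbitrary: v)
  case 0
  have "isCont (\<lambda>y. B y v) x" if x: "x \<in> S" for x
  proof -
    have inj: "inj (A x)" using inv(2)[OF x] by (metis injI)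
    obtain c where c: "c > 0" "\<forall>\<^sub>F y in at x. \<forall>v. norm v \<le> c * norm (A y v)"
      by (rule linear_bound_below_continuous[where A = A and S = S and x = x])
        (use 0 S x lin inj in auto)
    have "((\<lambda>y. c * norm (A x (B x v) - A y (B x v))) \<longlongrightarrow> c * norm (A x (B x v) - A x (B x v))) (at x)"
      using 0 S x by (intro tendsto_intros) (auto simp: continuous_on_eq_continuous_at isCont_def)
    then have lim: "((\<lambda>y. c * norm (A x (B x v) - A y (B x v))) \<longlongrightarrow> 0) (at x)" by simp
    have "\<forall>\<^sub>F y in at x. y \<in> S" using S x by (rule eventually_at_in_open')
    with c(2) have "\<forall>\<^sub>F y in at x. norm (B y v - B x v) \<le> c * norm (A x (B x v) - A y (B x v))"
    proof eventually_elim
      case (elim y)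
      have "A y (B y v - B x v) = A x (B x v) - A y (B x v)"
        using linear_diff[OF lin[OF elim(2)]] inv(1) x elim(2) by simp
      then show ?case using elim(1) by metis
    qed
    from Lim_null_comparison[OF this lim] show ?thesis by (simp add: isCont_def LIM_zero_iff)
  qed
  then show ?case by (simp add: continuous_at_imp_continuous_on)
next
  case (Suc n)
  let ?D = "\<lambda>b x w. frechet_derivative (\<lambda>y. A y b) (at x) w"
  have IH: "C_times_on n S (\<lambda>y. B y v)" for v
    by (rule Suc.IH) (rule C_times_on_SucD[OF Suc.prems])
  have dA: "((\<lambda>y. A y u) has_derivative ?D u x) (at x)" if "x \<in> S" for u x
    using Suc.prems[of u] that by (simp add: frechet_derivative_works)
  have rep: "L v = (\<Sum>b\<in>Basis. (v \<bullet> b) *\<^sub>R L b)" if "linear L"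
    for L :: "'x::euclidean_space \<Rightarrow> 'y::real_normed_vector" and v
  proof -
    have "L (\<Sum>b\<in>Basis. (v \<bullet> b) *\<^sub>R b) = (\<Sum>b\<in>Basis. (v \<bullet> b) *\<^sub>R L b)"
      by (simp only: linear_sum[OF that] linear_scale[OF that])
    then show ?thesis by (simp only: euclidean_representation)
  qed
  show ?case
  proof (rule C_times_on_SucI[OF S])
    fix x assume x: "x \<in> S"
    define u where "u = B x v"
    have cont: "isCont (\<lambda>y. B y w) x" for w
    proof -
      have "continuous_on S (\<lambda>y. B y w)"
        using IH[of w] by (induction n) (simp, metis C_times_on_SucD)
      then show ?thesis using S x by (simp add: continuous_on_eq_continuous_at)
    qed
    have D0: "((\<lambda>y. (A y u - A x u) \<bullet> b) has_derivative (\<lambda>h. ?D u x h \<bullet> b)) (at x)" for b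
      by (auto intro!: derivative_eq_intros dA x)
    have "((\<lambda>y. u - (\<Sum>b\<in>Basis. ((A y u - A x u) \<bullet> b) *\<^sub>R B y b)) has_derivative
        (\<lambda>h. 0 - (\<Sum>b\<in>Basis. (?D u x h \<bullet> b) *\<^sub>R B x b))) (at x)"
      by (intro has_derivative_diff has_derivative_const has_derivative_sum
          has_derivative_scaleR_vanishing D0 cont) simp
    moreover have "u - (\<Sum>b\<in>Basis. ((A y u - A x u) \<bullet> b) *\<^sub>R B y b) = B y v" if "y \<in> S" for y
    proof -
      have "(\<Sum>b\<in>Basis. ((A y u - A x u) \<bullet> b) *\<^sub>R B y b) = B y (A y u - A x u)"
        by (rule rep[OF linB[OF that], symmetric])
      also have "\<dots> = u - B y v"
        using linear_diff[OF linB[OF that]] inv x that by (simp add: u_def)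
      finally show ?thesis by simp
    qed
    ultimately have "((\<lambda>y. B y v) has_derivative
        (\<lambda>h. 0 - (\<Sum>b\<in>Basis. (?D u x h \<bullet> b) *\<^sub>R B x b))) (at x)"
      by (rule has_derivative_transform_within_open[OF _ S x])
    moreover have "?D u x h = (\<Sum>c\<in>Basis. (B x v \<bullet> c) *\<^sub>R ?D c x h)" for h
    proof -
      have "((\<lambda>y. \<Sum>c\<in>Basis. (u \<bullet> c) *\<^sub>R A y c) has_derivative (\<lambda>h. \<Sum>c\<in>Basis. (u \<bullet> c) *\<^sub>R ?D c x h)) (at x)"
        by (intro has_derivative_sum has_derivative_scaleR_right dA x)
      moreover have "(\<Sum>c\<in>Basis. (u \<bullet> c) *\<^sub>R A y c) = A y u" if "y \<in> S" for y
        by (rule rep[OF lin[OF that], symmetric])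
      ultimately have "((\<lambda>y. A y u) has_derivative (\<lambda>h. \<Sum>c\<in>Basis. (u \<bullet> c) *\<^sub>R ?D c x h)) (at x)"
        by (rule has_derivative_transform_within_open[OF _ S x])
      from has_derivative_unique[OF dA[OF x] this] show ?thesis by (simp add: u_def fun_eq_iff)
    qed
    ultimately show "((\<lambda>y. B y v) has_derivative
        (\<lambda>h. 0 - (\<Sum>b\<in>Basis. ((\<Sum>c\<in>Basis. (B x v \<bullet> c) *\<^sub>R ?D c x h) \<bullet> b) *\<^sub>R B x b))) (at x)"
      by simp
  next
    fix h
    have sD: "C_times_on n S (\<lambda>x. ?D c x h)" for c using Suc.prems[of c] by simp
    have "C_times_on n S (\<lambda>x. 0 + (\<Sum>b\<in>Basis. ((-1) * ((\<Sum>c\<in>Basis. (B x v \<bullet> c) *\<^sub>R ?D c x h) \<bullet> b)) *\<^sub>R B x b))"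
      by (intro C_times_on_add C_times_on_sum C_times_on_bilinear[OF bounded_bilinear_scaleR]
          C_times_on_bilinear[OF bounded_bilinear_inner] C_times_on_bilinear[OF bounded_bilinear_mult]
          C_times_on_const S IH sD)
    then show "C_times_on n S (\<lambda>x. 0 - (\<Sum>b\<in>Basis. ((\<Sum>c\<in>Basis. (B x v \<bullet> c) *\<^sub>R ?D c x h) \<bullet> b) *\<^sub>R B x b))"
      by (simp add: sum_negf)
  qed
qed

theorem smooth_inverse_function:
  fixes f :: "'a::euclidean_space \<Rightarrow> 'a"
  assumes U: "open U" "x0 \<in> U" and f: "smooth_map_on U f"
    and inj: "\<And>v. frechet_derivative f (at x0) v = 0 \<Longrightarrow> v = 0"
  obtains W V g where "open W" "W \<subseteq> U" "x0 \<in> W" "open V" "f x0 \<in> V"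
    "homeomorphism W V f g" "smooth_map_on V g"
proof -
  define F where "F x = Blinfun (frechet_derivative f (at x))" for x
  have F: "blinfun_apply (F x) = frechet_derivative f (at x)" if "x \<in> U" for x
    unfolding F_def
    by (intro bounded_linear_Blinfun_apply has_derivative_bounded_linear[OF smooth_map_on_has_derivative[OF f that]])
  have contF: "continuous_on U F"
  proof (rule continuous_on_blinfun_componentwise)
    fix b :: 'a
    have "continuous_on U (\<lambda>x. frechet_derivative f (at x) b)"
      by (intro smooth_map_on_continuous smooth_map_on_frechet_derivative f)
    then show "continuous_on U (\<lambda>x. blinfun_apply (F x) b)"
      by (rule continuous_on_eq) (simp add: F)
  qed
  have derF: "(f has_derivative blinfun_apply (F x)) (at x)" if "x \<in> U" for x
    using smooth_map_on_has_derivative[OF f that] F[OF that] by simp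
  have lin: "linear (frechet_derivative f (at x))" if "x \<in> U" for x
    using smooth_map_on_has_derivative[OF f that] by (rule has_derivative_linear)
  obtain L where L: "linear L" "L \<circ> frechet_derivative f (at x0) = id"
    using linear_injective_left_inverse[OF lin[OF U(2)]] inj linear_injective_0[OF lin[OF U(2)]] by blast
  have "Blinfun L o\<^sub>L F x0 = id_blinfun"
    using L by (intro blinfun_eqI)
      (auto simp: F U bounded_linear_Blinfun_apply linear_conv_bounded_linear fun_eq_iff)
  then obtain W V g g' where W: "open W" "W \<subseteq> U" "x0 \<in> W" "open V" "f x0 \<in> V" "homeomorphism W V f g"
    and g: "\<And>y. y \<in> V \<Longrightarrow> (g has_derivative g' y) (at y)"
    and g': "\<And>y. y \<in> V \<Longrightarrow> g' y = inv (blinfun_apply (F (g y)))"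
    and bij: "\<And>y. y \<in> V \<Longrightarrow> bij (blinfun_apply (F (g y)))"
    using inverse_function_theorem[OF U(1) derF contF U(2)] by metis
  have gW: "g y \<in> W" if "y \<in> V" for y
    using W(6) that by (auto simp: homeomorphism_def)
  have gU: "g ` V \<subseteq> W" using gW by auto
  have bijW: "bij (frechet_derivative f (at x))" if "x \<in> W" for x
  proof -
    have "f x \<in> V" "g (f x) = x" using W(6) that by (auto simp: homeomorphism_def)
    then show ?thesis using bij[of "f x"] F that W(2) by auto
  qed
  have fW: "C_times_on n W (\<lambda>x. frechet_derivative f (at x) v)" for n v
    using smooth_map_on_frechet_derivative[OF smooth_map_on_subset[OF f W(2)]]
    unfolding smooth_map_on_def by blast
  have B: "C_times_on n W (\<lambda>x. inv (frechet_derivative f (at x)) v)" for n v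
  proof (rule C_times_on_linear_inverse[OF W(1) _ _ _ _ fW])
    fix y v assume y: "y \<in> W"
    show "linear (frechet_derivative f (at y))" using y W(2) lin by blast
    then show "linear (inv (frechet_derivative f (at y)))"
      using bijW[OF y] by (metis bij_is_inj bij_is_surj inj_linear_imp_inv_linear)
    show "frechet_derivative f (at y) (inv (frechet_derivative f (at y)) v) = v"
      using bijW[OF y] by (simp add: bij_is_surj surj_f_inv_f)
    show "inv (frechet_derivative f (at y)) (frechet_derivative f (at y) v) = v"
      using bijW[OF y] by (simp add: bij_is_inj)
  qed
  have "C_times_on n V g" for n
  proof (induction n)
    case 0
    show ?case using W(6) by (simp add: homeomorphism_def)
  next
    case (Suc n)
    have "(g has_derivative inv (frechet_derivative f (at (g y)))) (at y)" if "y \<in> V" for y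
      using g[OF that] g'[OF that] F gW[OF that] W(2) by auto
    moreover have "C_times_on n V (\<lambda>y. inv (frechet_derivative f (at (g y))) v)" for v
      by (rule C_times_on_compose[OF W(4,1) gU Suc.IH B])
    ultimately show ?case by (rule C_times_on_SucI[OF W(4)])
  qed
  then have "smooth_map_on V g" by (simp add: smooth_map_on_def)
  with W that show ?thesis by blast
qed


lemma odd_diffeo_local_inverse:
  fixes \<psi> :: "'a::euclidean_space \<Rightarrow> 'a"
  assumes S: "open S" "0 \<in> S" and smooth: "smooth_map_on S \<psi>"
    and odd: "\<And>x. x \<in> S \<Longrightarrow> - x \<in> S \<and> \<psi> (- x) = - \<psi> x"
    and inj: "\<And>v. frechet_derivative \<psi> (at 0) v = 0 \<Longrightarrow> v = 0"
  obtains U V h where "odd_diffeo U V h" "V \<subseteq> S" "\<And>x. x \<in> U \<Longrightarrow> \<psi> (h x) = x"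
proof -
  obtain W V' g where W: "open W" "W \<subseteq> S" "0 \<in> W" "open V'" "\<psi> 0 \<in> V'"
      and hom: "homeomorphism W V' \<psi> g" and g: "smooth_map_on V' g"
    using smooth_inverse_function[OF S smooth inj] by metis
  obtain r where r: "r > 0" "ball 0 r \<subseteq> W" using W by (meson open_contains_ball)
  define V where "V = ball (0::'a) r"
  define U where "U = \<psi> ` V"
  have V: "open V" "0 \<in> V" "V \<subseteq> W" using r by (auto simp: V_def)
  have g\<psi>: "g (\<psi> x) = x" if "x \<in> V" for x using hom V that by (auto simp: homeomorphism_def)
  have "U = V' \<inter> g -` V"
    using hom V unfolding U_def homeomorphism_def by (auto intro!: image_eqI)
  moreover have "open (V' \<inter> g -` V)"
    using hom W V by (intro continuous_open_preimage) (auto simp: homeomorphism_def)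
  ultimately have U: "open U" "U \<subseteq> V'" by auto
  have "\<psi> 0 + \<psi> 0 = 0" using odd[OF S(2)] by (simp add: eq_neg_iff_add_eq_0)
  then have [simp]: "\<psi> 0 = 0" by (metis scaleR_2 scaleR_eq_0_iff zero_neq_numeral)
  have bij: "bij_betw g U V"
    by (rule bij_betw_byWitness[where f' = \<psi>]) (auto simp: U_def g\<psi>)
  have "smooth_map_on V (inv_into U g)"
  proof (rule smooth_map_on_cong[OF V(1) _ smooth_map_on_subset[OF smooth]])
    fix x assume "x \<in> V"
    then show "\<psi> x = inv_into U g x"
      using bij inv_into_f_eq[of g U "\<psi> x" x] g\<psi> by (auto simp: bij_betw_def U_def)
  qed (use V W in auto)
  moreover have "- x \<in> U \<and> g (- x) = - g x" if "x \<in> U" for x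
  proof -
    obtain v where v: "v \<in> V" "x = \<psi> v" using \<open>x \<in> U\<close> by (auto simp: U_def)
    have "v \<in> S" using v V W by blast
    then have "- v \<in> V" "- x = \<psi> (- v)" using v odd[of v] by (auto simp: V_def)
    then show ?thesis using v g\<psi> by (auto simp: U_def)
  qed
  moreover have "0 \<in> U" using V(2) by (force simp: U_def)
  ultimately have "odd_diffeo U V g"
    using U V bij smooth_map_on_subset[OF g U(2)] by (auto simp: odd_diffeo_def)
  moreover have "\<psi> (g x) = x" if "x \<in> U" for x
    using that g\<psi> by (auto simp: U_def)
  ultimately show ?thesis using that V W by blast
qed

lemma odd_diffeo_compose_linear:
  fixes h T T' :: "'a::euclidean_space \<Rightarrow> 'a"
  assumes h: "odd_diffeo U V h" and T: "linear T" "linear T'" "\<And>x. T (T' x) = x" "\<And>x. T' (T x) = x"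
  shows "odd_diffeo (T -` U) V (\<lambda>x. h (T x))"
proof -
  have bl: "bounded_linear T" "bounded_linear T'"
    using T by (simp_all add: linear_conv_bounded_linear)
  have U: "open U" "open V" "0 \<in> U" "bij_betw h U V" "smooth_map_on U h" "smooth_map_on V (inv_into U h)"
      "\<And>x. x \<in> U \<Longrightarrow> - x \<in> U \<and> h (- x) = - h x"
    using h by (auto simp: odd_diffeo_def)
  have o: "open (T -` U)"
    by (rule open_vimage[OF U(1) linear_continuous_on[OF bl(1)]])
  have hU: "h (inv_into U h y) = y" "inv_into U h y \<in> U" if "y \<in> V" for y
    using U(4) that by (auto simp: bij_betw_def f_inv_into_f inv_into_into)
  have bij: "bij_betw (\<lambda>x. h (T x)) (T -` U) V"
    by (rule bij_betw_byWitness[where f' = "\<lambda>y. T' (inv_into U h y)"])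
      (use U(4) hU T in \<open>auto simp: bij_betw_def\<close>)
  have "smooth_map_on V (inv_into (T -` U) (\<lambda>x. h (T x)))"
  proof (rule smooth_map_on_cong[OF U(2)])
    show "smooth_map_on V (\<lambda>y. T' (inv_into U h y))"
      by (rule smooth_map_on_compose_linear[OF bl(2) U(2,6)])
    show "T' (inv_into U h y) = inv_into (T -` U) (\<lambda>x. h (T x)) y" if "y \<in> V" for y
      by (rule inv_into_f_eq[symmetric]) (use bij hU[OF that] T in \<open>auto simp: bij_betw_def\<close>)
  qed
  moreover have "smooth_map_on (T -` U) (\<lambda>x. h (T x))"
    by (rule smooth_map_on_compose[OF o U(1) _ smooth_map_on_linear[OF bl(1)] U(5)]) auto
  ultimately show ?thesis
    using o U bij linear_0[OF T(1)] linear_neg[OF T(1)] by (auto simp: odd_diffeo_def)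
qed

section \<open>Binary quartic forms\<close>

definition quartic :: "real \<Rightarrow> real \<Rightarrow> real \<Rightarrow> real \<Rightarrow> real \<Rightarrow> real \<Rightarrow> real \<Rightarrow> real" where
  "quartic A B C D E x y = A * x^4 + B * x^3 * y + C * x^2 * y^2 + D * x * y^3 + E * y^4"

lemma quartic_coeff_unique:
  assumes "\<And>x y. quartic A B C D E x y = quartic A' B' C' D' E' x y"
  shows "A = A' \<and> B = B' \<and> C = C' \<and> D = D' \<and> E = E'"
  using assms[of 1 0] assms[of 0 1] assms[of 1 1] assms[of 1 "-1"] assms[of 2 1]
  by (simp add: quartic_def)

definition quartic_I :: "real \<Rightarrow> real \<Rightarrow> real \<Rightarrow> real \<Rightarrow> real \<Rightarrow> real" where
  "quartic_I A B C D E = 12 * A * E - 3 * B * D + C^2"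

definition quartic_J :: "real \<Rightarrow> real \<Rightarrow> real \<Rightarrow> real \<Rightarrow> real \<Rightarrow> real" where
  "quartic_J A B C D E = 72 * A * C * E + 9 * B * C * D - 27 * A * D^2 - 27 * E * B^2 - 2 * C^3"

lemma Delta4_IJ: "27 * Delta4 A B C D E = 4 * quartic_I A B C D E ^ 3 - quartic_J A B C D E ^ 2"
  unfolding Delta4_def quartic_I_def quartic_J_def by algebra

lemma quartic_IJ_subst:
  fixes a b c d :: real
  assumes "A' = A*a^4 + B*a^3*c + C*a^2*c^2 + D*a*c^3 + E*c^4"
    "B' = 4*A*a^3*b + B*(3*a^2*b*c + a^3*d) + C*(2*a*b*c^2 + 2*a^2*c*d) + D*(b*c^3 + 3*a*c^2*d) + 4*E*c^3*d"
    "C' = 6*A*a^2*b^2 + B*(3*a*b^2*c + 3*a^2*b*d) + C*(b^2*c^2 + 4*a*b*c*d + a^2*d^2)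
      + D*(3*b*c^2*d + 3*a*c*d^2) + 6*E*c^2*d^2"
    "D' = 4*A*a*b^3 + B*(b^3*c + 3*a*b^2*d) + C*(2*b^2*c*d + 2*a*b*d^2) + D*(3*b*c*d^2 + a*d^3) + 4*E*c*d^3"
    "E' = A*b^4 + B*b^3*d + C*b^2*d^2 + D*b*d^3 + E*d^4"
  shows "quartic_I A' B' C' D' E' = (a*d - b*c)^4 * quartic_I A B C D E"
    and "quartic_J A' B' C' D' E' = (a*d - b*c)^6 * quartic_J A B C D E"
  unfolding assms quartic_I_def quartic_J_def by algebra+

lemma Delta4_subst:
  assumes "\<And>x y. quartic A' B' C' D' E' x y = quartic A B C D E (a*x + b*y) (c*x + d*y)"
  shows "Delta4 A' B' C' D' E' = (a*d - b*c)^12 * Delta4 A B C D E"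
proof -
  have "quartic A' B' C' D' E' x y = quartic (A*a^4 + B*a^3*c + C*a^2*c^2 + D*a*c^3 + E*c^4)
    (4*A*a^3*b + B*(3*a^2*b*c + a^3*d) + C*(2*a*b*c^2 + 2*a^2*c*d) + D*(b*c^3 + 3*a*c^2*d) + 4*E*c^3*d)
    (6*A*a^2*b^2 + B*(3*a*b^2*c + 3*a^2*b*d) + C*(b^2*c^2 + 4*a*b*c*d + a^2*d^2)
      + D*(3*b*c^2*d + 3*a*c*d^2) + 6*E*c^2*d^2)
    (4*A*a*b^3 + B*(b^3*c + 3*a*b^2*d) + C*(2*b^2*c*d + 2*a*b*d^2) + D*(3*b*c*d^2 + a*d^3) + 4*E*c*d^3)
    (A*b^4 + B*b^3*d + C*b^2*d^2 + D*b*d^3 + E*d^4) x y" for x y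
    unfolding assms unfolding quartic_def by algebra
  note c = quartic_coeff_unique[OF this]
  have "quartic_I A' B' C' D' E' = (a*d - b*c)^4 * quartic_I A B C D E"
    using c by (elim conjE) (rule quartic_IJ_subst(1))
  moreover have "quartic_J A' B' C' D' E' = (a*d - b*c)^6 * quartic_J A B C D E"
    using c by (elim conjE) (rule quartic_IJ_subst(2))
  ultimately have "27 * Delta4 A' B' C' D' E'
      = 4 * ((a*d - b*c)^4 * quartic_I A B C D E)^3 - ((a*d - b*c)^6 * quartic_J A B C D E)^2"
    using Delta4_IJ by simp
  also have "\<dots> = (a*d - b*c)^12 * (4 * quartic_I A B C D E ^ 3 - quartic_J A B C D E ^ 2)"
    by algebra
  also have "\<dots> = 27 * ((a*d - b*c)^12 * Delta4 A B C D E)"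
    unfolding Delta4_IJ[symmetric] by simp
  finally show ?thesis by simp
qed

lemma quartic_eq_normal_form_scale:
  assumes "Delta4 A 0 C 0 E \<noteq> 0"
  obtains s t k \<sigma> \<tau> where "s \<noteq> 0" "t \<noteq> 0" "\<sigma> \<in> {1, -1}" "\<tau> \<in> {1, -1}"
    "\<And>x y. quartic A 0 C 0 E (s * x) (t * y) = quartic \<sigma> 0 k 0 \<tau> x y"
proof -
  have "Delta4 A 0 C 0 E = 16 * A * E * (C^2 - 4*A*E)^2"
    by (simp add: Delta4_def)
  then have nz: "A \<noteq> 0" "E \<noteq> 0" using assms by auto
  have scale: "P * (inverse (root 4 \<bar>P\<bar>) * x)^4 = sgn P * x^4" if "P \<noteq> 0" for P x :: real
    using that by (simp add: power_mult_distrib power_inverse sgn_if field_simps)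
  show ?thesis
  proof (rule that[of "inverse (root 4 \<bar>A\<bar>)" "inverse (root 4 \<bar>E\<bar>)" "sgn A" "sgn E"
        "C * (inverse (root 4 \<bar>A\<bar>) * inverse (root 4 \<bar>E\<bar>))^2"])
    show "quartic A 0 C 0 E (inverse (root 4 \<bar>A\<bar>) * x) (inverse (root 4 \<bar>E\<bar>) * y) =
      quartic (sgn A) 0 (C * (inverse (root 4 \<bar>A\<bar>) * inverse (root 4 \<bar>E\<bar>))^2) 0 (sgn E) x y" for x y
      unfolding quartic_def scale[OF nz(1)] scale[OF nz(2)] by (simp add: power_mult_distrib)
  qed (use nz in \<open>auto simp: sgn_if\<close>)
qed

lemma cubic_largest_positive_root:
  fixes b c d :: real
  assumes "d < 0"
  obtains t where "t > 0" "t^3 + b*t^2 + c*t + d = 0" "3*t^2 + 2*b*t + c \<ge> 0"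
proof -
  define F where "F t = t^3 + b*t^2 + c*t + d" for t
  have cont: "continuous_on S F" for S unfolding F_def by (intro continuous_intros)
  define m where "m = 1 + \<bar>b\<bar> + \<bar>c\<bar> + \<bar>d\<bar>"
  have big: "F t > 0" if "t \<ge> m" for t
  proof -
    have t: "t \<ge> 1" "t > 0" using that by (auto simp: m_def)
    have t2: "1 \<le> t^2" "t \<le> t^2" using t by (simp_all add: power2_eq_square mult_le_cancel_left1 mult_ge1_I)
    have "c * t \<ge> - (\<bar>c\<bar> * t^2)"
    proof -
      have "\<bar>c\<bar> * t \<le> \<bar>c\<bar> * t^2" using t2 by (intro mult_left_mono) auto
      moreover have "- (\<bar>c\<bar> * t) \<le> c * t"
        using mult_right_mono[of "- \<bar>c\<bar>" c t] t by simp
      ultimately show ?thesis by linarith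
    qed
    moreover have "d \<ge> - (\<bar>d\<bar> * t^2)"
      using mult_left_mono[OF t2(1), of "\<bar>d\<bar>"] by simp
    moreover have "b * t^2 \<ge> - (\<bar>b\<bar> * t^2)"
      using mult_right_mono[of "- \<bar>b\<bar>" b "t^2"] by simp
    moreover have "m * t^2 \<le> t^3"
      using mult_right_mono[OF that, of "t^2"] by (simp add: power3_eq_cube power2_eq_square)
    moreover have "m * t^2 = t^2 + \<bar>b\<bar> * t^2 + \<bar>c\<bar> * t^2 + \<bar>d\<bar> * t^2"
      by (simp add: m_def algebra_simps)
    ultimately show ?thesis using t unfolding F_def by (smt (verit) zero_less_power)
  qed
  have m: "m > 0" by (simp add: m_def)
  define R where "R = {0..m} \<inter> F -` {0}"
  have "closed R" unfolding R_def
    by (intro continuous_on_closed_vimage[THEN iffD1, rule_format] continuous_closed_preimage cont) auto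
  moreover have "bounded R" unfolding R_def by (rule bounded_subset[of "{0..m}"]) auto
  ultimately have "compact R" by (simp add: compact_eq_bounded_closed)
  moreover have "R \<noteq> {}"
  proof -
    have "\<exists>t\<ge>0. t \<le> m \<and> F t = 0"
      by (rule IVT') (use assms m big[of m] cont in \<open>auto simp: F_def\<close>)
    then show ?thesis by (auto simp: R_def)
  qed
  ultimately obtain t where t: "t \<in> R" "\<And>s. s \<in> R \<Longrightarrow> s \<le> t"
    using compact_attains_sup by metis
  have Ft: "F t = 0" "0 \<le> t" using t by (auto simp: R_def)
  have "t \<noteq> 0" using Ft assms by (auto simp: F_def)
  have pos: "F s > 0" if "s > t" for s
  proof (rule ccontr)
    assume "\<not> F s > 0"
    then have s: "F s \<le> 0" "s < m" using big[of s] by force+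
    then have "\<exists>r\<ge>s. r \<le> m \<and> F r = 0"
      by (intro IVT') (use big[of m] cont in auto)
    then obtain r where "s \<le> r" "r \<le> m" "F r = 0" by blast
    then have "r \<in> R" using \<open>s > t\<close> Ft by (auto simp: R_def)
    from t(2)[OF this] show False using \<open>s \<le> r\<close> \<open>s > t\<close> by simp
  qed
  have der: "(F has_real_derivative (3*t^2 + 2*b*t + c)) (at t)"
    unfolding F_def by (auto intro!: derivative_eq_intros)
  have "3*t^2 + 2*b*t + c \<ge> 0"
  proof (rule ccontr)
    assume "\<not> ?thesis"
    then obtain e where e: "e > 0" "\<And>h. 0 < h \<Longrightarrow> h < e \<Longrightarrow> F (t + h) < F t"
      using DERIV_neg_dec_right[OF der] by force
    show False using e(2)[of "e/2"] pos[of "t + e/2"] Ft e(1) by simp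
  qed
  with that[of t] Ft \<open>t \<noteq> 0\<close> show ?thesis by (simp add: F_def)
qed

text \<open>A depressed quartic splits into two real quadratics with opposite cross terms, and the two
  are diagonalised simultaneously. With \<open>U = u\<^sup>2\<close> the largest root of the resolvent cubic, the
  discriminant of the equation for \<open>e, f\<close> is the derivative of the resolvent divided by \<open>U\<close>.\<close>

lemma depressed_quartic_biquadratic:
  assumes nz: "Delta4 1 0 p q r \<noteq> 0"
  obtains a b c d P R S where "a*d - b*c \<noteq> (0::real)"
    "\<And>x y. quartic 1 0 p q r (a*x + b*y) (c*x + d*y) = quartic P 0 R 0 S x y"
proof (cases "q = 0")
  case True
  show ?thesis by (rule that[of 1 1 0 0 1 p r]) (simp_all add: True)
next
  case False
  then have "- (q^2) < 0" by simp
  then obtain U where U: "U > 0" "U^3 + (2*p)*U^2 + (p^2 - 4*r)*U + - (q^2) = 0"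
      "3*U^2 + 2*(2*p)*U + (p^2 - 4*r) \<ge> 0"
    by (rule cubic_largest_positive_root)
  define F' where "F' = 3*U^2 + 4*p*U + (p^2 - 4*r)"
  have F'0: "F' \<noteq> 0"
  proof
    assume "F' = 0"
    then have r: "4 * r = p^2 + 3*U^2 + 4*p*U" by (simp add: F'_def)
    moreover have "q^2 = U^3 + (2*p)*U^2 + (p^2 - 4*r)*U" using U(2) by simp
    ultimately have q: "q^2 = - 2*U^3 - 2*p*U^2" by algebra
    have "Delta4 1 0 p q r = - 4*p^3*q^2 - 27*(q^2)^2 + 36*p*q^2*(4*r) + 4*(4*r)*(p^2 - 4*r)^2"
      by (simp add: Delta4_def power2_eq_square power4_eq_xxxx algebra_simps)
    also have "\<dots> = 0" unfolding r q by algebra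
    finally show False using nz by simp
  qed
  then have F': "F' > 0" using U(3) by (simp add: F'_def)
  define u where "u = sqrt U"
  have u: "u > 0" "u^2 = U" using U(1) by (auto simp: u_def)
  define v where "v = (p + U - q/u)/2"
  define w where "w = (p + U + q/u)/2"
  have vw: "v + w - u^2 = p" "u*(w - v) = q" using u by (auto simp: v_def w_def field_simps)
  have "4*(v * w) = (p + U)^2 - (q/u)^2"
  proof -
    have "4 * ((a - b)/2 * ((a + b)/2)) = a^2 - b^2" for a b :: real
      by (simp add: field_simps power2_eq_square)
    then show ?thesis unfolding v_def w_def .
  qed
  also have "(q/u)^2 = q^2/U" by (simp add: power_divide u(2))
  also have "q^2/U = U^2 + 2*p*U + (p^2 - 4*r)"
    using U(1,2) by (simp add: field_simps power2_eq_square power3_eq_cube)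
  finally have vwr: "v * w = r" by (simp add: power2_eq_square algebra_simps)
  define m where "m = (v - w)/u"
  define D where "D = m^2 + 2*(v + w)"
  have um: "u*m = v - w" using u by (simp add: m_def)
  then have "m * U = - q" unfolding u(2)[symmetric] vw(2)[symmetric] by algebra
  then have mU: "m = - q/U" using U(1) by (simp add: field_simps)
  have "v + w = p + U" using vw(1) u by simp
  then have "D * U = q^2/U + 2*(p + U)*U"
    unfolding D_def mU using U(1) by (simp add: field_simps power2_eq_square)
  also have "\<dots> = F'" using \<open>q^2/U = _\<close> by (simp add: F'_def power2_eq_square algebra_simps)
  finally have "D > 0" using F' U(1) by (metis zero_less_mult_pos2)
  define e where "e = (- m + sqrt D)/2"
  define f where "f = (- m - sqrt D)/2"
  have ef: "e + f = - m" by (simp add: e_def f_def field_simps)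
  have "4 * (e*f) = m^2 - (sqrt D)^2" unfolding e_def f_def by algebra
  then have ef2: "2*(e*f) = - (v + w)" using \<open>D > 0\<close> by (simp add: D_def)
  show ?thesis
  proof (rule that[of e 1 f 1 "(e^2 + u*e + v)*(e^2 - u*e + w)"
     "(e^2 + u*e + v)*(f^2 - u*f + w) + (f^2 + u*f + v)*(e^2 - u*e + w)" "(f^2 + u*f + v)*(f^2 - u*f + w)"])
    show "e*1 - f*1 \<noteq> 0" using \<open>D > 0\<close> by (simp add: e_def f_def field_simps)
    fix x y
    let ?X = "e*x + f*y" and ?Y = "1*x + 1*y"
    have "quartic 1 0 p q r ?X ?Y = (?X^2 + u*?X*?Y + v * ?Y^2) * (?X^2 - u*?X*?Y + w*?Y^2)"
      unfolding quartic_def vw(1)[symmetric] vw(2)[symmetric] vwr[symmetric] by algebra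
    also have "?X^2 + u*?X*?Y + v * ?Y^2 = (e^2 + u*e + v)*x^2 + (f^2 + u*f + v)*y^2"
      using ef ef2 um by algebra
    also have "?X^2 - u*?X*?Y + w*?Y^2 = (e^2 - u*e + w)*x^2 + (f^2 - u*f + w)*y^2"
      using ef ef2 um by algebra
    finally show "quartic 1 0 p q r ?X ?Y = quartic ((e^2 + u*e + v)*(e^2 - u*e + w)) 0
      ((e^2 + u*e + v)*(f^2 - u*f + w) + (f^2 + u*f + v)*(e^2 - u*e + w)) 0
      ((f^2 + u*f + v)*(f^2 - u*f + w)) x y"
      unfolding quartic_def by algebra
  qed
qed

theorem quartic_normal_form:
  assumes nz: "Delta4 A B C D E \<noteq> 0"
  obtains a b c d k \<sigma> \<tau> where "a*d - b*c \<noteq> (0::real)" "\<sigma> \<in> {1, -1}" "\<tau> \<in> {1, -1}"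
    "\<sigma> = \<tau> \<Longrightarrow> k^2 \<noteq> 4" "Delta4 A B C D E > 0 \<Longrightarrow> \<sigma> = \<tau>"
    "Delta4 A B C D E < 0 \<Longrightarrow> \<sigma> = 1 \<and> \<tau> = -1"
    "\<And>x y. quartic A B C D E (a*x + b*y) (c*x + d*y) = quartic \<sigma> 0 k 0 \<tau> x y"
proof -
  define lineq where "lineq q q' \<longleftrightarrow> (\<exists>a b c d. a*d - b*c \<noteq> 0 \<and> (\<forall>x y. q (a*x + b*y) (c*x + d*y) = q' x y))"
    for q q' :: "real \<Rightarrow> real \<Rightarrow> real"
  have trans: "lineq q q''" if q: "lineq q q'" "lineq q' q''" for q q' q''
  proof -
    obtain a b c d where 1: "a*d - b*c \<noteq> 0" "\<And>x y. q (a*x + b*y) (c*x + d*y) = q' x y"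
      using q(1) unfolding lineq_def by blast
    obtain a' b' c' d' where 2: "a'*d' - b'*c' \<noteq> 0" "\<And>x y. q' (a'*x + b'*y) (c'*x + d'*y) = q'' x y"
      using q(2) unfolding lineq_def by blast
    have "(a*a' + b*c')*(c*b' + d*d') - (a*b' + b*d')*(c*a' + d*c') = (a*d - b*c)*(a'*d' - b'*c')"
      by algebra
    moreover have "q ((a*a' + b*c')*x + (a*b' + b*d')*y) ((c*a' + d*c')*x + (c*b' + d*d')*y) = q'' x y" for x y
      unfolding 2(2)[symmetric] 1(2)[symmetric] by (simp add: algebra_simps)
    ultimately show ?thesis unfolding lineq_def using 1(1) 2(1) by (metis mult_eq_0_iff)
  qed
  have Delta: "Delta4 A' B' C' D' E' \<noteq> 0 \<and> sgn (Delta4 A' B' C' D' E') = sgn (Delta4 A B C D E)"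
    if l: "lineq (quartic A B C D E) (quartic A' B' C' D' E')" for A' B' C' D' E'
  proof -
    obtain a b c d where 1: "a*d - b*c \<noteq> 0"
        "\<And>x y. quartic A B C D E (a*x + b*y) (c*x + d*y) = quartic A' B' C' D' E' x y"
      using l unfolding lineq_def by blast
    have "(a*d - b*c)^12 > 0" using 1(1) by simp
    with Delta4_subst[OF 1(2)[symmetric]] nz show ?thesis
      by (simp only: sgn_mult sgn_pos mult_1 mult_eq_0_iff) simp
  qed
  have "\<exists>x y. quartic A B C D E x y \<noteq> 0"
  proof (rule ccontr)
    assume "\<not> ?thesis"
    then have "A = 0 \<and> B = 0 \<and> C = 0 \<and> D = 0 \<and> E = 0"
      by (intro quartic_coeff_unique) (auto simp: quartic_def)
    then show False using nz by (simp add: Delta4_def)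
  qed
  then obtain x0 y0 where xy0: "quartic A B C D E x0 y0 \<noteq> 0" by blast
  define A1 where "A1 = quartic A B C D E x0 y0"
  have n0: "x0*x0 - (-y0)*y0 \<noteq> 0"
    using xy0 by (auto simp: quartic_def sum_squares_eq_zero_iff)
  obtain B1 C1 D1 E1 where e1: "\<And>x y. quartic A B C D E (x0*x + (-y0)*y) (y0*x + x0*y) = quartic A1 B1 C1 D1 E1 x y"
  proof
    show "quartic A B C D E (x0*x + (-y0)*y) (y0*x + x0*y) = quartic A1
      (4*A*x0^3*(-y0) + B*(3*x0^2*(-y0)*y0 + x0^3*x0) + C*(2*x0*(-y0)*y0^2 + 2*x0^2*y0*x0) + D*((-y0)*y0^3 + 3*x0*y0^2*x0) + 4*E*y0^3*x0)
      (6*A*x0^2*(-y0)^2 + B*(3*x0*(-y0)^2*y0 + 3*x0^2*(-y0)*x0) + C*((-y0)^2*y0^2 + 4*x0*(-y0)*y0*x0 + x0^2*x0^2)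
        + D*(3*(-y0)*y0^2*x0 + 3*x0*y0*x0^2) + 6*E*y0^2*x0^2)
      (4*A*x0*(-y0)^3 + B*((-y0)^3*y0 + 3*x0*(-y0)^2*x0) + C*(2*(-y0)^2*y0*x0 + 2*x0*(-y0)*x0^2) + D*(3*(-y0)*y0*x0^2 + x0*x0^3) + 4*E*y0*x0^3)
      (A*(-y0)^4 + B*(-y0)^3*x0 + C*(-y0)^2*x0^2 + D*(-y0)*x0^3 + E*x0^4) x y" for x y
      unfolding A1_def quartic_def by algebra
  qed
  have l1: "lineq (quartic A B C D E) (quartic A1 B1 C1 D1 E1)"
    unfolding lineq_def using n0 e1 by blast
  have A1: "A1 \<noteq> 0" using xy0 by (simp add: A1_def)
  define s where "s = - B1/(4*A1)"
  define p where "p = (6*A1* s^2 + 3*B1* s + C1)/A1"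
  define q where "q = (4*A1* s^3 + 3*B1* s^2 + 2*C1* s + D1)/A1"
  define r where "r = (A1* s^4 + B1* s^3 + C1* s^2 + D1* s + E1)/A1"
  have s: "4*A1* s + B1 = 0" using A1 by (simp add: s_def)
  have pqr: "A1*p = 6*A1* s^2 + 3*B1* s + C1" "A1*q = 4*A1* s^3 + 3*B1* s^2 + 2*C1* s + D1"
      "A1*r = A1* s^4 + B1* s^3 + C1* s^2 + D1* s + E1"
    using A1 by (simp_all add: p_def q_def r_def)
  have e2: "quartic A1 B1 C1 D1 E1 (1*x + s*y) (0*x + 1*y) = quartic A1 0 (A1*p) (A1*q) (A1*r) x y" for x y
    unfolding pqr unfolding quartic_def using s by algebra
  have l2: "lineq (quartic A1 B1 C1 D1 E1) (quartic A1 0 (A1*p) (A1*q) (A1*r))"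
    unfolding lineq_def using e2 by (intro exI[of _ 1] exI[of _ s] exI[of _ 0] exI[of _ 1]) auto
  note l12 = trans[OF l1 l2]
  have "Delta4 A1 0 (A1*p) (A1*q) (A1*r) = A1^6 * Delta4 1 0 p q r"
    unfolding Delta4_def by (simp add: power_mult_distrib) algebra
  then have "Delta4 1 0 p q r \<noteq> 0" using Delta[OF l12] by auto
  then obtain a b c d P R S where 3: "a*d - b*c \<noteq> (0::real)"
    "\<And>x y. quartic 1 0 p q r (a*x + b*y) (c*x + d*y) = quartic P 0 R 0 S x y"
    using depressed_quartic_biquadratic by metis
  have hom: "quartic (A1*A') (A1*B') (A1*C') (A1*D') (A1*E') x y = A1 * quartic A' B' C' D' E' x y" for A' B' C' D' E' x y
    by (simp add: quartic_def algebra_simps)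
  have e3: "quartic A1 0 (A1*p) (A1*q) (A1*r) (a*x + b*y) (c*x + d*y) = quartic (A1*P) 0 (A1*R) 0 (A1*S) x y" for x y
    using hom[of 1 0 p q r] hom[of P 0 R 0 S] 3(2) by simp
  have l3: "lineq (quartic A1 0 (A1*p) (A1*q) (A1*r)) (quartic (A1*P) 0 (A1*R) 0 (A1*S))"
    unfolding lineq_def by (intro exI conjI allI) (rule 3(1), rule e3)
  note l123 = trans[OF l12 l3]
  obtain s t k \<sigma> \<tau> where 4: "s \<noteq> 0" "t \<noteq> 0" "\<sigma> \<in> {1, -1}" "\<tau> \<in> {1, -1}"
    "\<And>x y. quartic (A1*P) 0 (A1*R) 0 (A1*S) (s * x) (t * y) = quartic \<sigma> 0 k 0 \<tau> x y"
    using quartic_eq_normal_form_scale[OF conjunct1[OF Delta[OF l123]]] by metis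
  have "lineq (quartic (A1*P) 0 (A1*R) 0 (A1*S)) (quartic \<sigma> 0 k 0 \<tau>)"
    unfolding lineq_def using 4(1,2,5)
    by (intro exI[of _ s] exI[of _ 0] exI[of _ 0] exI[of _ t]) auto
  note l = trans[OF l123 this]
  have Dn: "Delta4 \<sigma> 0 k 0 \<tau> = 16 * \<sigma> * \<tau> * (k^2 - 4*\<sigma>*\<tau>)^2" for \<sigma> k \<tau>
    by (simp add: Delta4_def)
  have sq: "(x::real)^2 \<ge> 0" for x by simp
  define \<sigma>' where "\<sigma>' = (if \<sigma> \<noteq> \<tau> then 1 else \<sigma>)"
  define \<tau>' where "\<tau>' = (if \<sigma> \<noteq> \<tau> then -1 else \<tau>)"
  have "lineq (quartic A B C D E) (quartic \<sigma>' 0 k 0 \<tau>')"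
  proof (cases "\<sigma> = \<sigma>'")
    case True
    then show ?thesis using l 4(3,4) by (auto simp: \<sigma>'_def \<tau>'_def split: if_splits)
  next
    case False
    then have st: "\<sigma> = -1" "\<tau> = 1" "\<sigma>' = 1" "\<tau>' = -1" using 4(3,4) by (auto simp: \<sigma>'_def \<tau>'_def split: if_splits)
    have "lineq (quartic \<sigma> 0 k 0 \<tau>) (quartic \<sigma>' 0 k 0 \<tau>')"
      unfolding lineq_def st
      by (intro exI[of _ 0] exI[of _ 1] exI[of _ 1] exI[of _ 0]) (simp add: quartic_def)
    from trans[OF l this] show ?thesis .
  qed
  note l' = this and D' = Delta[OF this]
  obtain a b c d where 5: "a*d - b*c \<noteq> 0"
      "\<And>x y. quartic A B C D E (a*x + b*y) (c*x + d*y) = quartic \<sigma>' 0 k 0 \<tau>' x y"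
    using l' unfolding lineq_def by blast
  show ?thesis
  proof (rule that[OF 5(1) _ _ _ _ _ 5(2)])
    show "\<sigma>' \<in> {1, -1}" "\<tau>' \<in> {1, -1}" using 4(3,4) by (auto simp: \<sigma>'_def \<tau>'_def)
    show "k^2 \<noteq> 4" if "\<sigma>' = \<tau>'"
    proof -
      have "\<sigma>' * \<tau>' = 1" using that 4(3) by (auto simp: \<sigma>'_def \<tau>'_def split: if_splits)
      then show ?thesis using D' Dn[of \<sigma>' k \<tau>'] by (auto simp: mult.assoc)
    qed
    show "\<sigma>' = \<tau>'" if "Delta4 A B C D E > 0"
    proof (rule ccontr)
      assume "\<sigma>' \<noteq> \<tau>'"
      then have "\<sigma>' = 1" "\<tau>' = -1" by (auto simp: \<sigma>'_def \<tau>'_def split: if_splits)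
      then have "Delta4 \<sigma>' 0 k 0 \<tau>' \<le> 0" using Dn[of \<sigma>' k \<tau>'] sq by simp
      then show False using D' that by (simp add: sgn_if split: if_splits)
    qed
    show "\<sigma>' = 1 \<and> \<tau>' = -1" if "Delta4 A B C D E < 0"
    proof (rule ccontr)
      assume "\<not> ?thesis"
      then have "\<sigma>' * \<tau>' = 1" using 4(3) by (auto simp: \<sigma>'_def \<tau>'_def split: if_splits)
      then have "Delta4 \<sigma>' 0 k 0 \<tau>' \<ge> 0" using Dn[of \<sigma>' k \<tau>'] sq by (simp add: mult.assoc)
      then show False using D' that by (simp add: sgn_if split: if_splits)
    qed
  qed
qed


section \<open>Taylor expansion of an even function\<close>

lemma smooth_map_on_compose_UNIV:
  fixes g :: "real ^ 'n \<Rightarrow> real"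
  assumes "smooth_map_on UNIV g" "smooth_map_on UNIV \<phi>"
  shows "smooth_map_on UNIV (\<lambda>p. g (\<phi> p))"
  using assms smooth_map_on_compose[OF open_UNIV open_UNIV subset_UNIV] by blast

lemma planar_taylor:
  fixes g :: "real ^ 'n \<Rightarrow> real" and e1 e2 :: "real ^ 'n" and i j :: 'n
  assumes g: "smooth_map_on UNIV g" and N: "0 < N" and parity: "\<And>x. g (- x) = s * g x"
  obtains \<rho> where "\<And>m. smooth_map_on UNIV (\<rho> m)" "\<And>m v. m \<le> N \<Longrightarrow> \<rho> m (- v) = (-1) ^ N * s * \<rho> m v"
    "\<And>v. g ((v $ i) *\<^sub>R e1 + (v $ j) *\<^sub>R e2) =
      (\<Sum>m<N. \<Sum>k<N - m. (v $ i) ^ k * (v $ j) ^ m * ((dirD e1 ^^ k) ((dirD e2 ^^ m) g) 0 / (fact k * fact m)))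
      + (\<Sum>m\<le>N. (v $ i) ^ (N - m) * (v $ j) ^ m * \<rho> m v)"
proof -
  define G where "G m k = (dirD e1 ^^ k) ((dirD e2 ^^ m) g)" for m k
  have G: "smooth_map_on UNIV (G m k)" for m k
    unfolding G_def by (intro smooth_dirD_pow g)
  have Gp: "G m k (- x) = (-1) ^ (m + k) * s * G m k x" for m k x
  proof -
    have "(dirD e1 ^^ k) ((dirD e2 ^^ m) g) (- x) = (-1) ^ k * ((-1) ^ m * s) * (dirD e1 ^^ k) ((dirD e2 ^^ m) g) x"
      by (rule dirD_pow_parity[OF smooth_dirD_pow[OF g] dirD_pow_parity[OF g parity]])
    then show ?thesis by (simp add: G_def power_add mult_ac)
  qed
  define R where "R m v = integral {0..1} (\<lambda>t. (1 - t) ^ (N - m - 1) / fact (N - m - 1) / fact m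
      * G m (N - m) ((t * v $ i) *\<^sub>R e1))" for m and v :: "real ^ 'n"
  define R' where "R' v = integral {0..1} (\<lambda>t. (1 - t) ^ (N - 1) / fact (N - 1)
      * G N 0 ((v $ i) *\<^sub>R e1 + (t * v $ j) *\<^sub>R e2))" for v :: "real ^ 'n"
  define \<rho> where "\<rho> m = (if m < N then R m else R')" for m
  have smooth_R: "smooth_map_on UNIV (R m)" for m
  proof -
    have "smooth_map_on UNIV (\<lambda>p::real \<times> (real ^ 'n). ((1 - fst p) ^ (N - m - 1) * (1 / fact (N - m - 1) / fact m))
      * G m (N - m) ((fst p * snd p $ i) *\<^sub>R e1))"
      by (intro smooth_map_on_mult smooth_map_on_power smooth_map_on_diff smooth_map_on_compose_UNIV[OF G] smooth_intros open_UNIV)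
    from smooth_integral[OF this] show ?thesis by (simp add: R_def[abs_def])
  qed
  have smooth_R': "smooth_map_on UNIV R'"
  proof -
    have "smooth_map_on UNIV (\<lambda>p::real \<times> (real ^ 'n). ((1 - fst p) ^ (N - 1) * (1 / fact (N - 1)))
      * G N 0 ((snd p $ i) *\<^sub>R e1 + (fst p * snd p $ j) *\<^sub>R e2))"
      by (intro smooth_map_on_mult smooth_map_on_power smooth_map_on_diff smooth_map_on_compose_UNIV[OF G] smooth_intros open_UNIV)
    from smooth_integral[OF this] show ?thesis by (simp add: R'_def[abs_def])
  qed
  have 1: "smooth_map_on UNIV (\<rho> m)" for m using smooth_R smooth_R' by (simp add: \<rho>_def)
  have 2: "\<rho> m (- v) = (-1) ^ N * s * \<rho> m v" if "m \<le> N" for m v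
  proof (cases "m < N")
    case True
    have "G m (N - m) ((t * (- v) $ i) *\<^sub>R e1) = (-1) ^ N * s * G m (N - m) ((t * v $ i) *\<^sub>R e1)" for t
      using Gp[of m "N - m" "(t * v $ i) *\<^sub>R e1"] that by simp
    then show ?thesis using True
      by (simp only: \<rho>_def R_def if_True mult.left_commute[of _ "(-1) ^ N * s"] integral_mult_right)
  next
    case False
    have "G N 0 (((- v) $ i) *\<^sub>R e1 + (t * (- v) $ j) *\<^sub>R e2)
        = (-1) ^ N * s * G N 0 ((v $ i) *\<^sub>R e1 + (t * v $ j) *\<^sub>R e2)" for t
      using Gp[of N 0 "(v $ i) *\<^sub>R e1 + (t * v $ j) *\<^sub>R e2"] by simp
    then show ?thesis using False
      by (simp only: \<rho>_def R'_def if_False mult.left_commute[of _ "(-1) ^ N * s"] integral_mult_right)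
  qed
  have 3: "g ((v $ i) *\<^sub>R e1 + (v $ j) *\<^sub>R e2) =
      (\<Sum>m<N. \<Sum>k<N - m. (v $ i) ^ k * (v $ j) ^ m * (G m k 0 / (fact k * fact m)))
      + (\<Sum>m\<le>N. (v $ i) ^ (N - m) * (v $ j) ^ m * \<rho> m v)" for v
  proof -
    define x where "x = v $ i"
    define y where "y = v $ j"
    have A: "g (x *\<^sub>R e1 + y *\<^sub>R e2) = (\<Sum>m<N. y ^ m * G m 0 (x *\<^sub>R e1) / fact m) + y ^ N * R' v"
      unfolding taylor_dirD[OF g N, of "x *\<^sub>R e1"]
      by (simp add: dirD_pow_scale_dir[OF g] G_def R'_def x_def y_def mult_ac mult.left_commute[of _ "_ ^ N"])
    have B: "G m 0 (x *\<^sub>R e1) / fact m = (\<Sum>k<N - m. x ^ k * (G m k 0 / (fact k * fact m))) + x ^ (N - m) * R m v"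
      if "m < N" for m
    proof -
      have "0 < N - m" using that by simp
      from taylor_dirD[OF G this, of m 0 0 "x *\<^sub>R e1"]
      have "G m 0 (x *\<^sub>R e1) = (\<Sum>k<N - m. x ^ k * G m k 0 / fact k)
        + integral {0..1} (\<lambda>t. (1 - t) ^ (N - m - 1) / fact (N - m - 1) * (x ^ (N - m) * G m (N - m) ((t * x) *\<^sub>R e1)))"
        by (simp add: dirD_pow_scale_dir[OF G] dirD_pow_scale_dir[OF smooth_dirD_pow[OF g]] G_def)
      moreover have "integral {0..1} (\<lambda>t. (1 - t) ^ (N - m - 1) / fact (N - m - 1) * (x ^ (N - m) * G m (N - m) ((t * x) *\<^sub>R e1)))
        = fact m * (x ^ (N - m) * R m v)"
        unfolding R_def x_def[symmetric] integral_mult_right[symmetric]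
        by (rule integral_cong) (simp add: field_simps)
      ultimately show ?thesis
        by (simp add: add_divide_distrib sum_divide_distrib)
    qed
    have "(\<Sum>m<N. y ^ m * G m 0 (x *\<^sub>R e1) / fact m) = (\<Sum>m<N. y ^ m * (G m 0 (x *\<^sub>R e1) / fact m))"
      by simp
    also have "\<dots> = (\<Sum>m<N. y ^ m * ((\<Sum>k<N - m. x ^ k * (G m k 0 / (fact k * fact m))) + x ^ (N - m) * R m v))"
      by (intro sum.cong refl) (simp only: B lessThan_iff)
    also have "\<dots> = (\<Sum>m<N. \<Sum>k<N - m. x ^ k * y ^ m * (G m k 0 / (fact k * fact m)))
        + (\<Sum>m<N. x ^ (N - m) * y ^ m * \<rho> m v)"
      by (simp add: distrib_left sum.distrib sum_distrib_left \<rho>_def mult_ac)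
    finally show ?thesis
      using A by (simp add: x_def y_def \<rho>_def lessThan_Suc_atMost[symmetric])
  qed
  show ?thesis using that[of \<rho>] 1 2 3 unfolding G_def by blast
qed

lemma second_differential_dirD: "second_differential f x u v = dirD v (dirD u f) x"
  by (simp add: second_differential_def dirD_def)

lemma partial_deriv_dirD:
  assumes "smooth_map_on UNIV f"
  shows "partial_deriv i f = dirD (axis i 1) f"
proof
  fix x
  have "((\<lambda>t. f (x + t *\<^sub>R axis i 1)) has_vector_derivative dirD (axis i 1) f (x + 0 *\<^sub>R axis i 1)) (at 0)"
    by (rule dirD_line[OF assms])
  then show "partial_deriv i f x = dirD (axis i 1) f x"
    unfolding partial_deriv_def by (simp add: DERIV_imp_deriv has_real_derivative_iff_has_vector_derivative)
qed

lemma partial_deriv_pow_dirD: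
  assumes "smooth_map_on UNIV f"
  shows "(partial_deriv i ^^ k) f = (dirD (axis i 1) ^^ k) f"
  by (induction k) (auto simp: partial_deriv_dirD[OF smooth_dirD_pow[OF assms]])

lemma vec_eq_plane_plus_proj:
  assumes "i \<noteq> j"
  shows "v = (v $ i) *\<^sub>R axis i 1 + (v $ j) *\<^sub>R axis j 1 + proj_other i j (v :: real ^ 'n)"
  using assms by (auto simp: vec_eq_iff proj_other_def axis_def)

lemma vec_eq_sum_axis: "(v :: real ^ 'n) = (\<Sum>b\<in>UNIV. (v $ b) *\<^sub>R axis b 1)"
  by (simp add: vec_eq_iff axis_def if_distrib cong: if_cong)

lemma dirD_expand:
  fixes g :: "real ^ 'n \<Rightarrow> real"
  assumes "smooth_map_on UNIV g"
  shows "dirD v g x = (\<Sum>b\<in>UNIV. v $ b * dirD (axis b 1) g x)"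
proof -
  have "dirD (\<Sum>b\<in>UNIV. (v $ b) *\<^sub>R axis b 1) g x = (\<Sum>b\<in>UNIV. v $ b * dirD (axis b 1) g x)"
    by (simp add: dirD_sum_dir[OF assms] dirD_scale_dir[OF assms])
  then show ?thesis by (simp only: vec_eq_sum_axis[symmetric])
qed

lemma dirD_dirD_expand:
  fixes f :: "real ^ 'n \<Rightarrow> real"
  assumes "smooth_map_on UNIV f"
  shows "dirD w (dirD v f) x = (\<Sum>c\<in>UNIV. v $ c * dirD w (dirD (axis c 1) f) x)"
proof -
  have "dirD v f = (\<lambda>x. \<Sum>c\<in>UNIV. v $ c * dirD (axis c 1) f x)"
    using dirD_expand[OF assms] by blast
  moreover have "dirD w (\<lambda>x. \<Sum>c\<in>UNIV. v $ c * dirD (axis c 1) f x) x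
     = (\<Sum>c\<in>UNIV. v $ c * dirD w (dirD (axis c 1) f) x)"
    by (rule dirD_eqI)
      (intro has_derivative_sum has_derivative_mult_right smooth_has_dirD[OF smooth_dirD[OF assms] UNIV_I])
  ultimately show ?thesis by (simp only:)
qed

lemma linear_proj_other: "linear (proj_other i j)"
  by (auto simp: linear_iff proj_other_def vec_eq_iff)

lemma smooth_proj_other [smooth_intros]:
  "open S \<Longrightarrow> smooth_map_on S f \<Longrightarrow> smooth_map_on S (\<lambda>x. proj_other i j (f x))"
  using smooth_map_on_compose_linear linear_proj_other linear_conv_bounded_linear by blast

lemma even_function_decomposition:
  fixes f :: "real ^ 'n \<Rightarrow> real" and i j :: 'n
  assumes ij: "i \<noteq> j" and f: "smooth_map_on UNIV f" and even: "\<And>x. f (- x) = f x"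
    and kernel: "bilinear_kernel (second_differential f 0) = coord_plane i j"
    and A: "A = 1 / fact 4 * (partial_deriv i ^^ 4) f 0"
    and B: "B = 1 / fact 3 * (partial_deriv i ^^ 3) (partial_deriv j f) 0"
    and C: "C = 1 / 4 * (partial_deriv i ^^ 2) ((partial_deriv j ^^ 2) f) 0"
    and D: "D = 1 / fact 3 * partial_deriv i ((partial_deriv j ^^ 3) f) 0"
    and E: "E = 1 / fact 4 * (partial_deriv j ^^ 4) f 0"
  obtains r :: "nat \<Rightarrow> real ^ 'n \<Rightarrow> real" and s :: "nat \<Rightarrow> real ^ 'n \<Rightarrow> real ^ 'n" and S :: "real ^ 'n \<Rightarrow> real ^ 'n ^ 'n"
  where "\<And>k. smooth_map_on UNIV (r k)" "\<And>k. smooth_map_on UNIV (s k)" "smooth_map_on UNIV S"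
    "\<And>k v. k \<le> 5 \<Longrightarrow> r k (- v) = - r k v" "\<And>k v. k \<le> 3 \<Longrightarrow> s k (- v) = s k v" "\<And>v. S (- v) = S v"
    "\<And>u v. u \<bullet> (S 0 *v v) = second_differential f 0 u v / 2"
    "\<And>v. f v = f 0 + quartic A B C D E (v $ i) (v $ j) + (\<Sum>k\<le>5. (v $ i) ^ (5 - k) * (v $ j) ^ k * r k v)
      + (\<Sum>k\<le>3. ((v $ i) ^ (3 - k) * (v $ j) ^ k) *\<^sub>R s k v) \<bullet> proj_other i j v
      + proj_other i j v \<bullet> (S v *v proj_other i j v)"
proof -
  let ?e = "\<lambda>b. axis b (1::real) :: real ^ 'n"
  let ?P = "proj_other i j"
  define pl where "pl v = (v $ i) *\<^sub>R ?e i + (v $ j) *\<^sub>R ?e j" for v :: "real ^ 'n"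
  have even1: "f (- x) = 1 * f x" for x using even by simp
  have odd1: "dirD u f (- x) = (- 1) * dirD u f x" for u x
    using dirD_parity[OF f even1] by simp
  have D2: "dirD w (dirD u f) 0 = 0" if "u \<in> {?e i, ?e j} \<or> w \<in> {?e i, ?e j}" for u w
  proof -
    have k: "dirD w (dirD u f) 0 = 0" if "u \<in> {?e i, ?e j}" for u w
    proof -
      have "u \<in> bilinear_kernel (second_differential f 0)"
        using that unfolding kernel coord_plane_def by (auto intro: span_base)
      then show ?thesis by (simp add: bilinear_kernel_def second_differential_dirD)
    qed
    show ?thesis using that k[of u w] k[of w u] dirD_commute[OF f, of w u] by auto
  qed
  have zero: "(dirD u ^^ k) ((dirD w ^^ m) g) 0 = 0"
    if "smooth_map_on UNIV g" "\<And>x. g (- x) = s * g x" "(-1) ^ (k + m) * s = -1" for u w k m s and g :: "real ^ 'n \<Rightarrow> real"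
  proof -
    have "(dirD u ^^ k) ((dirD w ^^ m) g) (- 0) = (-1) ^ k * ((-1) ^ m * s) * (dirD u ^^ k) ((dirD w ^^ m) g) 0"
      by (rule dirD_pow_parity[OF smooth_dirD_pow[OF that(1)] dirD_pow_parity[OF that(1,2)]])
    then show ?thesis using that(3) by (simp add: power_add mult_ac)
  qed
  have coeffs: "A = (dirD (?e i) ^^ 4) f 0 / 24" "B = (dirD (?e i) ^^ 3) (dirD (?e j) f) 0 / 6"
     "C = (dirD (?e i) ^^ 2) ((dirD (?e j) ^^ 2) f) 0 / 4" "D = dirD (?e i) ((dirD (?e j) ^^ 3) f) 0 / 6"
     "E = (dirD (?e j) ^^ 4) f 0 / 24"
    unfolding A B C D E
    by (simp_all add: partial_deriv_pow_dirD partial_deriv_dirD smooth_dirD_pow smooth_dirD f fact_numeral)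
  obtain r where r: "\<And>m. smooth_map_on UNIV (r m)" "\<And>m v. m \<le> 5 \<Longrightarrow> r m (- v) = (-1) ^ 5 * 1 * r m v"
    "\<And>v. f (pl v) =
      (\<Sum>m<5. \<Sum>k<5 - m. (v $ i) ^ k * (v $ j) ^ m * ((dirD (?e i) ^^ k) ((dirD (?e j) ^^ m) f) 0 / (fact k * fact m)))
      + (\<Sum>m\<le>5. (v $ i) ^ (5 - m) * (v $ j) ^ m * r m v)"
    unfolding pl_def by (rule planar_taylor[OF f _ even1, of 5]) auto
  have "(\<Sum>m<5. \<Sum>k<5 - m. (v $ i) ^ k * (v $ j) ^ m * ((dirD (?e i) ^^ k) ((dirD (?e j) ^^ m) f) 0 / (fact k * fact m)))
    = f 0 + quartic A B C D E (v $ i) (v $ j)" for v :: "real ^ 'n"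
  proof -
    have z: "(dirD u ^^ k) ((dirD w ^^ m) f) 0 = 0" if "(-1::real) ^ (k + m) = -1" for u w k m
      using zero[OF f even1, of k m u w] that by simp
    show ?thesis
      using D2[of "?e i" "?e i"] D2[of "?e j" "?e i"] D2[of "?e j" "?e j"]
        z[of 1 0 "?e i"] z[of 0 1] z[of 3 0 "?e i"] z[of 2 1 "?e i" "?e j"] z[of 1 2 "?e i" "?e j"] z[of 0 3 _ "?e j"]
      unfolding coeffs quartic_def
      by (simp add: numeral_eq_Suc lessThan_Suc fact_numeral algebra_simps)
  qed
  then have fpl: "f (pl v) = f 0 + quartic A B C D E (v $ i) (v $ j)
      + (\<Sum>k\<le>5. (v $ i) ^ (5 - k) * (v $ j) ^ k * r k v)" for v
    using r(3) by simp
  have "\<exists>\<rho>. (\<forall>m. smooth_map_on UNIV (\<rho> m)) \<and> (\<forall>m v. m \<le> 3 \<longrightarrow> \<rho> m (- v) = \<rho> m v) \<and>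
    (\<forall>v. dirD (?e b) f (pl v) = (\<Sum>m\<le>3. (v $ i) ^ (3 - m) * (v $ j) ^ m * \<rho> m v))" for b
  proof -
    obtain \<rho> where \<rho>: "\<And>m. smooth_map_on UNIV (\<rho> m)" "\<And>m v. m \<le> 3 \<Longrightarrow> \<rho> m (- v) = (-1) ^ 3 * (- 1) * \<rho> m v"
      "\<And>v. dirD (?e b) f (pl v) =
      (\<Sum>m<3. \<Sum>k<3 - m. (v $ i) ^ k * (v $ j) ^ m * ((dirD (?e i) ^^ k) ((dirD (?e j) ^^ m) (dirD (?e b) f)) 0 / (fact k * fact m)))
      + (\<Sum>m\<le>3. (v $ i) ^ (3 - m) * (v $ j) ^ m * \<rho> m v)"
      unfolding pl_def by (rule planar_taylor[OF smooth_dirD[OF f] _ odd1, of 3]) auto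
    have z: "(dirD u ^^ k) ((dirD w ^^ m) (dirD (?e b) f)) 0 = 0" if "(-1::real) ^ (k + m) = 1" for u w k m
      using zero[OF smooth_dirD[OF f] odd1, of k m u w] that by simp
    have low: "(\<Sum>m<3. \<Sum>k<3 - m. (v $ i) ^ k * (v $ j) ^ m * ((dirD (?e i) ^^ k) ((dirD (?e j) ^^ m) (dirD (?e b) f)) 0 / (fact k * fact m))) = 0"
      for v :: "real ^ 'n"
      using D2[of "?e b" "?e i"] D2[of "?e b" "?e j"] z[of 0 0] z[of 2 0 "?e i"] z[of 1 1 "?e i" "?e j"] z[of 0 2 _ "?e j"]
      by (simp add: numeral_eq_Suc lessThan_Suc)
    show ?thesis
    proof (intro exI[of _ \<rho>] conjI allI impI)
      show "\<rho> m (- v) = \<rho> m v" if "m \<le> 3" for m v using \<rho>(2)[OF that] by simp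
      show "dirD (?e b) f (pl v) = (\<Sum>m\<le>3. (v $ i) ^ (3 - m) * (v $ j) ^ m * \<rho> m v)" for v
        unfolding \<rho>(3) low by (rule add_0)
    qed (rule \<rho>(1))
  qed
  then have "\<exists>\<rho>. \<forall>b. (\<forall>m. smooth_map_on UNIV (\<rho> b m)) \<and> (\<forall>m v. m \<le> 3 \<longrightarrow> \<rho> b m (- v) = \<rho> b m v) \<and>
    (\<forall>v. dirD (?e b) f (pl v) = (\<Sum>m\<le>3. (v $ i) ^ (3 - m) * (v $ j) ^ m * \<rho> b m v))"
    by (intro choice allI)
  then obtain \<rho> where \<rho>: "\<And>b m. smooth_map_on UNIV (\<rho> b m)" "\<And>b m v. m \<le> 3 \<Longrightarrow> \<rho> b m (- v) = \<rho> b m v"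
     "\<And>b v. dirD (?e b) f (pl v) = (\<Sum>m\<le>3. (v $ i) ^ (3 - m) * (v $ j) ^ m * \<rho> b m v)"
    by blast
  define s where "s m v = (\<chi> b. \<rho> b m v)" for m v
  define T where "T b c v = integral {0..1} (\<lambda>t. (1 - t) * dirD (?e b) (dirD (?e c) f) (pl v + t *\<^sub>R ?P v))" for b c v
  define S where "S v = (\<chi> b c. T b c v)" for v
  have smooth_T: "smooth_map_on UNIV (T b c)" for b c
  proof -
    have "smooth_map_on UNIV (\<lambda>p::real \<times> (real ^ 'n). (1 - fst p) * dirD (?e b) (dirD (?e c) f) (pl (snd p) + fst p *\<^sub>R ?P (snd p)))"
      unfolding pl_def
      by (intro smooth_map_on_mult smooth_map_on_diff smooth_map_on_compose_UNIV[OF smooth_dirD[OF smooth_dirD[OF f]]]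
          smooth_proj_other smooth_intros open_UNIV)
    from smooth_integral[OF this] show ?thesis by (simp add: T_def[abs_def])
  qed
  have "smooth_map_on UNIV S"
  proof (rule smooth_map_on_componentwise[OF open_UNIV])
    fix u :: "real ^ 'n ^ 'n" assume "u \<in> Basis"
    then obtain b c where "u = axis b (axis c 1)" by (auto simp: Basis_vec_def)
    then show "smooth_map_on UNIV (\<lambda>v. S v \<bullet> u)"
      using smooth_T[of b c] by (simp add: inner_axis S_def)
  qed
  moreover have "S (- v) = S v" for v
  proof -
    have "pl (- v) + t *\<^sub>R ?P (- v) = - (pl v + t *\<^sub>R ?P v)" for t
      by (simp add: pl_def linear_neg[OF linear_proj_other])
    moreover have "dirD b (dirD c f) (- x) = dirD b (dirD c f) x" for b c x
      using dirD_parity[OF smooth_dirD[OF f] odd1] by simp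
    ultimately show ?thesis by (simp only: S_def T_def)
  qed
  moreover have "u \<bullet> (S 0 *v v) = second_differential f 0 u v / 2" for u v
  proof -
    have "integral {0..1} (\<lambda>t::real. 1 - t) = 1 / 2"
    proof (rule integral_unique)
      have "((\<lambda>t::real. 1 - t) has_integral ((1 - 1^2/2) - (0 - 0^2/2))) {0..1}"
        by (rule fundamental_theorem_of_calculus)
          (auto intro!: derivative_eq_intros simp flip: has_real_derivative_iff_has_vector_derivative)
      then show "((\<lambda>t::real. 1 - t) has_integral 1/2) {0..1}" by simp
    qed
    then have T0: "T b c 0 = dirD (?e b) (dirD (?e c) f) 0 / 2" for b c
      by (simp add: T_def pl_def linear_0[OF linear_proj_other])
    have "dirD u (dirD v f) 0 = (\<Sum>b\<in>UNIV. u $ b * (\<Sum>c\<in>UNIV. v $ c * dirD (?e b) (dirD (?e c) f) 0))"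
      unfolding dirD_expand[OF smooth_dirD[OF f], of u] by (simp only: dirD_dirD_expand[OF f, of _ v])
    then have "u \<bullet> (S 0 *v v) = dirD u (dirD v f) 0 / 2"
      by (simp add: inner_vec_def matrix_vector_mult_def S_def T0 sum_divide_distrib sum_distrib_left mult_ac)
    then show ?thesis using dirD_commute[OF f] by (simp add: second_differential_dirD)
  qed
  moreover have "smooth_map_on UNIV (s m)" for m
    unfolding s_def[abs_def] by (intro smooth_map_on_vec_lambda \<rho> open_UNIV)
  moreover have "s m (- v) = s m v" if "m \<le> 3" for m v
    using \<rho>(2)[OF that] by (simp add: s_def)
  moreover have "r k (- v) = - r k v" if "k \<le> 5" for k v
    using r(2)[OF that] by simp
  moreover have "f v = f 0 + quartic A B C D E (v $ i) (v $ j) + (\<Sum>k\<le>5. (v $ i) ^ (5 - k) * (v $ j) ^ k * r k v)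
      + (\<Sum>k\<le>3. ((v $ i) ^ (3 - k) * (v $ j) ^ k) *\<^sub>R s k v) \<bullet> ?P v + ?P v \<bullet> (S v *v ?P v)" for v
  proof -
    let ?z = "?P v"
    have dz2: "dirD ?z (dirD ?z f) x = (\<Sum>b\<in>UNIV. \<Sum>c\<in>UNIV. ?z $ b * ?z $ c * dirD (?e b) (dirD (?e c) f) x)" for x
      unfolding dirD_expand[OF smooth_dirD[OF f], of ?z]
      by (simp only: dirD_dirD_expand[OF f, of _ ?z] sum_distrib_left mult.assoc)
    have "v = pl v + ?z" using vec_eq_plane_plus_proj[OF ij, of v] by (simp add: pl_def)
    then have "f v = f (pl v) + dirD ?z f (pl v)
       + integral {0..1} (\<lambda>t. (1 - t) * dirD ?z (dirD ?z f) (pl v + t *\<^sub>R ?z))"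
      using taylor_dirD[OF f, of 2 "pl v" ?z] by (simp add: numeral_2_eq_2)
    also have "integral {0..1} (\<lambda>t. (1 - t) * dirD ?z (dirD ?z f) (pl v + t *\<^sub>R ?z))
      = integral {0..1} (\<lambda>t. \<Sum>b\<in>UNIV. \<Sum>c\<in>UNIV. ?z $ b * ?z $ c * ((1 - t) * dirD (?e b) (dirD (?e c) f) (pl v + t *\<^sub>R ?z)))"
      by (simp add: dz2 sum_distrib_left mult_ac)
    also have "\<dots> = (\<Sum>b\<in>UNIV. \<Sum>c\<in>UNIV. ?z $ b * ?z $ c * T b c v)"
    proof -
      have int: "(\<lambda>t. (1 - t) * dirD (?e b) (dirD (?e c) f) (pl v + t *\<^sub>R ?z)) integrable_on {0..1}" for b c
        by (intro integrable_continuous_real continuous_intros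
          continuous_on_compose2[OF smooth_map_on_continuous[OF smooth_dirD[OF smooth_dirD[OF f]]]]) auto
      show ?thesis unfolding T_def
        by (simp add: integral_sum integrable_sum integrable_on_mult_right int del: mult.assoc)
    qed
    also have "\<dots> = ?z \<bullet> (S v *v ?z)"
      by (simp add: inner_vec_def matrix_vector_mult_def S_def sum_distrib_left mult_ac)
    also have "dirD ?z f (pl v) = (\<Sum>k\<le>3. ((v $ i) ^ (3 - k) * (v $ j) ^ k) *\<^sub>R s k v) \<bullet> ?z"
      unfolding dirD_expand[OF f, of ?z] \<rho>(3)
      by (simp add: inner_sum_left inner_vec_def s_def sum_distrib_left mult_ac)
    finally show ?thesis unfolding fpl .
  qed
  ultimately show ?thesis using that r(1) by blast
qed


section \<open>Reduction to the quartic form\<close>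

lemma equivariant_implicit_function:
  fixes F :: "'a::euclidean_space \<times> 'b::euclidean_space \<Rightarrow> 'b" and \<tau> \<tau>' :: "'b \<Rightarrow> 'b"
  assumes F: "smooth_map_on UNIV F" "F (0, u0) = 0"
    and inj: "\<And>u. dirD (0, u) F (0, u0) = 0 \<Longrightarrow> u = 0"
    and equiv: "\<And>y u. F (- y, \<tau> u) = \<tau>' (F (y, u))" "\<tau> u0 = u0" "\<tau>' 0 = 0" "bounded_linear \<tau>"
  obtains \<epsilon> g where "\<epsilon> > 0" "smooth_map_on (ball 0 \<epsilon>) g" "g 0 = u0"
    "\<And>y. y \<in> ball 0 \<epsilon> \<Longrightarrow> F (y, g y) = 0" "\<And>y. y \<in> ball 0 \<epsilon> \<Longrightarrow> g (- y) = \<tau> (g y)"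
proof -
  define H where "H p = (fst p, F p)" for p
  have H: "smooth_map_on UNIV H"
    unfolding H_def by (intro smooth_map_on_Pair smooth_map_on_fst smooth_map_on_ident F open_UNIV)
  have injH: "v = 0" if v: "frechet_derivative H (at (0, u0)) v = 0" for v
  proof -
    have "(H has_derivative (\<lambda>v. (fst v, dirD v F (0, u0)))) (at (0, u0))"
      unfolding H_def
      by (intro has_derivative_Pair bounded_linear_imp_has_derivative[OF bounded_linear_fst]
          smooth_has_dirD[OF F(1) UNIV_I])
    from fun_cong[OF frechet_derivative_at[OF this], of v] v have "(fst v, dirD v F (0, u0)) = 0"
      by simp
    then have "fst v = 0" "dirD v F (0, u0) = 0" by (auto simp: zero_prod_def)
    then show ?thesis using inj[of "snd v"] by (cases v) (simp add: zero_prod_def)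
  qed
  obtain W V G where W: "open W" "(0, u0) \<in> W" "open V" "H (0, u0) \<in> V"
      and hom: "homeomorphism W V H G" and G: "smooth_map_on V G"
    using smooth_inverse_function[OF open_UNIV UNIV_I H injH] by metis
  have H0: "H (0, u0) = (0, 0)" by (simp add: H_def F)
  have G0: "G (0, 0) = (0, u0)" using hom W H0 by (metis homeomorphism_def)
  define D where "D = (\<lambda>y. (y, 0)) -` V"
  have D: "open D"
    unfolding D_def by (intro open_vimage W(3) continuous_intros)
  have D0: "0 \<in> D" using W(4) H0 by (simp add: D_def)
  define g where "g y = snd (G (y, 0))" for y
  have HG: "H (G q) = q" "G q \<in> W" if "q \<in> V" for q
    using hom that by (auto simp: homeomorphism_def)
  have injW: "p = q" if "p \<in> W" "q \<in> W" "H p = H q" for p q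
    using hom that by (metis homeomorphism_def)
  have fstG: "G (y, 0) = (y, g y)" "F (y, g y) = 0" if "y \<in> D" for y
  proof -
    have "H (G (y, 0)) = (y, 0)" using HG that by (simp add: D_def)
    then show "G (y, 0) = (y, g y)" "F (y, g y) = 0"
      by (auto simp: H_def g_def prod_eq_iff) (metis fst_conv prod.collapse snd_conv)
  qed
  have smooth_GD: "smooth_map_on D (\<lambda>y. G (y, 0))"
    by (rule smooth_map_on_compose[OF D W(3) _ _ G])
      (auto simp: D_def intro!: smooth_map_on_Pair smooth_map_on_ident smooth_map_on_const D[unfolded D_def])
  then have g: "smooth_map_on D g"
    unfolding g_def by (intro smooth_map_on_snd D)
  define D' where "D' = D \<inter> (\<lambda>y. (- y, \<tau> (g y))) -` W"
  have "open D'"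
    unfolding D'_def
    by (intro continuous_open_preimage D W(1) continuous_on_Pair continuous_on_minus continuous_on_id
        bounded_linear.continuous_on[OF equiv(4)] smooth_map_on_continuous[OF g])
  moreover have "0 \<in> D'" using D0 fstG[OF D0] G0 equiv(2) W(2) by (simp add: D'_def)
  ultimately obtain \<epsilon> where \<epsilon>: "\<epsilon> > 0" "ball 0 \<epsilon> \<subseteq> D'" by (meson open_contains_ball)
  have "g (- y) = \<tau> (g y)" if "y \<in> ball 0 \<epsilon>" for y
  proof -
    have y: "y \<in> D" "- y \<in> D" "(- y, \<tau> (g y)) \<in> W" using that \<epsilon>(2) by (auto simp: D'_def)
    have "H (- y, \<tau> (g y)) = (- y, 0)" using equiv(1,3) fstG[OF y(1)] by (simp add: H_def)
    also have "\<dots> = H (- y, g (- y))" using fstG[OF y(2)] by (simp add: H_def)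
    finally have "(- y, \<tau> (g y)) = (- y, g (- y))"
      using y HG(2)[of "(- y, 0)"] fstG[OF y(2)] by - (rule injW, auto simp: D_def)
    then show ?thesis by simp
  qed
  moreover have "g 0 = u0" using fstG[OF D0] G0 by simp
  moreover have "F (y, g y) = 0" if "y \<in> ball 0 \<epsilon>" for y
    using that \<epsilon>(2) fstG by (auto simp: D'_def)
  moreover have "smooth_map_on (ball 0 \<epsilon>) g"
    using \<epsilon>(2) by (intro smooth_map_on_subset[OF g]) (auto simp: D'_def)
  ultimately show ?thesis using that \<epsilon>(1) by blast
qed

definition pair_coeff :: "(nat \<Rightarrow> real) \<Rightarrow> (nat \<Rightarrow> real) \<Rightarrow> nat \<Rightarrow> real" where
  "pair_coeff a b k = (if k = 0 then a 0 * b 0 else if k = 1 then a 0 * b 1 + a 1 * b 0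
    else if k = 2 then a 0 * b 2 + a 1 * b 1 + a 2 * b 0 else if k = 3 then a 1 * b 2 + a 2 * b 1
    else if k = 4 then a 2 * b 2 else 0)"

definition qform :: "(nat \<Rightarrow> real) \<Rightarrow> real \<Rightarrow> real \<Rightarrow> real" where
  "qform a x y = a 0 * x^2 + a 1 * (x * y) + a 2 * y^2"

definition quartic_linear_part :: "real \<Rightarrow> real \<Rightarrow> real \<Rightarrow> real \<Rightarrow> real \<Rightarrow> (nat \<Rightarrow> real) \<Rightarrow> (nat \<Rightarrow> real) \<Rightarrow> nat \<Rightarrow> real" where
  "quartic_linear_part A B C D E a b k =
    (if k = 0 then 4*A * a 0 + B * b 0
     else if k = 1 then 3*B * a 0 + 4*A * a 1 + 2*C * b 0 + B * b 1
     else if k = 2 then 2*C * a 0 + 3*B * a 1 + 4*A * a 2 + 3*D * b 0 + 2*C * b 1 + B * b 2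
     else if k = 3 then D * a 0 + 2*C * a 1 + 3*B * a 2 + 4*E * b 0 + 3*D * b 1 + 2*C * b 2
     else if k = 4 then D * a 1 + 2*C * a 2 + 4*E * b 1 + 3*D * b 2
     else D * a 2 + 4*E * b 2)"

text \<open>The part of \<open>q(x + u, y + v) - q(x, y)\<close> that is nonlinear in the quadratic forms \<open>u, v\<close> with
  coefficients \<open>a, b\<close> has degree at least six in \<open>(x, y)\<close>. It is written as a combination of the six
  quintic monomials whose coefficients vanish at \<open>(x, y) = 0\<close>.\<close>

definition quartic_nonlinear_part ::
    "real \<Rightarrow> real \<Rightarrow> real \<Rightarrow> real \<Rightarrow> real \<Rightarrow> real \<Rightarrow> real \<Rightarrow> (nat \<Rightarrow> real) \<Rightarrow> (nat \<Rightarrow> real) \<Rightarrow> nat \<Rightarrow> real" where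
  "quartic_nonlinear_part A B C D E x y a b k =
    (let u = qform a x y; v = qform b x y;
       a1 = a 0 * x + a 1 * y; b1 = a 2 * y; a2 = b 0 * x + b 1 * y; b2 = b 2 * y
     in pair_coeff a a k * (6*A*x + 3*B*y + 4*A*u + 3*B * v + A*u*a1 + B*u*a2 + C * v * a2)
       + pair_coeff a b k * (3*B*x + 4*C*y + 2*C * v + D * v * a2)
       + pair_coeff b b k * (C*x + 3*D*y + D * v + E * v * a2)
       + (if k = 0 then 0 else
           pair_coeff a a (k - 1) * (C*y + B*u + 2*C * v + A*u*b1 + B*u*b2 + C * v * b2)
         + pair_coeff a b (k - 1) * (3*D*y + 3*D * v + D * v * b2)
         + pair_coeff b b (k - 1) * (6*E*y + 4*E * v + E * v * b2)))"

lemma sum_atMost_5: "(\<Sum>k\<le>5. g k) = g 0 + g 1 + g 2 + g 3 + g 4 + g (5::nat)"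
  for g :: "nat \<Rightarrow> 'a::comm_monoid_add"
  by (simp add: numeral_eq_Suc atMost_Suc add_ac)

lemma sum_atMost_3: "(\<Sum>k\<le>3. g k) = g 0 + g 1 + g 2 + g (3::nat)"
  for g :: "nat \<Rightarrow> 'a::comm_monoid_add"
  by (simp add: numeral_eq_Suc atMost_Suc add_ac)

lemma quartic_perturbation:
  "quartic A B C D E (x + qform a x y) (y + qform b x y) = quartic A B C D E x y
    + (\<Sum>k\<le>5. x ^ (5 - k) * y ^ k *
        (quartic_linear_part A B C D E a b k + quartic_nonlinear_part A B C D E x y a b k))"
proof -
  define u where "u = qform a x y"
  define v where "v = qform b x y"
  define a1 where "a1 = a 0 * x + a 1 * y"
  define b1 where "b1 = a 2 * y"
  define a2 where "a2 = b 0 * x + b 1 * y"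
  define b2 where "b2 = b 2 * y"
  define \<alpha>11 where "\<alpha>11 = 6*A*x + 3*B*y + 4*A*u + 3*B * v + A*u*a1 + B*u*a2 + C * v * a2"
  define \<beta>11 where "\<beta>11 = C*y + B*u + 2*C * v + A*u*b1 + B*u*b2 + C * v * b2"
  define \<alpha>12 where "\<alpha>12 = 3*B*x + 4*C*y + 2*C * v + D * v * a2"
  define \<beta>12 where "\<beta>12 = 3*D*y + 3*D * v + D * v * b2"
  define \<alpha>22 where "\<alpha>22 = C*x + 3*D*y + D * v + E * v * a2"
  define \<beta>22 where "\<beta>22 = 6*E*y + 4*E * v + E * v * b2"
  have u: "u = x*a1 + y*b1" and v: "v = x*a2 + y*b2"
    by (simp_all add: u_def v_def a1_def b1_def a2_def b2_def qform_def power2_eq_square algebra_simps)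
  have N: "quartic_nonlinear_part A B C D E x y a b k =
     pair_coeff a a k * \<alpha>11 + pair_coeff a b k * \<alpha>12 + pair_coeff b b k * \<alpha>22
       + (if k = 0 then 0 else pair_coeff a a (k - 1) * \<beta>11 + pair_coeff a b (k - 1) * \<beta>12
         + pair_coeff b b (k - 1) * \<beta>22)" for k
    unfolding quartic_nonlinear_part_def Let_def \<alpha>11_def \<alpha>12_def \<alpha>22_def \<beta>11_def \<beta>12_def \<beta>22_def
      u_def v_def a1_def a2_def b1_def b2_def by simp
  have pair: "qform a x y * qform b x y = pair_coeff a b 0 * x^4 + pair_coeff a b 1 * x^3 * y
      + pair_coeff a b 2 * x^2 * y^2 + pair_coeff a b 3 * x * y^3 + pair_coeff a b 4 * y^4" for a b
    unfolding qform_def pair_coeff_def by simp algebra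
  have p5: "pair_coeff a b 5 = 0" for a b by (simp add: pair_coeff_def)
  have "quartic A B C D E (x + u) (y + v) = quartic A B C D E x y
      + ((4*A*x^3 + 3*B*x^2*y + 2*C*x*y^2 + D*y^3) * u + (B*x^3 + 2*C*x^2*y + 3*D*x*y^2 + 4*E*y^3) * v)
      + (u*u) * (6*A*x^2 + 3*B*x*y + C*y^2 + (4*A*x + B*y)*u + (3*B*x + 2*C*y) * v + A*u^2 + B*u * v + C * v^2)
      + (u * v) * (3*B*x^2 + 4*C*x*y + 3*D*y^2 + (2*C*x + 3*D*y) * v + D * v^2)
      + (v * v) * (C*x^2 + 3*D*x*y + 6*E*y^2 + (D*x + 4*E*y) * v + E * v^2)"
    unfolding quartic_def by algebra
  also have "6*A*x^2 + 3*B*x*y + C*y^2 + (4*A*x + B*y)*u + (3*B*x + 2*C*y) * v + A*u^2 + B*u * v + C * v^2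
      = x*\<alpha>11 + y*\<beta>11"
    unfolding \<alpha>11_def \<beta>11_def using u v by algebra
  also have "3*B*x^2 + 4*C*x*y + 3*D*y^2 + (2*C*x + 3*D*y) * v + D * v^2 = x*\<alpha>12 + y*\<beta>12"
    unfolding \<alpha>12_def \<beta>12_def using u v by algebra
  also have "C*x^2 + 3*D*x*y + 6*E*y^2 + (D*x + 4*E*y) * v + E * v^2 = x*\<alpha>22 + y*\<beta>22"
    unfolding \<alpha>22_def \<beta>22_def using u v by algebra
  also have "(4*A*x^3 + 3*B*x^2*y + 2*C*x*y^2 + D*y^3) * u + (B*x^3 + 2*C*x^2*y + 3*D*x*y^2 + 4*E*y^3) * v
      = (\<Sum>k\<le>5. x ^ (5 - k) * y ^ k * quartic_linear_part A B C D E a b k)" (is "?lhs = _")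
  proof -
    have "?lhs = x^5 * (4*A * a 0 + B * b 0) + x^4*y * (3*B * a 0 + 4*A * a 1 + 2*C * b 0 + B * b 1)
      + x^3*y^2 * (2*C * a 0 + 3*B * a 1 + 4*A * a 2 + 3*D * b 0 + 2*C * b 1 + B * b 2)
      + x^2*y^3 * (D * a 0 + 2*C * a 1 + 3*B * a 2 + 4*E * b 0 + 3*D * b 1 + 2*C * b 2)
      + x*y^4 * (D * a 1 + 2*C * a 2 + 4*E * b 1 + 3*D * b 2) + y^5 * (D * a 2 + 4*E * b 2)"
      unfolding u_def v_def qform_def by algebra
    then show ?thesis by (simp add: sum_atMost_5 quartic_linear_part_def)
  qed
  finally have *: "quartic A B C D E (x + u) (y + v) = quartic A B C D E x y
      + (\<Sum>k\<le>5. x ^ (5 - k) * y ^ k * quartic_linear_part A B C D E a b k)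
      + (u * u) * (x*\<alpha>11 + y*\<beta>11) + (u * v) * (x*\<alpha>12 + y*\<beta>12) + (v * v) * (x*\<alpha>22 + y*\<beta>22)"
    by simp
  have "(u * u) * (x*\<alpha>11 + y*\<beta>11) + (u * v) * (x*\<alpha>12 + y*\<beta>12) + (v * v) * (x*\<alpha>22 + y*\<beta>22)
      = (\<Sum>k\<le>5. x ^ (5 - k) * y ^ k * quartic_nonlinear_part A B C D E x y a b k)"
  proof -
    have lift: "(c0 * x^4 + c1 * x^3 * y + c2 * x^2 * y^2 + c3 * x * y^3 + c4 * y^4) * (x*\<alpha> + y*\<beta>)
      = x^5 * (c0*\<alpha>) + x^4 * y * (c1*\<alpha> + c0*\<beta>) + x^3 * y^2 * (c2*\<alpha> + c1*\<beta>) + x^2 * y^3 * (c3*\<alpha> + c2*\<beta>)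
       + x * y^4 * (c4*\<alpha> + c3*\<beta>) + y^5 * (c4*\<beta>)" for c0 c1 c2 c3 c4 \<alpha> \<beta> :: real
      by algebra
    show ?thesis
      unfolding u_def v_def pair lift N sum_atMost_5 by (simp add: p5 algebra_simps)
  qed
  with * show ?thesis by (simp add: u_def v_def sum.distrib distrib_left)
qed

text \<open>The linear part is multiplication of \<open>\<partial>q/\<partial>x, \<partial>q/\<partial>y\<close> by quadratic forms, so its determinant is the
  resultant of the two derivatives. The rows below are those of the adjugate matrix.\<close>

lemma quartic_linear_part_inj:
  assumes nz: "Delta4 A B C D E \<noteq> 0" and z: "\<And>k. k \<le> 5 \<Longrightarrow> quartic_linear_part A B C D E a b k = 0"
    and m: "m < 3"
  shows "a m = 0" "b m = 0"
proof -
  define l0 where "l0 = 4*A * a 0 + B * b 0"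
  define l1 where "l1 = 3*B * a 0 + 4*A * a 1 + 2*C * b 0 + B * b 1"
  define l2 where "l2 = 2*C * a 0 + 3*B * a 1 + 4*A * a 2 + 3*D * b 0 + 2*C * b 1 + B * b 2"
  define l3 where "l3 = D * a 0 + 2*C * a 1 + 3*B * a 2 + 4*E * b 0 + 3*D * b 1 + 2*C * b 2"
  define l4 where "l4 = D * a 1 + 2*C * a 2 + 4*E * b 1 + 3*D * b 2"
  define l5 where "l5 = D * a 2 + 4*E * b 2"
  have l: "l0 = 0" "l1 = 0" "l2 = 0" "l3 = 0" "l4 = 0" "l5 = 0"
    using z[of 0] z[of 1] z[of 2] z[of 3] z[of 4] z[of 5]
    by (simp_all add: quartic_linear_part_def l0_def l1_def l2_def l3_def l4_def l5_def)
  have "a 0 = 0 \<and> a 1 = 0 \<and> a 2 = 0 \<and> b 0 = 0 \<and> b 1 = 0 \<and> b 2 = 0"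
  proof (intro conjI)
    have "16 * Delta4 A B C D E * a 0 = (1024*A^2*E^3 - 704*A*B*D*E^2 - 512*A*C^2*E^2 + 576*A*C*D^2*E - 108*A*D^4 + 384*B^2*C*E^2 + 4*B^2*D^2*E - 272*B*C^2*D*E + 60*B*C*D^3 + 64*C^4*E - 16*C^3*D^2) * l0
      + (128*A*B*C*E^2 - 48*A*B*D^2*E - 144*B^3*E^2 + 112*B^2*C*D*E - 24*B^2*D^3 - 32*B*C^3*E + 8*B*C^2*D^2) * l1
      + (192*A*B^2*E^2 - 128*A*B*C*D*E + 36*A*B*D^3 - 12*B^3*D*E + 16*B^2*C^2*E - 4*B^2*C*D^2) * l2
      + ( - 256*A^2*B*E^2 + 32*A*B^2*D*E + 64*A*B*C^2*E - 24*A*B*C*D^2 - 24*B^3*C*E + 8*B^3*D^2) * l3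
      + (192*A^2*B*D*E - 128*A*B^2*C*E - 12*A*B^2*D^2 + 16*A*B*C^2*D + 36*B^4*E - 4*B^3*C*D) * l4
      + (128*A^2*B*C*E - 144*A^2*B*D^2 - 48*A*B^3*E + 112*A*B^2*C*D - 32*A*B*C^3 - 24*B^4*D + 8*B^3*C^2) * l5"
      unfolding Delta4_def l0_def l1_def l2_def l3_def l4_def l5_def by algebra
    then show "a 0 = 0" using nz by (simp add: l)
  next
    have "16 * Delta4 A B C D E * a 1 = ( - 768*A*B*E^3 + 128*A*C*D*E^2 + 480*B^2*D*E^2 - 64*B*C^2*E^2 - 320*B*C*D^2*E + 72*B*D^4 + 96*C^3*D*E - 24*C^2*D^3) * l0
      + (1024*A^2*E^3 - 704*A*B*D*E^2 - 256*A*C^2*E^2 + 480*A*C*D^2*E - 108*A*D^4 + 96*B^2*C*E^2 + 4*B^2*D^2*E - 48*B*C^2*D*E + 12*B*C*D^3) * l1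
      + (512*A*B*C*E^2 - 48*A*B*D^2*E - 256*A*C^2*D*E + 72*A*C*D^3 - 144*B^3*E^2 + 88*B^2*C*D*E - 24*B^2*D^3) * l2
      + ( - 512*A^2*C*E^2 + 192*A*B^2*E^2 - 64*A*B*C*D*E + 36*A*B*D^3 + 128*A*C^3*E - 48*A*C^2*D^2 - 12*B^3*D*E - 32*B^2*C^2*E + 12*B^2*C*D^2) * l3
      + ( - 256*A^2*B*E^2 + 384*A^2*C*D*E + 32*A*B^2*D*E - 192*A*B*C^2*E - 48*A*B*C*D^2 + 32*A*C^3*D + 48*B^3*C*E + 8*B^3*D^2 - 8*B^2*C^2*D) * l4
      + (192*A^2*B*D*E + 256*A^2*C^2*E - 288*A^2*C*D^2 - 224*A*B^2*C*E - 12*A*B^2*D^2 + 240*A*B*C^2*D - 64*A*C^4 + 36*B^4*E - 52*B^3*C*D + 16*B^2*C^3) * l5"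
      unfolding Delta4_def l0_def l1_def l2_def l3_def l4_def l5_def by algebra
    then show "a 1 = 0" using nz by (simp add: l)
  next
    have "16 * Delta4 A B C D E * a 2 = ( - 512*A*C*E^3 + 192*A*D^2*E^2 + 576*B^2*E^3 - 448*B*C*D*E^2 + 96*B*D^3*E + 128*C^3*E^2 - 32*C^2*D^2*E) * l0
      + ( - 768*A*B*E^3 + 512*A*C*D*E^2 - 144*A*D^3*E + 48*B^2*D*E^2 - 64*B*C^2*E^2 + 16*B*C*D^2*E) * l1
      + (1024*A^2*E^3 - 128*A*B*D*E^2 - 256*A*C^2*E^2 + 96*A*C*D^2*E + 96*B^2*C*E^2 - 32*B^2*D^2*E) * l2
      + ( - 768*A^2*D*E^2 + 512*A*B*C*E^2 + 48*A*B*D^2*E - 64*A*C^2*D*E - 144*B^3*E^2 + 16*B^2*C*D*E) * l3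
      + ( - 512*A^2*C*E^2 + 576*A^2*D^2*E + 192*A*B^2*E^2 - 448*A*B*C*D*E + 128*A*C^3*E + 96*B^3*D*E - 32*B^2*C^2*E) * l4
      + ( - 256*A^2*B*E^2 + 768*A^2*C*D*E - 432*A^2*D^3 - 112*A*B^2*D*E - 192*A*B*C^2*E + 288*A*B*C*D^2 - 64*A*C^3*D + 48*B^3*C*E - 64*B^3*D^2 + 16*B^2*C^2*D) * l5"
      unfolding Delta4_def l0_def l1_def l2_def l3_def l4_def l5_def by algebra
    then show "a 2 = 0" using nz by (simp add: l)
  next
    have "16 * Delta4 A B C D E * b 0 = ( - 256*A^2*D*E^2 + 768*A*B*C*E^2 - 112*A*B*D^2*E - 192*A*C^2*D*E + 48*A*C*D^3 - 432*B^3*E^2 + 288*B^2*C*D*E - 64*B^2*D^3 - 64*B*C^3*E + 16*B*C^2*D^2) * l0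
      + ( - 512*A^2*C*E^2 + 192*A^2*D^2*E + 576*A*B^2*E^2 - 448*A*B*C*D*E + 96*A*B*D^3 + 128*A*C^3*E - 32*A*C^2*D^2) * l1
      + ( - 768*A^2*B*E^2 + 512*A^2*C*D*E - 144*A^2*D^3 + 48*A*B^2*D*E - 64*A*B*C^2*E + 16*A*B*C*D^2) * l2
      + (1024*A^3*E^2 - 128*A^2*B*D*E - 256*A^2*C^2*E + 96*A^2*C*D^2 + 96*A*B^2*C*E - 32*A*B^2*D^2) * l3
      + ( - 768*A^3*D*E + 512*A^2*B*C*E + 48*A^2*B*D^2 - 64*A^2*C^2*D - 144*A*B^3*E + 16*A*B^2*C*D) * l4
      + ( - 512*A^3*C*E + 576*A^3*D^2 + 192*A^2*B^2*E - 448*A^2*B*C*D + 128*A^2*C^3 + 96*A*B^3*D - 32*A*B^2*C^2) * l5"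
      unfolding Delta4_def l0_def l1_def l2_def l3_def l4_def l5_def by algebra
    then show "b 0 = 0" using nz by (simp add: l)
  next
    have "16 * Delta4 A B C D E * b 1 = (192*A*B*D*E^2 + 256*A*C^2*E^2 - 224*A*C*D^2*E + 36*A*D^4 - 288*B^2*C*E^2 - 12*B^2*D^2*E + 240*B*C^2*D*E - 52*B*C*D^3 - 64*C^4*E + 16*C^3*D^2) * l0
      + ( - 256*A^2*D*E^2 + 384*A*B*C*E^2 + 32*A*B*D^2*E - 192*A*C^2*D*E + 48*A*C*D^3 - 48*B^2*C*D*E + 8*B^2*D^3 + 32*B*C^3*E - 8*B*C^2*D^2) * l1
      + ( - 512*A^2*C*E^2 + 192*A^2*D^2*E - 64*A*B*C*D*E - 12*A*B*D^3 + 128*A*C^3*E - 32*A*C^2*D^2 + 36*B^3*D*E - 48*B^2*C^2*E + 12*B^2*C*D^2) * l2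
      + (512*A^2*C*D*E - 144*A^2*D^3 - 48*A*B^2*D*E - 256*A*B*C^2*E + 88*A*B*C*D^2 + 72*B^3*C*E - 24*B^3*D^2) * l3
      + (1024*A^3*E^2 - 704*A^2*B*D*E - 256*A^2*C^2*E + 96*A^2*C*D^2 + 480*A*B^2*C*E + 4*A*B^2*D^2 - 48*A*B*C^2*D - 108*B^4*E + 12*B^3*C*D) * l4
      + ( - 768*A^3*D*E + 128*A^2*B*C*E + 480*A^2*B*D^2 - 64*A^2*C^2*D - 320*A*B^2*C*D + 96*A*B*C^3 + 72*B^4*D - 24*B^3*C^2) * l5"
      unfolding Delta4_def l0_def l1_def l2_def l3_def l4_def l5_def by algebra
    then show "b 1 = 0" using nz by (simp add: l)
  next
    have "16 * Delta4 A B C D E * b 2 = (128*A*C*D*E^2 - 48*A*D^3*E - 144*B^2*D*E^2 + 112*B*C*D^2*E - 24*B*D^4 - 32*C^3*D*E + 8*C^2*D^3) * l0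
      + (192*A*B*D*E^2 - 128*A*C*D^2*E + 36*A*D^4 - 12*B^2*D^2*E + 16*B*C^2*D*E - 4*B*C*D^3) * l1
      + ( - 256*A^2*D*E^2 + 32*A*B*D^2*E + 64*A*C^2*D*E - 24*A*C*D^3 - 24*B^2*C*D*E + 8*B^2*D^3) * l2
      + (192*A^2*D^2*E - 128*A*B*C*D*E - 12*A*B*D^3 + 16*A*C^2*D^2 + 36*B^3*D*E - 4*B^2*C*D^2) * l3
      + (128*A^2*C*D*E - 144*A^2*D^3 - 48*A*B^2*D*E + 112*A*B*C*D^2 - 32*A*C^3*D - 24*B^3*D^2 + 8*B^2*C^2*D) * l4
      + (1024*A^3*E^2 - 704*A^2*B*D*E - 512*A^2*C^2*E + 384*A^2*C*D^2 + 576*A*B^2*C*E + 4*A*B^2*D^2 - 272*A*B*C^2*D + 64*A*C^4 - 108*B^4*E + 60*B^3*C*D - 16*B^2*C^3) * l5"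
      unfolding Delta4_def l0_def l1_def l2_def l3_def l4_def l5_def by algebra
    then show "b 2 = 0" using nz by (simp add: l)
  qed
  moreover have "m = 0 \<or> m = 1 \<or> m = 2" using m by auto
  ultimately show "a m = 0" "b m = 0" by auto
qed

lemma smooth_map_on_if [smooth_intros]:
  "smooth_map_on S f \<Longrightarrow> smooth_map_on S g \<Longrightarrow> smooth_map_on S (\<lambda>x. if c then f x else g x)"
  by (cases c) simp_all

lemma smooth_qform [smooth_intros]:
  assumes "open S" "\<And>k. smooth_map_on S (\<lambda>p. a p k)" "smooth_map_on S x" "smooth_map_on S y"
  shows "smooth_map_on S (\<lambda>p. qform (a p) (x p) (y p))"
  unfolding qform_def by (intro smooth_intros assms)

lemma smooth_pair_coeff [smooth_intros]:
  assumes "open S" "\<And>k. smooth_map_on S (\<lambda>p. a p k)" "\<And>k. smooth_map_on S (\<lambda>p. b p k)"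
  shows "smooth_map_on S (\<lambda>p. pair_coeff (a p) (b p) k)"
  unfolding pair_coeff_def by (intro smooth_intros assms)

lemma smooth_quartic_linear_part [smooth_intros]:
  assumes "open S" "\<And>k. smooth_map_on S (\<lambda>p. a p k)" "\<And>k. smooth_map_on S (\<lambda>p. b p k)"
  shows "smooth_map_on S (\<lambda>p. quartic_linear_part A B C D E (a p) (b p) k)"
  unfolding quartic_linear_part_def by (intro smooth_intros assms)

lemma smooth_quartic_nonlinear_part [smooth_intros]:
  assumes "open S" "\<And>k. smooth_map_on S (\<lambda>p. a p k)" "\<And>k. smooth_map_on S (\<lambda>p. b p k)"
    "smooth_map_on S x" "smooth_map_on S y"
  shows "smooth_map_on S (\<lambda>p. quartic_nonlinear_part A B C D E (x p) (y p) (a p) (b p) k)"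
  unfolding quartic_nonlinear_part_def Let_def by (intro smooth_intros assms)

lemma quartic_linear_part_scale:
  "quartic_linear_part A B C D E (\<lambda>k. t * a k) (\<lambda>k. t * b k) k = t * quartic_linear_part A B C D E a b k"
  unfolding quartic_linear_part_def by (simp add: algebra_simps)

lemma quartic_nonlinear_part_odd:
  "quartic_nonlinear_part A B C D E (- x) (- y) (\<lambda>k. - a k) (\<lambda>k. - b k) k
    = - quartic_nonlinear_part A B C D E x y a b k"
proof -
  have p: "pair_coeff (\<lambda>k. - a k) (\<lambda>k. - b k) k = pair_coeff a b k" for a b k
    unfolding pair_coeff_def by simp
  have q: "qform (\<lambda>k. - a k) (- x) (- y) = - qform a x y" for a
    unfolding qform_def by simp
  show ?thesis unfolding quartic_nonlinear_part_def Let_def p q by (simp add: algebra_simps)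
qed

lemma quartic_nonlinear_part_0: "quartic_nonlinear_part A B C D E 0 0 a b k = 0"
  unfolding quartic_nonlinear_part_def Let_def qform_def by simp


text \<open>Components of triples and quadruples; an index that is too large gives the last component.\<close>

definition tri :: "'b \<times> 'b \<times> 'b \<Rightarrow> nat \<Rightarrow> 'b" where
  "tri q k = (if k = 0 then fst q else if k = 1 then fst (snd q) else snd (snd q))"

definition tet :: "'b \<times> 'b \<times> 'b \<times> 'b \<Rightarrow> nat \<Rightarrow> 'b" where
  "tet q k = (if k = 0 then fst q else if k = 1 then fst (snd q) else if k = 2 then fst (snd (snd q)) else snd (snd (snd q)))"

lemma bounded_linear_tri: "bounded_linear (\<lambda>q. tri q k :: 'b::real_normed_vector)"
  unfolding tri_def
  by (cases "k = 0"; cases "k = 1")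
    (simp_all add: bounded_linear_fst bounded_linear_snd bounded_linear_fst_comp bounded_linear_snd_comp)

lemma bounded_linear_tet: "bounded_linear (\<lambda>q. tet q k :: 'b::real_normed_vector)"
  unfolding tet_def
  by (cases "k = 0"; cases "k = 1"; cases "k = 2")
    (simp_all add: bounded_linear_fst bounded_linear_snd bounded_linear_fst_comp bounded_linear_snd_comp)

lemma tri_eqI:
  assumes "\<And>k. k < 3 \<Longrightarrow> tri p k = tri q k"
  shows "p = q"
  using assms[of 0] assms[of 1] assms[of 2] by (simp add: tri_def prod_eq_iff)

lemma tet_eqI:
  assumes "\<And>k. k \<le> 3 \<Longrightarrow> tet p k = tet q k"
  shows "p = q"
  using assms[of 0] assms[of 1] assms[of 2] assms[of 3] by (simp add: tet_def prod_eq_iff)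

lemma smooth_tri [smooth_intros]:
  fixes f :: "'a::real_normed_vector \<Rightarrow> 'b::euclidean_space \<times> 'b \<times> 'b"
  shows "open S \<Longrightarrow> smooth_map_on S f \<Longrightarrow> smooth_map_on S (\<lambda>x. tri (f x) k)"
  by (rule smooth_map_on_compose_linear[OF bounded_linear_tri])

lemma smooth_tet [smooth_intros]:
  fixes f :: "'a::real_normed_vector \<Rightarrow> 'b::euclidean_space \<times> 'b \<times> 'b \<times> 'b"
  shows "open S \<Longrightarrow> smooth_map_on S f \<Longrightarrow> smooth_map_on S (\<lambda>x. tet (f x) k)"
  by (rule smooth_map_on_compose_linear[OF bounded_linear_tet])

lemma tri_linear:
  fixes p q :: "'b::real_vector \<times> 'b \<times> 'b"
  shows "tri (p + q) k = tri p k + tri q k" "tri (c *\<^sub>R p) k = c *\<^sub>R tri p k" "tri (- p) k = - tri p k" "tri 0 k = (0::'b)"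
  by (simp_all add: tri_def)

lemma tet_linear:
  fixes p q :: "'b::real_vector \<times> 'b \<times> 'b \<times> 'b"
  shows "tet (p + q) k = tet p k + tet q k" "tet (c *\<^sub>R p) k = c *\<^sub>R tet p k" "tet 0 k = (0::'b)"
  by (simp_all add: tet_def)

lemma has_derivative_scaleR_both_vanish:
  assumes "(f has_derivative f') (at x)" "(g has_derivative g') (at x)" "f x = 0" "g x = 0"
  shows "((\<lambda>y. f y *\<^sub>R g y) has_derivative (\<lambda>h. 0)) (at x)"
  using has_derivative_scaleR[OF assms(1,2)] assms(3,4) by simp

definition conv :: "(nat \<Rightarrow> nat \<Rightarrow> real) \<Rightarrow> nat \<Rightarrow> real" where
  "conv G k = (\<Sum>m\<le>3. \<Sum>l\<le>3. if m + l = k then G m l else 0)"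

lemma conv_sum:
  fixes x y :: real
  shows "(\<Sum>m\<le>3. \<Sum>l\<le>3. (x ^ (3 - m) * y ^ m) * (x ^ (3 - l) * y ^ l) * G m l)
    = (\<Sum>k\<le>5. x ^ (5 - k) * y ^ k * (x * conv G k + (if k = 5 then y * conv G 6 else 0)))"
  by (simp add: conv_def sum_atMost_3 sum_atMost_5 algebra_simps power2_eq_square power3_eq_cube power4_eq_xxxx
      numeral_eq_Suc)

type_synonym 'n unknowns = "((real \<times> real \<times> real) \<times> (real \<times> real \<times> real))
  \<times> ((real ^ 'n) \<times> (real ^ 'n) \<times> (real ^ 'n) \<times> (real ^ 'n)) \<times> ((real ^ 'n) ^ 'n)"

theorem even_function_splitting:
  fixes f :: "real ^ 'n \<Rightarrow> real" and i j :: 'n and r :: "nat \<Rightarrow> real ^ 'n \<Rightarrow> real"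
    and s :: "nat \<Rightarrow> real ^ 'n \<Rightarrow> real ^ 'n" and S :: "real ^ 'n \<Rightarrow> real ^ 'n ^ 'n" and K :: "real ^ 'n ^ 'n"
  assumes ij: "i \<noteq> j"
    and smooth: "\<And>k. smooth_map_on UNIV (r k)" "\<And>k. smooth_map_on UNIV (s k)" "smooth_map_on UNIV S"
    and parity: "\<And>k v. k \<le> 5 \<Longrightarrow> r k (- v) = - r k v" "\<And>k v. k \<le> 3 \<Longrightarrow> s k (- v) = s k v" "\<And>v. S (- v) = S v"
    and K: "K = S 0" and Ksym: "\<And>u v. u \<bullet> (K *v v) = v \<bullet> (K *v u)"
    and Kplane: "\<And>u. K *v u = 0 \<longleftrightarrow> proj_other i j u = 0"
    and f: "\<And>v. f v = f 0 + quartic A B C D E (v $ i) (v $ j) + (\<Sum>k\<le>5. (v $ i) ^ (5 - k) * (v $ j) ^ k * r k v)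
      + (\<Sum>k\<le>3. ((v $ i) ^ (3 - k) * (v $ j) ^ k) *\<^sub>R s k v) \<bullet> proj_other i j v
      + proj_other i j v \<bullet> (S v *v proj_other i j v)"
    and nz: "Delta4 A B C D E \<noteq> 0"
  obtains U V h where "odd_diffeo U V h"
    "\<And>x. x \<in> U \<Longrightarrow> f (h x) = f 0 + quartic A B C D E (x $ i) (x $ j) + proj_other i j x \<bullet> (K *v proj_other i j x)"
proof -
  let ?P = "proj_other i j"
  have Plin: "linear ?P" by (rule linear_proj_other)
  note P0 = linear_0[OF Plin] and Padd = linear_add[OF Plin] and Pdiff = linear_diff[OF Plin]
    and Pneg = linear_neg[OF Plin] and Pscale = linear_scale[OF Plin]
  have PP: "?P (?P v) = ?P v" for v by (simp add: proj_other_def vec_eq_iff)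
  have Pe: "?P (axis i 1) = 0" "?P (axis j 1) = 0" by (auto simp: proj_other_def vec_eq_iff axis_def)
  have Psym: "u \<bullet> ?P v = ?P u \<bullet> v" for u v
    by (auto simp: inner_vec_def proj_other_def intro!: sum.cong)
  have KP: "K *v ?P v = K *v v" for v
  proof -
    have "K *v (v - ?P v) = 0" using Kplane[of "v - ?P v"] by (simp add: Pdiff PP)
    then show ?thesis by (simp add: matrix_vector_mult_diff_distrib)
  qed
  have PK: "?P u \<bullet> (K *v v) = u \<bullet> (K *v v)" for u v
    using Ksym[of "?P u" v] Ksym[of v u] KP[of u] by simp
  define Kt where "Kt v = K *v v + (v - ?P v)" for v
  have Ktlin: "linear Kt"
    unfolding Kt_def by (auto simp: linear_iff matrix_vector_right_distrib Padd Pscale algebra_simps matrix_vector_mult_scaleR)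
  have Ktinj: "v = 0" if "Kt v = 0" for v
  proof -
    have "(v - ?P v) \<bullet> Kt v = (v - ?P v) \<bullet> (v - ?P v)"
      unfolding Kt_def using PK[of v v] by (simp add: inner_add_right inner_diff_left)
    then have 1: "v = ?P v" using that by simp
    then have "K *v v = 0" using that by (simp add: Kt_def)
    then show ?thesis using Kplane[of v] 1 by simp
  qed
  have Ktz: "?P u \<bullet> Kt v = u \<bullet> (K *v v)" for u v
    unfolding Kt_def by (simp add: inner_add_right PK) (simp add: Psym[symmetric] Pdiff PP)
  have "surj Kt" using linear_injective_imp_surjective[OF Ktlin] linear_injective_0[OF Ktlin] Ktinj by blast
  then have "\<exists>V0. \<forall>m. 2 *\<^sub>R Kt (V0 m) = s m 0"
  proof -
    have "\<exists>v. Kt v = (1/2) *\<^sub>R s m 0" for m using \<open>surj Kt\<close> by (metis surjD)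
    then have "\<exists>v. 2 *\<^sub>R Kt v = s m 0" for m by (metis scaleR_half_double scaleR_2 scaleR_right_distrib)
    then show ?thesis by (intro choice allI)
  qed
  then obtain V0 where V0: "\<And>m. 2 *\<^sub>R Kt (V0 m) = s m 0" by blast
  define xa where "xa p = tri (fst (fst (snd p)))" for p :: "(real ^ 'n) \<times> 'n unknowns"
  define xb where "xb p = tri (snd (fst (snd p)))" for p :: "(real ^ 'n) \<times> 'n unknowns"
  define xV where "xV p = tet (fst (snd (snd p)))" for p :: "(real ^ 'n) \<times> 'n unknowns"
  define xM where "xM p b = snd (snd (snd p)) $ b" for p :: "(real ^ 'n) \<times> 'n unknowns" and b
  define X where "X p k = fst p $ i * conv (\<lambda>m l. xV p m \<bullet> (K *v xV p l)) k
    + (if k = 5 then fst p $ j * conv (\<lambda>m l. xV p m \<bullet> (K *v xV p l)) 6 else 0)" for p k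
  define EW where "EW p k = quartic_linear_part A B C D E (xa p) (xb p) k
    + quartic_nonlinear_part A B C D E (fst p $ i) (fst p $ j) (xa p) (xb p) k + X p k - r k (fst p)" for p k
  define EV where "EV p m = (\<chi> b. 2 * Kt (xV p m) $ b + 2 * (xM p b \<bullet> (K *v xV p m)) - s m (fst p) $ b)" for p m
  define EM where "EM p = (\<chi> b. \<chi> c. 2 * Kt (xM p c) $ b + xM p b \<bullet> (K *v xM p c) - (S (fst p) $ b $ c - K $ b $ c))" for p
  define F where "F p = (((EW p 0, EW p 1, EW p 2), (EW p 3, EW p 4, EW p 5)),
     (EV p 0, EV p 1, EV p 2, EV p 3), EM p)" for p
  define u0 where "u0 = (((0::real, 0::real, 0::real), (0::real, 0::real, 0::real)), (V0 0, V0 1, V0 2, V0 3), 0 :: (real ^ 'n) ^ 'n)"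
  define \<tau> where "\<tau> u = (- fst u, snd u)" for u :: "'n unknowns"
  note ou = open_UNIV
  have sm: "smooth_map_on UNIV (\<lambda>p. xa p k)" "smooth_map_on UNIV (\<lambda>p. xb p k)" "smooth_map_on UNIV (\<lambda>p. xV p k)"
    "smooth_map_on UNIV (\<lambda>p. xM p b)" for k b
    unfolding xa_def xb_def xV_def xM_def by (intro smooth_intros ou)+
  have sfst: "smooth_map_on UNIV fst" by (intro smooth_map_on_linear bounded_linear_fst)
  have scomp: "smooth_map_on UNIV (\<lambda>p. G (fst p))" if "smooth_map_on UNIV G"
    for G :: "real ^ 'n \<Rightarrow> 'z::real_normed_vector"
    by (rule smooth_map_on_compose[OF ou ou _ sfst that]) simp
  have sK: "smooth_map_on UNIV (\<lambda>p. Kt (G p))" if "smooth_map_on UNIV G" for G :: "'z::real_normed_vector \<Rightarrow> real ^ 'n"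
    unfolding Kt_def using that by (intro smooth_intros ou)
  have sX: "smooth_map_on UNIV (\<lambda>p. X p k)" for k
    unfolding X_def conv_def by (intro smooth_intros ou sm sfst)
  have sEW: "smooth_map_on UNIV (\<lambda>p. EW p k)" for k
    unfolding EW_def
    by (intro smooth_map_on_add smooth_map_on_diff smooth_quartic_linear_part smooth_quartic_nonlinear_part
        smooth_map_on_vec_nth ou sm sfst sX scomp smooth)
  have sEV: "smooth_map_on UNIV (\<lambda>p. EV p k)" for k
    unfolding EV_def
    by (intro smooth_map_on_vec_lambda smooth_map_on_add smooth_map_on_diff smooth_map_on_mult smooth_map_on_const
        smooth_map_on_vec_nth smooth_map_on_inner smooth_map_on_matrix_vector_mult ou sm sK scomp smooth)
  have sEM: "smooth_map_on UNIV EM"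
    unfolding EM_def
    by (intro smooth_map_on_vec_lambda smooth_map_on_add smooth_map_on_diff smooth_map_on_mult smooth_map_on_const
        smooth_map_on_vec_nth smooth_map_on_inner smooth_map_on_matrix_vector_mult ou sm sK scomp smooth)
  have sF: "smooth_map_on UNIV F"
    unfolding F_def by (intro smooth_map_on_Pair sEW sEV sEM ou)
  have r0: "r k 0 = 0" if "k \<le> 5" for k using parity(1)[OF that, of 0] by simp
  have Kt0: "Kt 0 = 0" by (rule linear_0[OF Ktlin])
  have xu0: "xa (y, u0) = (\<lambda>k. 0)" "xb (y, u0) = (\<lambda>k. 0)" "xM (y, u0) = (\<lambda>b. 0)" for y
    by (auto simp: xa_def xb_def xM_def u0_def tri_def)
  have xV0: "xV (y, u0) m = V0 m" if "m \<le> 3" for y m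
  proof -
    have "m = 0 \<or> m = 1 \<or> m = 2 \<or> m = 3" using that by auto
    then show ?thesis by (auto simp: xV_def u0_def tet_def)
  qed
  have L0: "quartic_linear_part A B C D E (\<lambda>k. 0) (\<lambda>k. 0) k = 0" for k
    by (simp add: quartic_linear_part_def)
  have lt: "((k::nat) \<le> 5) = (k = 0 \<or> k = 1 \<or> k = 2 \<or> k = 3 \<or> k = 4 \<or> k = 5)"
      "((m::nat) \<le> 3) = (m = 0 \<or> m = 1 \<or> m = 2 \<or> m = 3)" for k m by auto
  have EW0: "EW (0, u) k = quartic_linear_part A B C D E (xa (0, u)) (xb (0, u)) k" if "k \<le> 5" for u k
    by (simp add: EW_def X_def quartic_nonlinear_part_0 r0[OF that])
  have Fbase: "F (0, u0) = 0"
  proof -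
    have "EW (0, u0) k = 0" if "k \<le> 5" for k using EW0[OF that] by (simp add: xu0 L0)
    moreover have "EV (0, u0) m = 0" if "m \<le> 3" for m
    proof -
      have "2 * Kt (V0 m) $ b = s m 0 $ b" for b
        using arg_cong[OF V0[of m], of "\<lambda>v. v $ b"] by simp
      then show ?thesis by (simp add: EV_def xu0 xV0[OF that] vec_eq_iff)
    qed
    moreover have "EM (0, u0) = 0" by (simp add: EM_def xu0 Kt0 K vec_eq_iff)
    ultimately show ?thesis by (simp add: F_def zero_prod_def)
  qed
  have inj: "u = 0" if u: "dirD (0, u) F (0, u0) = 0" for u
  proof -
    have xl: "xa (0, u0 + t *\<^sub>R u) = (\<lambda>k. t * xa (0, u) k)" "xb (0, u0 + t *\<^sub>R u) = (\<lambda>k. t * xb (0, u) k)"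
      "xM (0, u0 + t *\<^sub>R u) = (\<lambda>b. t *\<^sub>R xM (0, u) b)" for t
      by (auto simp: xa_def xb_def xM_def u0_def tri_def fun_eq_iff)
    have xVl: "xV (0, u0 + t *\<^sub>R u) m = V0 m + t *\<^sub>R xV (0, u) m" if "m \<le> 3" for m t
      using xV0[OF that, of 0] by (simp add: xV_def tet_linear)
    have "((\<lambda>t. F ((0, u0) + t *\<^sub>R (0, u))) has_vector_derivative 0) (at 0)"
      using dirD_line[OF sF, of "(0, u0)" "(0, u)" 0 UNIV] u by simp
    then have dF0: "((\<lambda>t. F (0, u0 + t *\<^sub>R u)) has_vector_derivative 0) (at 0)" by simp
    have dF: "((\<lambda>t. \<phi> (F (0, u0 + t *\<^sub>R u))) has_real_derivative 0) (at 0)" if "bounded_linear \<phi>" for \<phi>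
      using bounded_linear.has_vector_derivative[OF that dF0] linear_0[OF bounded_linear.linear[OF that]]
      by (simp add: has_real_derivative_iff_has_vector_derivative)
    have W: "quartic_linear_part A B C D E (xa (0, u)) (xb (0, u)) k = 0" if k: "k \<le> 5" for k
    proof -
      have bl: "bounded_linear (\<lambda>q :: 'n unknowns. tri (fst (fst q)) m)"
        "bounded_linear (\<lambda>q :: 'n unknowns. tri (snd (fst q)) m)" for m
        by (intro bounded_linear_compose[OF bounded_linear_tri] bounded_linear_fst_comp bounded_linear_snd_comp
            bounded_linear_fst)+
      have "((\<lambda>t. EW (0, u0 + t *\<^sub>R u) k) has_real_derivative 0) (at 0)"
        using k[unfolded lt] dF[OF bl(1)[of 0]] dF[OF bl(1)[of 1]] dF[OF bl(1)[of 2]]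
          dF[OF bl(2)[of 0]] dF[OF bl(2)[of 1]] dF[OF bl(2)[of 2]]
        by (auto simp: F_def tri_def)
      then have "((\<lambda>t. t * quartic_linear_part A B C D E (xa (0, u)) (xb (0, u)) k) has_real_derivative 0) (at 0)"
        unfolding EW0[OF k] xl quartic_linear_part_scale .
      moreover have "((\<lambda>t. t * quartic_linear_part A B C D E (xa (0, u)) (xb (0, u)) k) has_real_derivative
          quartic_linear_part A B C D E (xa (0, u)) (xb (0, u)) k) (at 0)"
        by (auto intro!: derivative_eq_intros)
      ultimately show ?thesis using DERIV_unique by blast
    qed
    have uW: "fst u = 0"
    proof -
      have "tri (fst (fst u)) k = tri 0 k" "tri (snd (fst u)) k = tri 0 k" if "k < 3" for k
        using quartic_linear_part_inj[OF nz W that] by (simp_all add: xa_def xb_def tri_linear)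
      then have "fst (fst u) = 0" "snd (fst u) = 0" by (auto intro: tri_eqI)
      then show ?thesis by (simp add: prod_eq_iff)
    qed
    have M: "xM (0, u) c = 0" for c
    proof -
      have "Kt (xM (0, u) c) $ b = 0" for b
      proof -
        have "bounded_linear (\<lambda>q :: 'n unknowns. snd (snd q) $ b $ c)"
          by (intro bounded_linear_compose[OF bounded_linear_vec_nth] bounded_linear_snd_comp bounded_linear_snd)
        from dF[OF this]
        have "((\<lambda>t. 2 * (t * Kt (xM (0, u) c) $ b) + t * (t * (xM (0, u) b \<bullet> (K *v xM (0, u) c))))
            has_real_derivative 0) (at 0)"
          by (simp add: F_def EM_def xl K linear_scale[OF Ktlin] matrix_vector_mult_scaleR)
        moreover have "((\<lambda>t. 2 * (t * Kt (xM (0, u) c) $ b) + t * (t * (xM (0, u) b \<bullet> (K *v xM (0, u) c))))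
            has_real_derivative 2 * Kt (xM (0, u) c) $ b) (at 0)"
          by (auto intro!: derivative_eq_intros)
        ultimately show ?thesis using DERIV_unique by fastforce
      qed
      then show ?thesis using Ktinj by (simp add: vec_eq_iff)
    qed
    have V: "xV (0, u) m = 0" if m: "m \<le> 3" for m
    proof -
      have "Kt (xV (0, u) m) $ b = 0" for b
      proof -
        have "bounded_linear (\<lambda>q :: 'n unknowns. tet (fst (snd q)) m $ b)"
          by (intro bounded_linear_compose[OF bounded_linear_vec_nth] bounded_linear_compose[OF bounded_linear_tet]
            bounded_linear_fst_comp bounded_linear_snd)
        from dF[OF this]
        have "((\<lambda>t. EV (0, u0 + t *\<^sub>R u) m $ b) has_real_derivative 0) (at 0)"
          using m unfolding lt by (auto simp: F_def tet_def)
        then have "((\<lambda>t. 2 * (Kt (V0 m) $ b + t * Kt (xV (0, u) m) $ b) - s m 0 $ b) has_real_derivative 0) (at 0)"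
          by (simp add: EV_def xl xVl[OF m] M linear_add[OF Ktlin] linear_scale[OF Ktlin])
        moreover have "((\<lambda>t. 2 * (Kt (V0 m) $ b + t * Kt (xV (0, u) m) $ b) - s m 0 $ b)
            has_real_derivative 2 * Kt (xV (0, u) m) $ b) (at 0)"
          by (auto intro!: derivative_eq_intros)
        ultimately show ?thesis using DERIV_unique by fastforce
      qed
      then show ?thesis using Ktinj by (simp add: vec_eq_iff)
    qed
    have "fst (snd u) = 0" by (rule tet_eqI) (use V in \<open>simp add: xV_def tet_linear\<close>)
    moreover have "snd (snd u) = 0" using M by (simp add: xM_def vec_eq_iff)
    ultimately show ?thesis using uW by (simp add: prod_eq_iff)
  qed
  have equiv: "F (- y, \<tau> u) = \<tau> (F (y, u))" for y u
  proof -
    have x: "xa (- y, \<tau> u) = (\<lambda>k. - xa (y, u) k)" "xb (- y, \<tau> u) = (\<lambda>k. - xb (y, u) k)"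
       "xV (- y, \<tau> u) = xV (y, u)" "xM (- y, \<tau> u) = xM (y, u)"
      by (auto simp: xa_def xb_def xV_def xM_def \<tau>_def tri_def fun_eq_iff)
    have L: "quartic_linear_part A B C D E (\<lambda>k. - a k) (\<lambda>k. - b k) k = - quartic_linear_part A B C D E a b k" for a b k
      using quartic_linear_part_scale[of A B C D E "-1" a b k] by simp
    have "EW (- y, \<tau> u) k = - EW (y, u) k" if "k \<le> 5" for k
      unfolding EW_def X_def x L fst_conv vector_uminus_component quartic_nonlinear_part_odd parity(1)[OF that] by simp
    moreover have "EV (- y, \<tau> u) m = EV (y, u) m" if "m \<le> 3" for m
      by (simp add: EV_def x parity(2)[OF that])
    moreover have "EM (- y, \<tau> u) = EM (y, u)" by (simp add: EM_def x parity(3))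
    ultimately show ?thesis by (simp add: F_def \<tau>_def)
  qed
  have \<tau>0: "\<tau> u0 = u0" "\<tau> 0 = 0" by (simp_all add: \<tau>_def u0_def zero_prod_def)
  have "bounded_linear \<tau>"
    unfolding \<tau>_def by (intro bounded_linear_Pair bounded_linear_minus bounded_linear_fst bounded_linear_snd)
  from equivariant_implicit_function[OF sF Fbase inj equiv \<tau>0 this]
  obtain \<epsilon> g where \<epsilon>: "\<epsilon> > 0" and g: "smooth_map_on (ball 0 \<epsilon>) g" "g 0 = u0"
    "\<And>y. y \<in> ball 0 \<epsilon> \<Longrightarrow> F (y, g y) = 0" "\<And>y. y \<in> ball 0 \<epsilon> \<Longrightarrow> g (- y) = \<tau> (g y)"
    by metis
  define a where "a y = xa (y, g y)" for y
  define b where "b y = xb (y, g y)" for y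
  define V where "V y = xV (y, g y)" for y
  define M where "M y = xM (y, g y)" for y
  define T where "T y = (\<Sum>c\<in>UNIV. (?P y $ c) *\<^sub>R M y c)" for y
  define Z where "Z y = (\<Sum>m\<le>3. ((y $ i) ^ (3 - m) * (y $ j) ^ m) *\<^sub>R V y m)" for y
  define \<eta> where "\<eta> y = qform (a y) (y $ i) (y $ j) *\<^sub>R axis i 1 + qform (b y) (y $ i) (y $ j) *\<^sub>R axis j 1
    + ?P (T y + Z y)" for y
  define \<psi> where "\<psi> y = y + \<eta> y" for y
  have identity: "f y = f 0 + quartic A B C D E (\<psi> y $ i) (\<psi> y $ j) + ?P (\<psi> y) \<bullet> (K *v ?P (\<psi> y))"
    if y: "y \<in> ball 0 \<epsilon>" for y
  proof -
    define x where "x = y $ i"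
    define x' where "x' = y $ j"
    define z where "z = ?P y"
    define \<mu> where "\<mu> m = x ^ (3 - m) * x' ^ m" for m
    define w where "w = z + T y + Z y"
    have F0: "F (y, g y) = 0" by (rule g(3)[OF y])
    have EW: "EW (y, g y) k = 0" if "k \<le> 5" for k
      using that[unfolded lt] F0 by (auto simp: F_def zero_prod_def)
    have EV: "EV (y, g y) m = 0" if "m \<le> 3" for m
      using that[unfolded lt] F0 by (auto simp: F_def zero_prod_def)
    have EM: "EM (y, g y) = 0" using F0 by (auto simp: F_def zero_prod_def)
    have r: "r k y = quartic_linear_part A B C D E (a y) (b y) k
       + quartic_nonlinear_part A B C D E x x' (a y) (b y) k + X (y, g y) k" if "k \<le> 5" for k
      using EW[OF that] by (simp add: EW_def a_def b_def x_def x'_def)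
    have KtT: "Kt (T y) = (\<Sum>c\<in>UNIV. z $ c *\<^sub>R Kt (M y c))"
      unfolding T_def z_def linear_sum[OF Ktlin] by (simp only: linear_scale[OF Ktlin])
    have zV: "2 * (z \<bullet> (K *v V y m)) + 2 * (T y \<bullet> (K *v V y m)) = s m y \<bullet> z" if "m \<le> 3" for m
    proof -
      have "2 * Kt (V y m) $ b + 2 * (M y b \<bullet> (K *v V y m)) = s m y $ b" for b
        using arg_cong[OF EV[OF that], of "\<lambda>v. v $ b"] by (simp add: EV_def V_def M_def)
      then have "(\<Sum>b\<in>UNIV. z $ b * (2 * Kt (V y m) $ b + 2 * (M y b \<bullet> (K *v V y m)))) = (\<Sum>b\<in>UNIV. z $ b * s m y $ b)"
        by simp
      then have "2 * (z \<bullet> Kt (V y m)) + 2 * (T y \<bullet> (K *v V y m)) = z \<bullet> s m y"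
        by (simp add: T_def z_def[symmetric] inner_sum_left inner_vec_def[of z] sum.distrib sum_distrib_left distrib_left mult_ac)
      then show ?thesis using Ktz[of y "V y m"] PK[of y "K *v V y m"] PK[of y "V y m"] by (simp add: z_def inner_commute)
    qed
    have zM: "2 * (z \<bullet> (K *v T y)) + T y \<bullet> (K *v T y) = z \<bullet> (S y *v z) - z \<bullet> (K *v z)"
    proof -
      have "2 * Kt (M y c) $ b + M y b \<bullet> (K *v M y c) = S y $ b $ c - K $ b $ c" for b c
        using arg_cong[OF EM, of "\<lambda>v. v $ b $ c"] by (simp add: EM_def M_def)
      then have "(\<Sum>b\<in>UNIV. \<Sum>c\<in>UNIV. z $ b * z $ c * (2 * Kt (M y c) $ b + M y b \<bullet> (K *v M y c)))
        = (\<Sum>b\<in>UNIV. \<Sum>c\<in>UNIV. z $ b * z $ c * (S y $ b $ c - K $ b $ c))" by simp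
      moreover have "(\<Sum>b\<in>UNIV. \<Sum>c\<in>UNIV. z $ b * z $ c * (A $ b $ c)) = z \<bullet> (A *v z)" for A :: "real ^ 'n ^ 'n"
        by (simp add: inner_vec_def matrix_vector_mult_def sum_distrib_left mult_ac)
      moreover have "(\<Sum>b\<in>UNIV. \<Sum>c\<in>UNIV. z $ b * z $ c * Kt (M y c) $ b) = z \<bullet> Kt (T y)"
        unfolding KtT by (simp add: inner_vec_def sum_distrib_left mult_ac)
      moreover have "(\<Sum>b\<in>UNIV. \<Sum>c\<in>UNIV. z $ b * z $ c * (M y b \<bullet> (K *v M y c))) = T y \<bullet> (K *v T y)"
      proof -
        have "K *v T y = (\<Sum>c\<in>UNIV. z $ c *\<^sub>R (K *v M y c))"
          unfolding T_def z_def linear_sum[OF matrix_vector_mul_linear] by (simp only: matrix_vector_mult_scaleR)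
        then show ?thesis
          by (simp add: T_def z_def[symmetric] inner_sum_left inner_sum_right sum_distrib_left mult_ac)
            (subst sum.swap, simp add: mult_ac)
      qed
      ultimately have "2 * (z \<bullet> Kt (T y)) + T y \<bullet> (K *v T y) = z \<bullet> (S y *v z) - z \<bullet> (K *v z)"
        by (simp add: distrib_left right_diff_distrib sum.distrib sum_subtractf sum_distrib_left[symmetric] mult.left_commute[of _ 2])
      then show ?thesis using Ktz[of y "T y"] PK[of y "T y"] by (simp add: z_def)
    qed
    have KZ: "K *v Z y = (\<Sum>m\<le>3. \<mu> m *\<^sub>R (K *v V y m))"
      unfolding Z_def \<mu>_def x_def x'_def linear_sum[OF matrix_vector_mul_linear] by (simp only: matrix_vector_mult_scaleR)
    have zZ: "2 * (z \<bullet> (K *v Z y)) + 2 * (T y \<bullet> (K *v Z y)) = (\<Sum>m\<le>3. \<mu> m *\<^sub>R s m y) \<bullet> z"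
    proof -
      have "(\<Sum>m\<le>3. \<mu> m *\<^sub>R s m y) \<bullet> z = (\<Sum>m\<le>3. \<mu> m * (2 * (z \<bullet> (K *v V y m)) + 2 * (T y \<bullet> (K *v V y m))))"
        unfolding inner_sum_left by (intro sum.cong refl) (simp add: zV)
      then show ?thesis unfolding KZ
        by (simp add: inner_sum_right sum.distrib sum_distrib_left distrib_left mult_ac)
    qed
    have ZZ: "Z y \<bullet> (K *v Z y) = (\<Sum>k\<le>5. x ^ (5 - k) * x' ^ k * X (y, g y) k)"
    proof -
      have "Z y \<bullet> (K *v Z y) = (\<Sum>m\<le>3. \<Sum>l\<le>3. (x ^ (3 - m) * x' ^ m) * (x ^ (3 - l) * x' ^ l) * (V y m \<bullet> (K *v V y l)))"
        unfolding KZ by (simp add: Z_def x_def[symmetric] x'_def[symmetric] \<mu>_def inner_sum_left inner_sum_right sum_distrib_left mult_ac)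
          (intro sum.cong refl arg_cong2[where f = "(*)"] Ksym)
      then show ?thesis unfolding conv_sum by (simp add: X_def V_def x_def x'_def cong: if_cong)
    qed
    have \<psi>i: "\<psi> y $ i = x + qform (a y) x x'" "\<psi> y $ j = x' + qform (b y) x x'"
      using ij by (auto simp: \<psi>_def \<eta>_def x_def x'_def proj_other_def axis_def)
    have "?P (\<psi> y) = ?P w"
      by (simp add: \<psi>_def \<eta>_def w_def z_def Padd Pscale Pe PP)
    then have "?P (\<psi> y) \<bullet> (K *v ?P (\<psi> y)) = w \<bullet> (K *v w)" by (simp add: KP PK)
    also have "\<dots> = z \<bullet> (K *v z) + (2 * (z \<bullet> (K *v T y)) + T y \<bullet> (K *v T y))
        + (2 * (z \<bullet> (K *v Z y)) + 2 * (T y \<bullet> (K *v Z y))) + Z y \<bullet> (K *v Z y)"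
      using Ksym[of "T y" z] Ksym[of "Z y" z] Ksym[of "Z y" "T y"]
      by (simp add: w_def matrix_vector_right_distrib inner_add_left inner_add_right)
    also have "\<dots> = z \<bullet> (S y *v z) + (\<Sum>m\<le>3. \<mu> m *\<^sub>R s m y) \<bullet> z + (\<Sum>k\<le>5. x ^ (5 - k) * x' ^ k * X (y, g y) k)"
      unfolding zM zZ ZZ by simp
    finally have Q: "?P (\<psi> y) \<bullet> (K *v ?P (\<psi> y)) = \<dots>" .
    have "(\<Sum>k\<le>5. x ^ (5 - k) * x' ^ k * r k y) = (\<Sum>k\<le>5. x ^ (5 - k) * x' ^ k *
        (quartic_linear_part A B C D E (a y) (b y) k + quartic_nonlinear_part A B C D E x x' (a y) (b y) k))
      + (\<Sum>k\<le>5. x ^ (5 - k) * x' ^ k * X (y, g y) k)"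
      unfolding sum.distrib[symmetric] by (intro sum.cong refl) (simp add: r distrib_left)
    then show ?thesis
      unfolding Q \<psi>i quartic_perturbation
      by (subst f) (simp add: x_def[symmetric] x'_def[symmetric] z_def[symmetric] \<mu>_def)
  qed
  have sball: "smooth_map_on (ball 0 \<epsilon>) (\<lambda>y. a y k)" "smooth_map_on (ball 0 \<epsilon>) (\<lambda>y. b y k)"
     "smooth_map_on (ball 0 \<epsilon>) (\<lambda>y. V y k)" "smooth_map_on (ball 0 \<epsilon>) (\<lambda>y. M y c)" for k c
    unfolding a_def b_def V_def M_def xa_def xb_def xV_def xM_def by (simp_all, (intro smooth_intros open_ball g)+)
  have s\<psi>: "smooth_map_on (ball 0 \<epsilon>) \<psi>"
    unfolding \<psi>_def \<eta>_def T_def Z_def by (intro smooth_intros open_ball sball)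
  have odd: "- y \<in> ball 0 \<epsilon> \<and> \<psi> (- y) = - \<psi> y" if y: "y \<in> ball 0 \<epsilon>" for y
  proof -
    have gy: "g (- y) = \<tau> (g y)" by (rule g(4)[OF y])
    have sym: "a (- y) = (\<lambda>k. - a y k)" "b (- y) = (\<lambda>k. - b y k)" "V (- y) = V y" "M (- y) = M y"
      by (auto simp: a_def b_def V_def M_def gy xa_def xb_def xV_def xM_def \<tau>_def tri_def fun_eq_iff)
    have q: "qform (\<lambda>k. - a k) (- x) (- x') = - qform a x x'" for a x x'
      by (simp add: qform_def)
    have "T (- y) = - T y" by (simp add: T_def sym Pneg sum_negf)
    moreover have "Z (- y) = - Z y" by (simp add: Z_def sym sum_atMost_3)
    ultimately show ?thesis using y
      by (simp add: \<psi>_def \<eta>_def sym q Pdiff Pneg Padd)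
  qed
  have d\<psi>: "(\<psi> has_derivative (\<lambda>h. h)) (at 0)"
  proof -
    have 0: "0 \<in> ball (0::real ^ 'n) \<epsilon>" using \<epsilon> by simp
    have ab0: "a 0 k = 0" "b 0 k = 0" "M 0 c = 0" for k c
      by (simp_all add: a_def b_def M_def g(2) xu0)
    note der = sball[THEN smooth_map_on_has_derivative, OF 0]
    have coord: "((\<lambda>y::real ^ 'n. y $ c) has_derivative (\<lambda>h. h $ c)) (at 0)" for c :: 'n
      by (rule bounded_linear_imp_has_derivative[OF bounded_linear_vec_nth])
    have mono: "((\<lambda>y::real ^ 'n. (y $ c) * (y $ d)) has_derivative (\<lambda>h. 0)) (at 0)" for c d :: 'n
      using has_derivative_scaleR_both_vanish[OF coord coord] by simp
    have quad: "((\<lambda>y. qform (\<alpha> y) (y $ i) (y $ j)) has_derivative (\<lambda>h. 0)) (at 0)"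
      if "\<And>k. ((\<lambda>y. \<alpha> y k) has_derivative \<alpha>' k) (at 0)" "\<And>k. \<alpha> 0 k = 0" for \<alpha> \<alpha>'
    proof -
      have t: "((\<lambda>y. \<alpha> y k * ((y $ c) * (y $ d))) has_derivative (\<lambda>h. 0)) (at 0)" for k and c d :: 'n
        using has_derivative_scaleR_both_vanish[OF that(1) mono] that(2) by simp
      have "((\<lambda>y. \<alpha> y 0 * ((y $ i) * (y $ i)) + \<alpha> y 1 * ((y $ i) * (y $ j)) + \<alpha> y 2 * ((y $ j) * (y $ j)))
          has_derivative (\<lambda>h. 0 + 0 + 0)) (at 0)"
        by (intro has_derivative_add t)
      then show ?thesis by (simp add: qform_def power2_eq_square)
    qed
    have dT: "(T has_derivative (\<lambda>h. 0)) (at 0)"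
    proof -
      have "((\<lambda>y. ?P y $ c) has_derivative (\<lambda>h. ?P h $ c)) (at 0)" for c
        by (intro bounded_linear_imp_has_derivative bounded_linear_compose[OF bounded_linear_vec_nth]
            linear_conv_bounded_linear[THEN iffD1, OF Plin])
      then have "((\<lambda>y. (?P y $ c) *\<^sub>R M y c) has_derivative (\<lambda>h. 0)) (at 0)" for c
        by (rule has_derivative_scaleR_both_vanish[OF _ der(4)]) (simp_all add: P0 ab0)
      then have "((\<lambda>y. \<Sum>c\<in>UNIV. (?P y $ c) *\<^sub>R M y c) has_derivative (\<lambda>h. \<Sum>c\<in>(UNIV::'n set). 0)) (at 0)"
        by (intro has_derivative_sum)
      then show ?thesis by (simp add: T_def[abs_def])
    qed
    have dZ: "(Z has_derivative (\<lambda>h. 0)) (at 0)"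
    proof -
      have "((\<lambda>y. ((y $ i) ^ (3 - m) * (y $ j) ^ m) *\<^sub>R V y m) has_derivative (\<lambda>h. 0)) (at 0)" if "m \<le> 3" for m
      proof -
        have "((\<lambda>y::real ^ 'n. (y $ i) ^ (3 - m) * (y $ j) ^ m) has_derivative (\<lambda>h. 0)) (at 0)"
          using that unfolding lt
          by (elim disjE) (auto intro!: derivative_eq_intros coord)
        from has_derivative_scaleR[OF this der(3)[of m]]
        show ?thesis
        proof (rule has_derivative_eq_rhs)
          have "(0::real) ^ (3 - m) * 0 ^ m = 0" using that unfolding lt by auto
          then show "(\<lambda>h. ((0::real ^ 'n) $ i ^ (3 - m) * (0::real ^ 'n) $ j ^ m) *\<^sub>R frechet_derivative (\<lambda>y. V y m) (at 0) h
              + 0 *\<^sub>R V 0 m) = (\<lambda>h. 0)"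
            by (simp only: zero_index scaleR_zero_left add_0_left)
        qed
      qed
      then have "((\<lambda>y. \<Sum>m\<le>3. ((y $ i) ^ (3 - m) * (y $ j) ^ m) *\<^sub>R V y m) has_derivative (\<lambda>h. \<Sum>m\<le>(3::nat). 0)) (at 0)"
        by (intro has_derivative_sum) simp
      then show ?thesis by (simp add: Z_def[abs_def])
    qed
    have "((\<lambda>y. ?P (T y + Z y)) has_derivative (\<lambda>h. ?P (0 + 0))) (at 0)"
      by (intro bounded_linear.has_derivative[OF linear_conv_bounded_linear[THEN iffD1, OF Plin]] has_derivative_add dT dZ)
    then have "(\<eta> has_derivative (\<lambda>h. 0 *\<^sub>R axis i 1 + 0 *\<^sub>R axis j 1 + ?P (0 + 0))) (at 0)"
      unfolding \<eta>_def
      by (intro has_derivative_add has_derivative_scaleR_left quad[OF der(1) ab0(1)] quad[OF der(2) ab0(2)])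
    from has_derivative_add[OF has_derivative_ident this] show ?thesis
      by (simp add: \<psi>_def[abs_def] P0)
  qed
  have "v = 0" if "frechet_derivative \<psi> (at 0) v = 0" for v
    using that frechet_derivative_at[OF d\<psi>] by (metis (no_types))
  from odd_diffeo_local_inverse[OF open_ball _ s\<psi> odd this]
  obtain U' V' h where h: "odd_diffeo U' V' h" "V' \<subseteq> ball 0 \<epsilon>" "\<And>x. x \<in> U' \<Longrightarrow> \<psi> (h x) = x"
    using \<epsilon> by (metis centre_in_ball)
  show ?thesis
  proof (rule that[OF h(1)])
    fix x assume x: "x \<in> U'"
    then have "h x \<in> ball 0 \<epsilon>" using h(1,2) by (auto simp: odd_diffeo_def bij_betw_def)
    from identity[OF this] show "f (h x) = f 0 + quartic A B C D E (x $ i) (x $ j) + ?P x \<bullet> (K *v ?P x)"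
      by (simp add: h(3)[OF x])
  qed
qed


section \<open>The singularity class and the discriminant\<close>

lemma coord_plane_iff: "i \<noteq> j \<Longrightarrow> v \<in> coord_plane i j \<longleftrightarrow> proj_other i j v = 0"
proof
  have "subspace {v. proj_other i j v = 0}"
    using linear_subspace_kernel[OF linear_proj_other] .
  moreover have "{axis i 1, axis j 1} \<subseteq> {v. proj_other i j v = 0}"
    by (auto simp: proj_other_def vec_eq_iff axis_def)
  ultimately have "coord_plane i j \<subseteq> {v. proj_other i j v = 0}"
    unfolding coord_plane_def by (rule span_minimal[rotated])
  then show "v \<in> coord_plane i j \<Longrightarrow> proj_other i j v = 0" by blast
next
  assume "i \<noteq> j" "proj_other i j v = 0"
  then have "v = (v $ i) *\<^sub>R axis i 1 + (v $ j) *\<^sub>R axis j 1"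
    using vec_eq_plane_plus_proj[of i j v] by simp
  also have "\<dots> \<in> coord_plane i j"
    unfolding coord_plane_def by (intro span_add span_scale span_base) auto
  finally show "v \<in> coord_plane i j" .
qed

lemma hessian_matrix_properties:
  fixes f :: "real ^ 'n \<Rightarrow> real" and K :: "real ^ 'n ^ 'n"
  assumes ij: "i \<noteq> j" and f: "smooth_map_on UNIV f"
    and kernel: "bilinear_kernel (second_differential f 0) = coord_plane i j"
    and K: "\<And>u v. u \<bullet> (K *v v) = second_differential f 0 u v / 2"
  shows "u \<bullet> (K *v v) = v \<bullet> (K *v u)" "K *v u = 0 \<longleftrightarrow> proj_other i j u = 0"
proof -
  have sym: "second_differential f 0 u v = second_differential f 0 v u" for u v
    unfolding second_differential_dirD by (rule dirD_commute[OF f])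
  then show "u \<bullet> (K *v v) = v \<bullet> (K *v u)" by (simp add: K)
  have "K *v u = 0 \<longleftrightarrow> (\<forall>v. v \<bullet> (K *v u) = 0)" by (metis inner_eq_zero_iff inner_zero_right)
  also have "\<dots> \<longleftrightarrow> (\<forall>v. second_differential f 0 u v = 0)" by (simp add: K sym[of u])
  also have "\<dots> \<longleftrightarrow> u \<in> coord_plane i j" unfolding kernel[symmetric] by (simp add: bilinear_kernel_def)
  finally show "K *v u = 0 \<longleftrightarrow> proj_other i j u = 0" using coord_plane_iff[OF ij] by simp
qed

lemma proj_other_idem: "proj_other i j (proj_other i j v) = proj_other i j v"
  by (simp add: proj_other_def vec_eq_iff)

lemma proj_other_mem: "proj_other i j v \<in> other_coords i j"
  by (simp add: proj_other_def other_coords_def)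

lemma proj_other_fixed: "v \<in> other_coords i j \<Longrightarrow> proj_other i j v = v"
  by (auto simp: proj_other_def other_coords_def vec_eq_iff)

lemma nondegenerate_matrix_form:
  fixes K :: "real ^ 'n ^ 'n"
  assumes sym: "\<And>u v. u \<bullet> (K *v v) = v \<bullet> (K *v u)" and ker: "\<And>u. K *v u = 0 \<longleftrightarrow> proj_other i j u = 0"
  shows "nondegenerate_quadratic_form_on (other_coords i j) (\<lambda>u. u \<bullet> (K *v u))"
  unfolding nondegenerate_quadratic_form_on_def
proof (intro exI[of _ "\<lambda>u v. u \<bullet> (K *v v)"] conjI ballI allI impI sym refl)
  show "bilinear (\<lambda>u v. u \<bullet> (K *v v))"
    by (auto simp: bilinear_def linear_iff matrix_vector_right_distrib inner_add_left inner_add_right matrix_vector_mult_scaleR)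
next
  fix u assume u: "u \<in> other_coords i j" "\<forall>v\<in>other_coords i j. u \<bullet> (K *v v) = 0"
  have KP: "K *v proj_other i j v = K *v v" for v
  proof -
    have "K *v (v - proj_other i j v) = 0"
      using ker[of "v - proj_other i j v"] by (simp add: linear_diff[OF linear_proj_other] proj_other_idem)
    then show ?thesis by (simp add: matrix_vector_mult_diff_distrib)
  qed
  have "(K *v u) \<bullet> (K *v u) = u \<bullet> (K *v proj_other i j (K *v u))"
    unfolding KP by (rule sym)
  also have "\<dots> = 0" using u(2) proj_other_mem by blast
  finally have "proj_other i j u = 0" using ker by simp
  then show "u = 0" using proj_other_fixed[OF u(1)] by simp
qed

lemma X_e5_linear_change:
  fixes f :: "real ^ 'n \<Rightarrow> real" and K :: "real ^ 'n ^ 'n"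
  assumes ij: "i \<noteq> j" and even: "\<And>x. f (- x) = f x" and h: "odd_diffeo U V h"
    and f: "\<And>x. x \<in> U \<Longrightarrow> f (h x) = f 0 + quartic A B C D E (x $ i) (x $ j) + proj_other i j x \<bullet> (K *v proj_other i j x)"
    and Q: "nondegenerate_quadratic_form_on (other_coords i j) (\<lambda>u. u \<bullet> (K *v u))"
    and T: "a*d - b*c \<noteq> 0" "\<And>x y. quartic A B C D E (a*x + b*y) (c*x + d*y) = quartic \<sigma> 0 k 0 \<tau> x y"
    and k: "\<sigma> = \<tau> \<Longrightarrow> k^2 \<noteq> 4"
  shows "f \<in> X_e5 i j \<sigma> \<tau>"
proof -
  define M where "M a b c d x = (a * x $ i + b * x $ j) *\<^sub>R axis i 1 + (c * x $ i + d * x $ j) *\<^sub>R axis j 1 + proj_other i j x"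
    for a b c d and x :: "real ^ 'n"
  have Mp: "M a b c d x $ p = x $ p" if "p \<noteq> i" "p \<noteq> j" for a b c d x p
    using that ij by (auto simp: M_def axis_def proj_other_def)
  have Mij: "M a b c d x $ i = a * x $ i + b * x $ j" "M a b c d x $ j = c * x $ i + d * x $ j" for a b c d x
    using ij by (auto simp: M_def axis_def proj_other_def)
  have lin: "linear (M a b c d)" for a b c d
    unfolding M_def
    by (auto simp: linear_iff algebra_simps linear_add[OF linear_proj_other] linear_scale[OF linear_proj_other])
  have MM: "M a b c d (M a' b' c' d' x) = x"
    if "a*a' + b*c' = 1" "a*b' + b*d' = 0" "c*a' + d*c' = 0" "c*b' + d*d' = 1" for a b c d a' b' c' d' x
  proof -
    have "M a b c d (M a' b' c' d' x) $ p = x $ p" for p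
    proof -
      consider "p = i" | "p = j" | "p \<noteq> i" "p \<noteq> j" by blast
      then show ?thesis
      proof cases
        case 1
        have "a * (a' * x $ i + b' * x $ j) + b * (c' * x $ i + d' * x $ j)
            = (a*a' + b*c') * x $ i + (a*b' + b*d') * x $ j" by (simp add: algebra_simps)
        then show ?thesis using 1 that by (simp add: Mij)
      next
        case 2
        have "c * (a' * x $ i + b' * x $ j) + d * (c' * x $ i + d' * x $ j)
            = (c*a' + d*c') * x $ i + (c*b' + d*d') * x $ j" by (simp add: algebra_simps)
        then show ?thesis using 2 that by (simp add: Mij)
      qed (simp add: Mp)
    qed
    then show ?thesis by (simp add: vec_eq_iff)
  qed
  define \<delta> where "\<delta> = a*d - b*c"
  have \<delta>: "\<delta> \<noteq> 0" using T(1) by (simp add: \<delta>_def)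
  have inv: "M a b c d (M (d/\<delta>) (-b/\<delta>) (-c/\<delta>) (a/\<delta>) x) = x" "M (d/\<delta>) (-b/\<delta>) (-c/\<delta>) (a/\<delta>) (M a b c d x) = x" for x
    by (rule MM; use \<delta> in \<open>simp add: field_simps; simp add: \<delta>_def algebra_simps\<close>)+
  have od: "odd_diffeo (M a b c d -` U) V (\<lambda>x. h (M a b c d x))"
    by (rule odd_diffeo_compose_linear[OF h lin lin inv])
  have PM: "proj_other i j (M a b c d x) = proj_other i j x" for x
    by (auto simp: proj_other_def vec_eq_iff Mp)
  have nf: "f (h (M a b c d x)) = f 0 + \<sigma> * (x $ i) ^ 4 + k * (x $ i)\<^sup>2 * (x $ j)\<^sup>2 + \<tau> * (x $ j) ^ 4
      + proj_other i j x \<bullet> (K *v proj_other i j x)" if "x \<in> M a b c d -` U" for x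
    using f[of "M a b c d x"] that by (simp add: Mij T(2) PM) (simp add: quartic_def)
  show ?thesis
    unfolding X_e5_def mem_Collect_eq
  proof (rule conjI[rotated], rule exI[of _ "M a b c d -` U"], rule exI[of _ V], rule exI[of _ "\<lambda>x. h (M a b c d x)"],
      rule exI[of _ k], rule exI[of _ "f 0"], rule exI[of _ "\<lambda>u. u \<bullet> (K *v u)"], intro conjI od Q impI ballI)
    show "\<forall>\<^sub>F x in nhds 0. f (- x) = f x" by (simp add: even)
  qed (simp_all add: k nf)
qed

lemma continuous_smooth_tendsto:
  assumes "smooth_map_on UNIV \<Phi>" "(p \<longlongrightarrow> l) F"
  shows "((\<lambda>t. \<Phi> (p t)) \<longlongrightarrow> \<Phi> l) F"
  using continuous_on_tendsto_compose[OF smooth_map_on_continuous[OF assms(1)] assms(2)] by simp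

lemma smooth_line_DERIV:
  fixes h :: "real ^ 'n \<Rightarrow> real ^ 'n"
  assumes "smooth_map_on U h" "t *\<^sub>R x \<in> U"
  shows "((\<lambda>t. h (t *\<^sub>R x) $ b) has_real_derivative dirD x h (t *\<^sub>R x) $ b) (at t)"
proof -
  have lin: "linear (\<lambda>v. dirD v h (t *\<^sub>R x))"
    using smooth_has_dirD[OF assms] by (rule has_derivative_linear)
  have "((\<lambda>t. t *\<^sub>R x) has_derivative (\<lambda>s. s *\<^sub>R x)) (at t)"
    by (auto intro!: derivative_eq_intros)
  from has_derivative_compose[OF this smooth_has_dirD[OF assms]]
  have "((\<lambda>t. h (t *\<^sub>R x) $ b) has_derivative (\<lambda>s. dirD (s *\<^sub>R x) h (t *\<^sub>R x) $ b)) (at t)"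
    by (rule bounded_linear.has_derivative[OF bounded_linear_vec_nth])
  then show ?thesis
    unfolding linear_scale[OF lin] has_field_derivative_def by (simp add: mult_commute_abs)
qed

lemma odd_smooth_quadratic_remainder:
  fixes h :: "real ^ 'n \<Rightarrow> real ^ 'n"
  assumes U: "open U" "0 \<in> U" and h: "smooth_map_on U h" and odd: "\<And>x. x \<in> U \<Longrightarrow> - x \<in> U \<and> h (- x) = - h x"
    and zero: "dirD x h 0 $ b = 0"
  shows "((\<lambda>t. h (t *\<^sub>R x) $ b / t^2) \<longlongrightarrow> 0) (at 0)"
proof -
  have [simp]: "h 0 = 0"
  proof -
    have "h 0 + h 0 = 0" using odd[OF U(2)] by (simp add: eq_neg_iff_add_eq_0)
    then show ?thesis by (metis scaleR_2 scaleR_eq_0_iff zero_neq_numeral)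
  qed
  define O' where "O' = (\<lambda>t::real. t *\<^sub>R x) -` U"
  have O': "open O'" "0 \<in> O'"
    unfolding O'_def using U by (auto intro!: open_vimage continuous_intros)
  define \<omega> where "\<omega> t = dirD x h (t *\<^sub>R x) $ b" for t
  have dh: "((\<lambda>t. h (t *\<^sub>R x) $ b) has_real_derivative \<omega> t) (at t)" if "t \<in> O'" for t
    using smooth_line_DERIV[OF h, of t x b] that by (simp add: O'_def \<omega>_def)
  have even: "\<omega> (- t) = \<omega> t" if "t \<in> O'" for t
  proof -
    have t: "t *\<^sub>R x \<in> U" "(- t) *\<^sub>R x \<in> U" using that odd by (auto simp: O'_def)
    then have mt: "- t \<in> O'" by (simp add: O'_def)
    have "((\<lambda>s. - (h ((- s) *\<^sub>R x) $ b)) has_real_derivative - (\<omega> (- t) * (- 1))) (at t)"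
      using dh[OF mt]
      by (intro DERIV_minus DERIV_chain2[where f = "\<lambda>t. h (t *\<^sub>R x) $ b" and g = uminus]) (auto intro!: derivative_eq_intros)
    then have "((\<lambda>s. h (s *\<^sub>R x) $ b) has_real_derivative \<omega> (- t)) (at t)"
    proof (rule DERIV_cong_ev[OF refl _ _, THEN iffD1, rotated 2])
      show "\<forall>\<^sub>F s in nhds t. - (h ((- s) *\<^sub>R x) $ b) = h (s *\<^sub>R x) $ b"
        using eventually_nhds_in_open[OF O'(1) that]
        by eventually_elim (use odd in \<open>auto simp: O'_def\<close>)
    qed simp
    with dh[OF that] show ?thesis by (metis DERIV_unique)
  qed
  obtain d where d: "(\<omega> has_real_derivative d) (at 0)"
    unfolding \<omega>_def using smooth_line_DERIV[OF smooth_dirD[OF h], of 0 x] U(2) by auto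
  have "d = 0"
  proof -
    have "((\<lambda>t. \<omega> (- t)) has_real_derivative d * (- 1)) (at 0)"
      by (rule DERIV_chain2[of \<omega>]) (use d in \<open>auto intro!: derivative_eq_intros\<close>)
    then have "(\<omega> has_real_derivative - d) (at 0)"
    proof (rule DERIV_cong_ev[OF refl _ _, THEN iffD1, rotated 2])
      show "\<forall>\<^sub>F t in nhds 0. \<omega> (- t) = \<omega> t"
        using eventually_nhds_in_open[OF O'] by eventually_elim (rule even)
    qed simp
    with d show ?thesis by (metis DERIV_unique equal_neg_zero)
  qed
  then have "((\<lambda>t. \<omega> t / t) \<longlongrightarrow> 0) (at 0)"
    using d zero by (simp add: has_field_derivative_iff \<omega>_def)
  then have "((\<lambda>t. (\<omega> t / t) / 2) \<longlongrightarrow> 0 / 2) (at 0)" by (intro tendsto_intros) auto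
  then have lim: "((\<lambda>t. \<omega> t / (2 * t)) \<longlongrightarrow> 0) (at 0)" by (simp add: mult.commute)
  show ?thesis
  proof (rule lhopital[OF _ _ _ _ _ _ lim])
    have "isCont (\<lambda>t. h (t *\<^sub>R x) $ b) 0" using dh[OF O'(2)] by (rule DERIV_isCont)
    then show "((\<lambda>t. h (t *\<^sub>R x) $ b) \<longlongrightarrow> 0) (at 0)" by (simp add: isCont_def)
    show "((\<lambda>t. t^2) \<longlongrightarrow> (0::real)) (at 0)" by (auto intro!: tendsto_eq_intros)
    show "\<forall>\<^sub>F t in at 0. (t::real)^2 \<noteq> 0" "\<forall>\<^sub>F t in at 0. 2 * (t::real) \<noteq> 0"
      by (auto simp: eventually_at intro!: exI[of _ 1])
    show "\<forall>\<^sub>F t in at 0. ((\<lambda>t. h (t *\<^sub>R x) $ b) has_real_derivative \<omega> t) (at t)"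
      using eventually_at_in_open'[OF O'] by eventually_elim (rule dh)
    show "\<forall>\<^sub>F t in at 0. ((\<lambda>t. t^2) has_real_derivative 2 * t) (at t)"
      by (auto intro!: derivative_eq_intros always_eventually)
  qed
qed

lemma X_e5_imp_Delta4_nonzero:
  fixes f :: "real ^ 'n \<Rightarrow> real" and i j :: 'n and r :: "nat \<Rightarrow> real ^ 'n \<Rightarrow> real"
    and s :: "nat \<Rightarrow> real ^ 'n \<Rightarrow> real ^ 'n" and S :: "real ^ 'n \<Rightarrow> real ^ 'n ^ 'n" and K :: "real ^ 'n ^ 'n"
  assumes ij: "i \<noteq> j"
    and smooth: "\<And>k. smooth_map_on UNIV (r k)" "\<And>k. smooth_map_on UNIV (s k)" "smooth_map_on UNIV S"
    and K: "K = S 0" and Ksym: "\<And>u v. u \<bullet> (K *v v) = v \<bullet> (K *v u)"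
    and Kplane: "\<And>u. K *v u = 0 \<longleftrightarrow> proj_other i j u = 0"
    and f: "\<And>v. f v = f 0 + quartic A B C D E (v $ i) (v $ j) + (\<Sum>k\<le>5. (v $ i) ^ (5 - k) * (v $ j) ^ k * r k v)
      + (\<Sum>k\<le>3. ((v $ i) ^ (3 - k) * (v $ j) ^ k) *\<^sub>R s k v) \<bullet> proj_other i j v
      + proj_other i j v \<bullet> (S v *v proj_other i j v)"
    and X: "f \<in> X_e5 i j \<sigma> \<tau>" and \<sigma>\<tau>: "\<sigma> \<in> {1, -1}" "\<tau> \<in> {1, -1}"
  shows "Delta4 A B C D E \<noteq> 0"
proof -
  let ?P = "proj_other i j"
  note Pscale = linear_scale[OF linear_proj_other]
  obtain U V h \<kappa> c Q where h: "odd_diffeo U V h" and Q: "nondegenerate_quadratic_form_on (other_coords i j) Q"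
    and \<kappa>: "\<sigma> = \<tau> \<longrightarrow> \<kappa>\<^sup>2 \<noteq> 4"
    and fh: "\<And>x. x \<in> U \<Longrightarrow> f (h x) = c + \<sigma> * (x $ i) ^ 4 + \<kappa> * (x $ i)\<^sup>2 * (x $ j)\<^sup>2 + \<tau> * (x $ j) ^ 4 + Q (?P x)"
    using X unfolding X_e5_def by blast
  have U: "open U" "open V" "0 \<in> U" "bij_betw h U V" "smooth_map_on U h" "smooth_map_on V (inv_into U h)"
      "\<And>x. x \<in> U \<Longrightarrow> - x \<in> U \<and> h (- x) = - h x"
    using h by (auto simp: odd_diffeo_def)
  have h0: "h 0 = 0"
  proof -
    have "h 0 + h 0 = 0" using U(7)[OF U(3)] by (simp add: eq_neg_iff_add_eq_0)
    then show ?thesis by (metis scaleR_2 scaleR_eq_0_iff zero_neq_numeral)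
  qed
  obtain \<beta> where \<beta>: "bilinear \<beta>" "\<And>u. u \<in> other_coords i j \<Longrightarrow> Q u = \<beta> u u"
    using Q unfolding nondegenerate_quadratic_form_on_def by blast
  have Qscale: "Q (?P (t *\<^sub>R x)) = t^2 * Q (?P x)" for t x
  proof -
    have "Q (?P (t *\<^sub>R x)) = \<beta> (t *\<^sub>R ?P x) (t *\<^sub>R ?P x)"
      using \<beta>(2)[OF proj_other_mem, of "t *\<^sub>R x"] by (simp add: Pscale)
    then show ?thesis
      by (simp add: \<beta>(2)[OF proj_other_mem] bilinear_lmul[OF \<beta>(1)] bilinear_rmul[OF \<beta>(1)] power2_eq_square)
  qed
  have Q0: "Q 0 = 0" using Qscale[of 0 0] by (simp add: linear_0[OF linear_proj_other])
  have c: "c = f 0" using fh[OF U(3)] by (simp add: h0 Q0 linear_0[OF linear_proj_other])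
  define L where "L x = dirD x h 0" for x
  have Llin: "linear L"
    unfolding L_def using smooth_has_dirD[OF U(5,3)] by (rule has_derivative_linear)
  have Lsurj: "\<exists>u. L u = v" for v
  proof -
    have V0: "0 \<in> V" using U(3,4) h0 by (metis bij_betwE)
    have g0: "inv_into U h 0 = 0" using U(3,4) h0 by (metis bij_betw_inv_into_left)
    have "((\<lambda>y. h (inv_into U h y)) has_derivative (\<lambda>v. L (dirD v (inv_into U h) 0))) (at 0)"
      unfolding L_def using has_derivative_compose[OF smooth_has_dirD[OF U(6) V0], of h] smooth_has_dirD[OF U(5,3)]
      by (simp add: g0)
    then have "((\<lambda>y. y) has_derivative (\<lambda>v. L (dirD v (inv_into U h) 0))) (at 0)"
      by (rule has_derivative_transform_within_open[OF _ U(2) V0])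
        (metis U(4) bij_betw_inv_into_right)
    from has_derivative_unique[OF this has_derivative_ident] show ?thesis by metis
  qed
  define Y where "Y x t = (1 / t) *\<^sub>R h (t *\<^sub>R x)" for x t
  have hY: "h (t *\<^sub>R x) = t *\<^sub>R Y x t" if "t \<noteq> 0" for t x
    using that by (simp add: Y_def)
  have limY: "(Y x \<longlongrightarrow> L x) (at 0)" for x
  proof (rule vec_tendstoI)
    fix b
    have "((\<lambda>t. h (t *\<^sub>R x) $ b) has_real_derivative L x $ b) (at 0)"
      using smooth_line_DERIV[OF U(5), of 0 x b] U(3) by (simp add: L_def)
    then show "((\<lambda>t. Y x t $ b) \<longlongrightarrow> L x $ b) (at 0)"
      by (simp add: has_field_derivative_iff Y_def h0)
  qed
  have limh: "((\<lambda>t. t *\<^sub>R Y x t) \<longlongrightarrow> 0) (at 0)" for x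
    using tendsto_scaleR[OF tendsto_ident_at limY[of x]] by simp
  have evU: "\<forall>\<^sub>F t in at 0. t \<noteq> 0 \<and> t *\<^sub>R x \<in> U" for x
  proof -
    have "open ((\<lambda>t::real. t *\<^sub>R x) -` U)" "0 \<in> (\<lambda>t::real. t *\<^sub>R x) -` U"
      using U by (auto intro!: open_vimage continuous_intros)
    from eventually_at_in_open[OF this] show ?thesis by eventually_elim auto
  qed
  define nf where "nf x = \<sigma> * (x $ i) ^ 4 + \<kappa> * (x $ i)\<^sup>2 * (x $ j)\<^sup>2 + \<tau> * (x $ j) ^ 4" for x :: "real ^ 'n"
  define R where "R v y = (\<Sum>k\<le>5. (y $ i) ^ (5 - k) * (y $ j) ^ k * r k v)" for v y
  define W where "W v y = (\<Sum>k\<le>3. ((y $ i) ^ (3 - k) * (y $ j) ^ k) *\<^sub>R s k v) \<bullet> ?P y" for v y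
  have hom: "f (t *\<^sub>R y) - f 0 = t^4 * quartic A B C D E (y $ i) (y $ j) + t^5 * R (t *\<^sub>R y) y + t^4 * W (t *\<^sub>R y) y
      + t^2 * (?P y \<bullet> (S (t *\<^sub>R y) *v ?P y))" for t y
    unfolding f[of "t *\<^sub>R y"]
    by (simp add: quartic_def R_def W_def sum_atMost_5 sum_atMost_3 Pscale matrix_vector_mult_scaleR
        inner_add_left algebra_simps power2_eq_square power3_eq_cube power4_eq_xxxx numeral_eq_Suc)
  have fnf: "f (t *\<^sub>R Y x t) - f 0 = t^4 * nf x + t^2 * Q (?P x)" if "t \<noteq> 0 \<and> t *\<^sub>R x \<in> U" for t x
    using fh[of "t *\<^sub>R x"] that unfolding c Qscale
    by (simp add: hY nf_def power_mult_distrib algebra_simps numeral_eq_Suc)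
  have sfst: "smooth_map_on UNIV (\<lambda>p::real \<times> (real ^ 'n) \<times> (real ^ 'n) \<times> (real ^ 'n). G (fst (snd p)))"
    if "smooth_map_on UNIV G" for G :: "real ^ 'n \<Rightarrow> 'z::real_normed_vector"
    by (rule smooth_map_on_compose[OF open_UNIV open_UNIV _ _ that]) (auto intro!: smooth_map_on_fst smooth_map_on_snd smooth_map_on_ident)
  have order2: "?P (L x) \<bullet> (K *v ?P (L x)) = Q (?P x)" for x
  proof -
    define \<Phi> where "\<Phi> p = (fst p)^2 * quartic A B C D E (fst (snd (snd p)) $ i) (fst (snd (snd p)) $ j)
      + (fst p)^3 * R (fst (snd p)) (fst (snd (snd p))) + (fst p)^2 * W (fst (snd p)) (fst (snd (snd p)))
      + ?P (fst (snd (snd p))) \<bullet> (S (fst (snd p)) *v ?P (fst (snd (snd p))))" for p :: "real \<times> (real ^ 'n) \<times> (real ^ 'n) \<times> (real ^ 'n)"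
    have "smooth_map_on UNIV \<Phi>"
      unfolding \<Phi>_def quartic_def R_def W_def
      by (intro smooth_map_on_add smooth_map_on_mult smooth_map_on_power smooth_map_on_sum smooth_map_on_inner
          smooth_map_on_scaleR smooth_map_on_matrix_vector_mult smooth_proj_other smooth_map_on_vec_nth
          smooth_map_on_const sfst smooth smooth_map_on_fst smooth_map_on_snd smooth_map_on_ident open_UNIV)
    then have "((\<lambda>t. \<Phi> (t, t *\<^sub>R Y x t, Y x t, 0)) \<longlongrightarrow> \<Phi> (0, 0, L x, 0)) (at 0)"
      by (rule continuous_smooth_tendsto) (intro tendsto_Pair tendsto_ident_at limh limY tendsto_const)
    moreover have "\<forall>\<^sub>F t in at 0. \<Phi> (t, t *\<^sub>R Y x t, Y x t, 0) = t^2 * nf x + Q (?P x)"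
      using evU[of x]
    proof eventually_elim
      case (elim t)
      have "t^2 * \<Phi> (t, t *\<^sub>R Y x t, Y x t, 0) = t^2 * (t^2 * nf x + Q (?P x))"
        using fnf[OF elim] hom[of t "Y x t"] by (simp add: \<Phi>_def algebra_simps power2_eq_square numeral_eq_Suc)
      then show ?case using elim by simp
    qed
    ultimately have "((\<lambda>t. t^2 * nf x + Q (?P x)) \<longlongrightarrow> \<Phi> (0, 0, L x, 0)) (at 0)"
      by (rule Lim_transform_eventually)
    moreover have "((\<lambda>t. t^2 * nf x + Q (?P x)) \<longlongrightarrow> Q (?P x)) (at 0)"
      by (auto intro!: tendsto_eq_intros)
    ultimately have "\<Phi> (0, 0, L x, 0) = Q (?P x)" by (rule LIM_unique)
    then show ?thesis by (simp add: \<Phi>_def K)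
  qed
  have KP: "K *v ?P v = K *v v" for v
  proof -
    have "K *v (v - ?P v) = 0"
      using Kplane[of "v - ?P v"] by (simp add: linear_diff[OF linear_proj_other] proj_other_idem)
    then show ?thesis by (simp add: matrix_vector_mult_diff_distrib)
  qed
  have PK: "?P u \<bullet> (K *v v) = u \<bullet> (K *v v)" for u v
    using Ksym[of "?P u" v] Ksym[of v u] KP[of u] by simp
  have KL: "L x \<bullet> (K *v L x) = Q (?P x)" for x using order2[of x] by (simp add: KP PK)
  have plane: "?P (L x) = 0" if x: "?P x = 0" for x
  proof -
    have "v \<bullet> (K *v L x) = 0" for v
    proof -
      obtain u where u: "L u = v" using Lsurj by blast
      have "(L x + L u) \<bullet> (K *v (L x + L u)) = L u \<bullet> (K *v L u)"
        using KL[of "x + u"] KL[of u] x by (simp add: linear_add[OF Llin] linear_add[OF linear_proj_other])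
      then show ?thesis
        using KL[of x] Ksym[of "L x" "L u"] x u by (simp add: Q0 matrix_vector_right_distrib inner_add_left inner_add_right)
    qed
    then have "K *v L x = 0" by (metis inner_eq_zero_iff)
    then show ?thesis using Kplane by blast
  qed
  have order4: "quartic A B C D E (L x $ i) (L x $ j) = nf x" if x: "?P x = 0" for x
  proof -
    define w where "w t = (1 / t) *\<^sub>R ?P (Y x t)" for t
    have limw: "(w \<longlongrightarrow> 0) (at 0)"
    proof (rule vec_tendstoI)
      fix b
      show "((\<lambda>t. w t $ b) \<longlongrightarrow> 0 $ b) (at 0)"
      proof (cases "b = i \<or> b = j")
        case True
        then show ?thesis by (auto simp: w_def proj_other_def)
      next
        case False
        then have "dirD x h 0 $ b = ?P (L x) $ b" by (simp add: L_def proj_other_def)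
        then have "dirD x h 0 $ b = 0" using plane[OF x] by simp
        from odd_smooth_quadratic_remainder[OF U(1,3,5,7) this]
        show ?thesis using False by (simp add: w_def Y_def proj_other_def power2_eq_square)
      qed
    qed
    define \<Phi> where "\<Phi> p = quartic A B C D E (fst (snd (snd p)) $ i) (fst (snd (snd p)) $ j)
      + fst p * R (fst (snd p)) (fst (snd (snd p))) + W (fst (snd p)) (fst (snd (snd p)))
      + snd (snd (snd p)) \<bullet> (S (fst (snd p)) *v snd (snd (snd p)))" for p :: "real \<times> (real ^ 'n) \<times> (real ^ 'n) \<times> (real ^ 'n)"
    have "smooth_map_on UNIV \<Phi>"
      unfolding \<Phi>_def quartic_def R_def W_def
      by (intro smooth_map_on_add smooth_map_on_mult smooth_map_on_power smooth_map_on_sum smooth_map_on_inner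
          smooth_map_on_scaleR smooth_map_on_matrix_vector_mult smooth_proj_other smooth_map_on_vec_nth
          smooth_map_on_const sfst smooth smooth_map_on_fst smooth_map_on_snd smooth_map_on_ident open_UNIV)
    then have "((\<lambda>t. \<Phi> (t, t *\<^sub>R Y x t, Y x t, w t)) \<longlongrightarrow> \<Phi> (0, 0, L x, 0)) (at 0)"
      by (rule continuous_smooth_tendsto) (intro tendsto_Pair tendsto_ident_at limh limY limw)
    moreover have "\<forall>\<^sub>F t in at 0. \<Phi> (t, t *\<^sub>R Y x t, Y x t, w t) = nf x"
      using evU[of x]
    proof eventually_elim
      case (elim t)
      have "?P (Y x t) = t *\<^sub>R w t" using elim by (simp add: w_def)
      then have "?P (Y x t) \<bullet> (S (t *\<^sub>R Y x t) *v ?P (Y x t)) = t^2 * (w t \<bullet> (S (t *\<^sub>R Y x t) *v w t))"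
        by (simp add: matrix_vector_mult_scaleR power2_eq_square)
      then have "t^4 * \<Phi> (t, t *\<^sub>R Y x t, Y x t, w t) = t^4 * nf x"
        using fnf[OF elim] hom[of t "Y x t"] x by (simp add: \<Phi>_def Q0 algebra_simps numeral_eq_Suc)
      then show ?case using elim by simp
    qed
    ultimately have "((\<lambda>t::real. nf x) \<longlongrightarrow> \<Phi> (0, 0, L x, 0)) (at 0)"
      by (rule Lim_transform_eventually)
    then have "\<Phi> (0, 0, L x, 0) = nf x" using LIM_unique tendsto_const by blast
    then show ?thesis using plane[OF x] by (simp add: \<Phi>_def W_def)
  qed
  have "quartic \<sigma> 0 \<kappa> 0 \<tau> x y = quartic A B C D E (L (axis i 1) $ i * x + L (axis j 1) $ i * y)
     (L (axis i 1) $ j * x + L (axis j 1) $ j * y)" for x y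
  proof -
    define v where "v = x *\<^sub>R axis i 1 + y *\<^sub>R (axis j 1 :: real ^ 'n)"
    have "?P v = 0" by (auto simp: v_def proj_other_def vec_eq_iff axis_def)
    moreover have "v $ i = x" "v $ j = y" using ij by (auto simp: v_def axis_def)
    moreover have "L v = x *\<^sub>R L (axis i 1) + y *\<^sub>R L (axis j 1)"
      by (simp add: v_def linear_add[OF Llin] linear_scale[OF Llin])
    ultimately show ?thesis using order4[of v] by (simp add: nf_def quartic_def mult.commute)
  qed
  from Delta4_subst[OF this] have "Delta4 A B C D E = 0 \<Longrightarrow> Delta4 \<sigma> 0 \<kappa> 0 \<tau> = 0" by simp
  moreover have "Delta4 \<sigma> 0 \<kappa> 0 \<tau> = 16 * \<sigma> * \<tau> * (\<kappa>^2 - 4 * \<sigma> * \<tau>)^2" by (simp add: Delta4_def)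
  moreover have "\<kappa>^2 - 4 * \<sigma> * \<tau> \<noteq> 0" 
  proof -
    have "\<kappa>^2 \<noteq> - 4" using zero_le_power2[of \<kappa>] by linarith
    then show ?thesis using \<sigma>\<tau> \<kappa> by auto
  qed
  ultimately show ?thesis using \<sigma>\<tau> by auto
qed

theorem mainTheorem6:
  fixes f :: "real ^ 'n \<Rightarrow> real" and i1 i2 :: "'n::finite" and A B C D E :: real
  assumes "i1 \<noteq> i2"
    and "smooth_map_on UNIV f"
    and "\<And>k. f (- k) = f k"
    and "bilinear_kernel (second_differential f 0) = coord_plane i1 i2"
    and "A = 1 / fact 4 * (partial_deriv i1 ^^ 4) f 0"
    and "B = 1 / fact 3 * (partial_deriv i1 ^^ 3) (partial_deriv i2 f) 0"
    and "C = 1 / 4 * (partial_deriv i1 ^^ 2) ((partial_deriv i2 ^^ 2) f) 0"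
    and "D = 1 / fact 3 * partial_deriv i1 ((partial_deriv i2 ^^ 3) f) 0"
    and "E = 1 / fact 4 * (partial_deriv i2 ^^ 4) f 0"
  shows "((\<exists>\<sigma>\<in>{1, -1}. \<exists>\<tau>\<in>{1, -1}. f \<in> X_e5 i1 i2 \<sigma> \<tau>) \<longleftrightarrow> Delta4 A B C D E \<noteq> 0)
    \<and> (Delta4 A B C D E > 0 \<longrightarrow> f \<in> X_e5 i1 i2 1 1 \<union> X_e5 i1 i2 (-1) (-1))
    \<and> (Delta4 A B C D E < 0 \<longrightarrow> f \<in> X_e5 i1 i2 1 (-1))"
proof -
  obtain r s S where smooth: "\<And>k. smooth_map_on UNIV (r k)" "\<And>k. smooth_map_on UNIV (s k)" "smooth_map_on UNIV S"
    and parity: "\<And>k v. k \<le> 5 \<Longrightarrow> r k (- v) = - r k v" "\<And>k v. k \<le> 3 \<Longrightarrow> s k (- v) = s k v" "\<And>v. S (- v) = S v"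
    and S0: "\<And>u v. u \<bullet> (S 0 *v v) = second_differential f 0 u v / 2"
    and f: "\<And>v. f v = f 0 + quartic A B C D E (v $ i1) (v $ i2) + (\<Sum>k\<le>5. (v $ i1) ^ (5 - k) * (v $ i2) ^ k * r k v)
      + (\<Sum>k\<le>3. ((v $ i1) ^ (3 - k) * (v $ i2) ^ k) *\<^sub>R s k v) \<bullet> proj_other i1 i2 v
      + proj_other i1 i2 v \<bullet> (S v *v proj_other i1 i2 v)"
    using even_function_decomposition[OF assms] by blast
  note K = hessian_matrix_properties[OF assms(1,2,4) S0]
  have normal: "\<exists>\<sigma>\<in>{1, -1}. \<exists>\<tau>\<in>{1, -1}. f \<in> X_e5 i1 i2 \<sigma> \<tau> \<and> (Delta4 A B C D E > 0 \<longrightarrow> \<sigma> = \<tau>)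
      \<and> (Delta4 A B C D E < 0 \<longrightarrow> \<sigma> = 1 \<and> \<tau> = -1)" if nz: "Delta4 A B C D E \<noteq> 0"
  proof -
    obtain U V h where h: "odd_diffeo U V h"
      "\<And>x. x \<in> U \<Longrightarrow> f (h x) = f 0 + quartic A B C D E (x $ i1) (x $ i2)
        + proj_other i1 i2 x \<bullet> (S 0 *v proj_other i1 i2 x)"
      using even_function_splitting[OF assms(1) smooth parity refl K f nz] by blast
    obtain a b c d k \<sigma> \<tau> where n: "a*d - b*c \<noteq> 0" "\<sigma> \<in> {1, -1}" "\<tau> \<in> {1, -1}"
      "\<sigma> = \<tau> \<Longrightarrow> k^2 \<noteq> 4" "Delta4 A B C D E > 0 \<Longrightarrow> \<sigma> = \<tau>" "Delta4 A B C D E < 0 \<Longrightarrow> \<sigma> = 1 \<and> \<tau> = -1"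
      "\<And>x y. quartic A B C D E (a*x + b*y) (c*x + d*y) = quartic \<sigma> 0 k 0 \<tau> x y"
      using quartic_normal_form[OF nz] by metis
    have "f \<in> X_e5 i1 i2 \<sigma> \<tau>"
      by (rule X_e5_linear_change[OF assms(1,3) h nondegenerate_matrix_form[OF K] n(1,7,4)])
    then show ?thesis using n(2,3,5,6) by blast
  qed
  have nonzero: "Delta4 A B C D E \<noteq> 0" if "f \<in> X_e5 i1 i2 \<sigma> \<tau>" "\<sigma> \<in> {1, -1}" "\<tau> \<in> {1, -1}" for \<sigma> \<tau>
    by (rule X_e5_imp_Delta4_nonzero[OF assms(1) smooth refl K f that])
  show ?thesis
  proof (intro conjI iffI impI)
    show "Delta4 A B C D E \<noteq> 0" if "\<exists>\<sigma>\<in>{1, -1}. \<exists>\<tau>\<in>{1, -1}. f \<in> X_e5 i1 i2 \<sigma> \<tau>"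
      using that nonzero by blast
    show "\<exists>\<sigma>\<in>{1, -1}. \<exists>\<tau>\<in>{1, -1}. f \<in> X_e5 i1 i2 \<sigma> \<tau>" if "Delta4 A B C D E \<noteq> 0"
      using normal[OF that] by blast
    show "f \<in> X_e5 i1 i2 1 1 \<union> X_e5 i1 i2 (-1) (-1)" if "Delta4 A B C D E > 0"
      using normal that by fastforce
    show "f \<in> X_e5 i1 i2 1 (-1)" if "Delta4 A B C D E < 0"
      using normal that by fastforce
  qed
qed

end
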